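(* Let $M>0$ and let $\Phi\in C^1([0,\infty[)\cap C^2(]0,\infty[)$ satisfy $\Phi(0)=0=\Phi'(0)$ and: ($\Phi1$) $\Phi$ is strictly convex; ($\Phi2$) $\Phi(\rho)\ge C\rho^{1+1/n}$ for all sufficiently large $\rho\ge 0$, for some constants $C>0$ and $0<n<3$; ($\Phi3$) $\Phi(\rho)\le C\rho^{1+1/n'}$ for all sufficiently small $\rho\ge 0$, for some constants $C>0$ and $0<n'<3$. Suppose that $\rho_0\in\mathcal F_M$ is a minimizer of the functional $\mathcal H_r$ over $\mathcal F_M$, and let $V_0:=V_{\rho_0}$ be its induced potential. Then there exists a Lagrange multiplier $E_0\le 0$ such that \[ \rho_0=\begin{cases}(\Phi')^{-1}(E_0-V_0), & V_0<E_0,\\ 0, & V_0\ge E_0.\end{cases} \] The functions $\rho_0$ and $V_0$ are spherically symmetric with respect to some point of $\mathbb R^3$; as functions of the radial variable, $\rho_0$ is decreasing and $V_0$ is increasing; $\rho_0\in C(\mathbb R^3)$ with finite mass $M$, $V_0\in C^2(\mathbb R^3)$ with $\lim_{|x|\to\infty}V_0(x)=0$; and $(\rho_0,u_0=0)$ is a time-independent solution of the Euler–Poisson system \[ \partial_t\rho+\nabla\cdot(\rho u)=0,\quad \rho\partial_t u+\rho(u\cdot\nabla)u=-\nabla p-\rho\nabla V,\quad \Delta V=4\pi\rho,\ \lim_{|x|\to\infty}V(t,x)=0, \] with equation of state $p=P(\rho)$, $P(\rho)=\int_0^\rho\sigma\,\Phi''(\sigma)\,d\sigma$. If moreover $\Phi'(\rho)\le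 C\rho^{1/n'}$ for all sufficiently small $\rho\ge0$, then $E_0<0$ and $\rho_0$ has compact support.
   Context: For a function $\rho$ on $\mathbb R^3$, the induced potential is $V_\rho(x):=-\int_{\mathbb R^3}\frac{\rho(y)}{|x-y|}\,dy$ and the potential energy is $E_{\rm pot}(\rho):=-\frac12\iint\frac{\rho(x)\rho(y)}{|x-y|}\,dy\,dx$. The reduced energy functional is $\mathcal H_r(\rho):=\int_{\mathbb R^3}\Phi(\rho(x))\,dx+E_{\rm pot}(\rho)$, and the constraint set is $\mathcal F_M:=\{\rho\in L^1(\mathbb R^3)\mid \rho\ge0,\ \int\Phi(\rho)\,dx<\infty,\ \int\rho\,dx=M\}$. A minimizer means $\rho_0\in\mathcal F_M$ with $\mathcal H_r(\rho_0)=\inf_{\mathcal F_M}\mathcal H_r$; $\rho_0$ is understood as a pointwise defined representative. Under the assumptions on $\Phi$, $\Phi'$ is invertible on $[0,\infty[$. *)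

theory Defs
  imports "HOL-Analysis.Analysis"
begin

type_synonym R3 = "real^3"

definition strict_convex_on :: "real set \<Rightarrow> (real \<Rightarrow> real) \<Rightarrow> bool" where
  "strict_convex_on S f \<longleftrightarrow> (\<forall>x\<in>S. \<forall>y\<in>S. \<forall>t. x \<noteq> y \<and> 0 < t \<and> t < 1 \<longrightarrow>
      f ((1 - t) * x + t * y) < (1 - t) * f x + t * f y)"

definition Vpot :: "(R3 \<Rightarrow> real) \<Rightarrow> R3 \<Rightarrow> real" where
  "Vpot \<rho> x = - (\<integral>y. \<rho> y / norm (x - y) \<partial>lborel)"

definition Epot :: "(R3 \<Rightarrow> real) \<Rightarrow> real" where
  "Epot \<rho> = - (1/2) * (\<integral>x. (\<integral>y. \<rho> x * \<rho> y / norm (x - y) \<partial>lborel) \<partial>lborel)"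

definition Hr :: "(real \<Rightarrow> real) \<Rightarrow> (R3 \<Rightarrow> real) \<Rightarrow> real" where
  "Hr \<Phi> \<rho> = (\<integral>x. \<Phi> (\<rho> x) \<partial>lborel) + Epot \<rho>"

text \<open>The constraint set \<open>F_M\<close> (note \<open>\<Phi> \<ge> 0\<close> under the standing assumptions,
  so finiteness of \<open>\<integral>\<Phi>(\<rho>)\<close> is integrability).\<close>
definition FM :: "(real \<Rightarrow> real) \<Rightarrow> real \<Rightarrow> (R3 \<Rightarrow> real) set" where
  "FM \<Phi> M = {\<rho>. integrable lborel \<rho> \<and> (\<forall>x. 0 \<le> \<rho> x) \<and>
       integrable lborel (\<lambda>x. \<Phi> (\<rho> x)) \<and> (\<integral>x. \<rho> x \<partial>lborel) = M}"

definition is_minimizer :: "(real \<Rightarrow> real) \<Rightarrow> real \<Rightarrow> (R3 \<Rightarrow> real) \<Rightarrow> bool" where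
  "is_minimizer \<Phi> M \<rho>0 \<longleftrightarrow> \<rho>0 \<in> FM \<Phi> M \<and> (\<forall>\<rho>\<in>FM \<Phi> M. Hr \<Phi> \<rho>0 \<le> Hr \<Phi> \<rho>)"

definition grad :: "(R3 \<Rightarrow> real) \<Rightarrow> R3 \<Rightarrow> R3" where
  "grad f x = (\<chi> i. frechet_derivative f (at x) (axis i 1))"

definition divg :: "(R3 \<Rightarrow> R3) \<Rightarrow> R3 \<Rightarrow> real" where
  "divg F x = (\<Sum>i\<in>UNIV. frechet_derivative F (at x) (axis i 1) $ i)"

definition lap :: "(R3 \<Rightarrow> real) \<Rightarrow> R3 \<Rightarrow> real" where
  "lap f x = divg (grad f) x"

definition C2 :: "(R3 \<Rightarrow> real) \<Rightarrow> bool" where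
  "C2 f \<longleftrightarrow> (\<forall>x. f differentiable at x) \<and> (\<forall>x. grad f differentiable at x) \<and>
     (\<forall>i j. continuous_on UNIV (\<lambda>x. frechet_derivative (grad f) (at x) (axis i 1) $ j))"

definition EP_solution :: "(real \<Rightarrow> real) \<Rightarrow> (real \<Rightarrow> R3 \<Rightarrow> real) \<Rightarrow> (real \<Rightarrow> R3 \<Rightarrow> R3)
     \<Rightarrow> (real \<Rightarrow> R3 \<Rightarrow> real) \<Rightarrow> bool" where
  "EP_solution P \<rho> u V \<longleftrightarrow>
     (\<forall>t x.
        (\<lambda>s. \<rho> s x) differentiable at t \<and>
        (\<lambda>y. \<rho> t y *\<^sub>R u t y) differentiable at x \<and>
        (\<lambda>s. u s x) differentiable at t \<and>
        u t differentiable at x \<and>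
        (\<lambda>y. P (\<rho> t y)) differentiable at x \<and>
        V t differentiable at x \<and>
        grad (V t) differentiable at x \<and>
        vector_derivative (\<lambda>s. \<rho> s x) (at t) + divg (\<lambda>y. \<rho> t y *\<^sub>R u t y) x = 0 \<and>
        \<rho> t x *\<^sub>R vector_derivative (\<lambda>s. u s x) (at t)
          + \<rho> t x *\<^sub>R frechet_derivative (u t) (at x) (u t x)
          = - grad (\<lambda>y. P (\<rho> t y)) x - \<rho> t x *\<^sub>R grad (V t) x \<and>
        lap (V t) x = 4 * pi * \<rho> t x) \<and>
     (\<forall>t. (V t \<longlongrightarrow> 0) at_infinity)"

end

theory Submission
  imports Defs
begin

text \<open>
  \<^bold>\<open>Symmetry.\<close> Polarizing a density with respect to a hyperplane (putting the larger of the two values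
  at mirror points on a fixed side) preserves the mass and the Casimir term and does not decrease the
  Coulomb energy; the energy stays the same only if the polarization is trivial.  Hence for every hyperplane the
  minimizer dominates its mirror image on one of the two sides.  At a hyperplane that bisects the mass
  it then equals its mirror image.  Three orthogonal bisecting hyperplanes give a centre \<open>c\<close> of point
  symmetry, so every hyperplane through \<open>c\<close> bisects the mass, and any other hyperplane has the larger
  values on the side of \<open>c\<close>.  Reflecting \<open>x\<close> to \<open>y\<close> shows that the potential at
  every point is determined by, and monotone in, the distance to \<open>c\<close>; the density inherits this
  through the Euler--Lagrange equation \<open>\<rho> = (\<Phi>')\<^sup>-\<^sup>1 (max 0 (E\<^sub>0 - V))\<close>, which comes from the first
  variation along segments towards multiples of indicator functions.

  \<^bold>\<open>Regularity.\<close> By Newton's shell theorem the potential of a radial density is the integral of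
  \<open>\<rho> y / max |x| |y|\<close>.  The bound \<open>\<Phi> r \<ge> C r^(1+1/n)\<close> with \<open>n < 3\<close> puts the
  density in \<open>L^(4/3)\<close>, and one bootstrap through the Euler--Lagrange equation makes the potential
  bounded, hence continuous; a continuous radial density has a \<open>C\<^sup>2\<close> potential.
  The pressure is the Legendre transform of \<open>\<Phi>\<close> evaluated at \<open>E\<^sub>0 - V\<close>, whose derivative is the density.

  \<^bold>\<open>Cut-off.\<close> If \<open>E\<^sub>0 = 0\<close>, then \<open>-V \<ge> k / |x|\<close> at large distances and the bound on \<open>\<Phi>'\<close> would force
  \<open>\<rho> \<ge> c |x|^(-n')\<close> with \<open>n' < 3\<close>, which has infinite mass.
\<close>

section \<open>Reflections\<close>

text \<open>\<open>Vpot\<close> and \<open>Epot\<close> are Bochner integrals, which silently become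
  0 where they diverge. Energies are therefore manipulated only on \<open>energy_class\<close>,
  densities in L^1 and L^(4/3), where the Coulomb integral converges absolutely; 4/3 is the value of
  1 + 1/n at the excluded endpoint n = 3. Pointwise comparisons of potentials are made for
  \<open>newton\<close>, with values in \<open>ennreal\<close>, since finiteness at every point is
  available only after the bootstrap.

  Polarization replaces symmetric decreasing rearrangement because its equality case is elementary:
  after folding, the gain in energy is the integral of an explicit nonnegative function of pairs of
  points. Symmetry precedes regularity: for a radial density the shell theorem reduces all questions
  of regularity to calculus in one variable. The density is determined only almost everywhere, so
  monotonicity is proved for the potential, which is defined at every point, and transferred from
  there.\<close>

definition hrefl :: "R3 \<Rightarrow> real \<Rightarrow> R3 \<Rightarrow> R3" where
  "hrefl e t x = x - (2 * (x \<bullet> e - t)) *\<^sub>R e"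

lemma hrefl_inner: "norm e = 1 \<Longrightarrow> hrefl e t x \<bullet> e = 2 * t - x \<bullet> e"
  by (simp add: hrefl_def inner_diff_left dot_square_norm)

lemma hrefl_hrefl [simp]: "norm e = 1 \<Longrightarrow> hrefl e t (hrefl e t x) = x"
  by (simp add: hrefl_def[of e t "hrefl e t x"] hrefl_inner) (simp add: hrefl_def algebra_simps flip: scaleR_add_left)

lemma hrefl_diff: "hrefl e t x - hrefl e t y = hrefl e 0 (x - y)"
  by (simp add: hrefl_def inner_diff_left algebra_simps)

lemma norm_hrefl_0:
  assumes "norm e = 1" shows "norm (hrefl e 0 x) = norm x"
proof -
  have "e \<bullet> e = 1" using assms by (simp add: dot_square_norm)
  then show ?thesis
    by (simp add: norm_eq hrefl_def inner_diff_left inner_diff_right inner_commute)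
qed

lemma norm_hrefl_diff: "norm e = 1 \<Longrightarrow> norm (hrefl e t x - hrefl e t y) = norm (x - y)"
  by (simp add: hrefl_diff norm_hrefl_0)

lemma norm_hrefl_diff': "norm e = 1 \<Longrightarrow> norm (hrefl e t x - y) = norm (x - hrefl e t y)"
  by (metis norm_hrefl_diff hrefl_hrefl)

text \<open>The source of every kernel comparison below: \<open>x\<close> is closer to
  \<open>y\<close> than to the mirror image of \<open>y\<close> exactly when both points lie
  strictly on the same side.\<close>

lemma norm_diff_hrefl_power2:
  assumes "norm e = 1"
  shows "(norm (x - hrefl e t y))\<^sup>2 = (norm (x - y))\<^sup>2 + 4 * (x \<bullet> e - t) * (y \<bullet> e - t)"
proof -
  have "e \<bullet> e = 1" using assms by (simp add: dot_square_norm)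
  then show ?thesis
    unfolding power2_norm_eq_inner hrefl_def
    by (simp add: inner_diff_left inner_diff_right inner_commute algebra_simps)
qed

lemma borel_measurable_hrefl [measurable]: "hrefl e t \<in> borel \<rightarrow>\<^sub>M borel"
  unfolding hrefl_def [abs_def] by measurable

lemma orthogonal_hrefl: "norm e = 1 \<Longrightarrow> orthogonal_transformation (hrefl e 0)"
  unfolding orthogonal_transformation
  using norm_hrefl_0[of e] by (auto simp: hrefl_def inner_add_left algebra_simps intro!: linearI)

lemma lborel_distr_hrefl:
  assumes e: "norm e = 1"
  shows "distr lborel borel (hrefl e t) = lborel"
proof (rule lborel_eqI[symmetric])
  fix l u :: R3 assume le: "\<And>b. b \<in> Basis \<Longrightarrow> l \<bullet> b \<le> u \<bullet> b"
  \<comment> \<open>An affine reflection is the linear one followed by a translation along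
    \<open>e\<close>; both preserve Lebesgue measure.\<close>
  have vi: "hrefl e t -` box l u = (\<lambda>x. (2 * t) *\<^sub>R e + x) ` (hrefl e 0 ` box l u)"
  proof -
    have "hrefl e t -` box l u = hrefl e t ` box l u"
      using e by (force simp: image_iff)
    also have "\<dots> = (\<lambda>x. (2 * t) *\<^sub>R e + x) ` (hrefl e 0 ` box l u)"
      by (simp add: image_image hrefl_def algebra_simps)
    finally show ?thesis .
  qed
  have lm: "hrefl e 0 ` box l u \<in> lmeasurable"
    by (rule measurable_orthogonal_image) (auto simp: orthogonal_hrefl e)
  have lm2: "hrefl e t -` box l u \<in> lmeasurable"
    unfolding vi by (rule measurable_translation) (rule lm)
  have "measure lebesgue (hrefl e t -` box l u) = measure lebesgue (hrefl e 0 ` box l u)"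
    unfolding vi by (rule measure_translation)
  also have "\<dots> = measure lebesgue (box l u)"
    by (rule measure_orthogonal_image) (auto simp: orthogonal_hrefl e)
  finally have m: "measure lebesgue (hrefl e t -` box l u) = measure lebesgue (box l u)" .
  have [simp]: "hrefl e t -` box l u \<in> sets borel"
    by (rule measurable_sets_borel[of _ borel]) auto
  have "emeasure (distr lborel borel (hrefl e t)) (box l u) = emeasure lborel (hrefl e t -` box l u)"
    by (subst emeasure_distr) auto
  also have "\<dots> = emeasure lebesgue (hrefl e t -` box l u)"
    by simp
  also have "\<dots> = emeasure lebesgue (box l u)"
    using m lm2 by (metis emeasure_eq_measure2 lmeasurable_box)
  finally show "emeasure (distr lborel borel (hrefl e t)) (box l u) = (\<Prod>b\<in>Basis. (u - l) \<bullet> b)"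
    using le by (simp add: emeasure_lborel_box)
qed simp

lemma AE_hrefl:
  assumes e: "norm e = 1" and P: "AE x in lborel. P x"
  shows "AE x in lborel. P (hrefl e t x)"
proof -
  have "AE x in distr lborel borel (hrefl e t). P x" using P unfolding lborel_distr_hrefl[OF e] .
  from AE_distrD[OF _ this] show ?thesis by simp
qed

lemma nn_integral_hrefl:
  assumes e: "norm e = 1" and [measurable]: "f \<in> borel_measurable borel"
  shows "(\<integral>\<^sup>+x. f (hrefl e t x) \<partial>lborel) = (\<integral>\<^sup>+x. f x \<partial>lborel)"
  by (subst (2) lborel_distr_hrefl[OF e, of t, symmetric]) (simp add: nn_integral_distr)

lemma integral_hrefl:
  fixes f :: "R3 \<Rightarrow> real"
  assumes e: "norm e = 1" and [measurable]: "f \<in> borel_measurable borel"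
  shows "(\<integral>x. f (hrefl e t x) \<partial>lborel) = (\<integral>x. f x \<partial>lborel)"
  by (subst (2) lborel_distr_hrefl[OF e, of t, symmetric]) (simp add: integral_distr)

lemma integrable_hrefl:
  fixes f :: "R3 \<Rightarrow> real"
  assumes e: "norm e = 1" and "integrable lborel f"
  shows "integrable lborel (\<lambda>x. f (hrefl e t x))"
proof -
  have "integrable (distr lborel borel (hrefl e t)) f"
    using assms(2) unfolding lborel_distr_hrefl[OF e] .
  from integrable_distr[OF _ this] show ?thesis by simp
qed

lemma AE_inner_neq:
  fixes e :: R3 assumes "e \<noteq> 0" shows "AE x in lborel. x \<bullet> e \<noteq> t"
proof -
  have "negligible {x. e \<bullet> x = t}" using assms by (intro negligible_hyperplane) auto
  then have "{x. e \<bullet> x = t} \<in> null_sets lborel"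
    by (simp add: negligible_iff_null_sets null_sets_completion_iff)
  then show ?thesis by (rule AE_I') (auto simp: inner_commute)
qed

section \<open>Newton's shell theorem\<close>

definition vec3 :: "(real \<times> real) \<times> real \<Rightarrow> R3" where
  "vec3 p = vector [fst (fst p), snd (fst p), snd p]"

lemma vec3_nth [simp]: "vec3 p $ 1 = fst (fst p)" "vec3 p $ 2 = snd (fst p)" "vec3 p $ 3 = snd p"
  by (simp_all add: vec3_def vector_3)

lemma borel_measurable_vec3 [measurable]: "vec3 \<in> borel \<rightarrow>\<^sub>M borel"
proof (rule borel_measurable_continuous_onI)
  have "continuous_on UNIV (\<lambda>p. \<chi> i. vec3 p $ i)"
  proof (rule continuous_on_vec_lambda)
    fix i :: 3
    consider "i = 1" | "i = 2" | "i = 3" using exhaust_3[of i] by auto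
    then show "continuous_on UNIV (\<lambda>p. vec3 p $ i)"
      by cases (auto intro!: continuous_intros)
  qed
  then show "continuous_on UNIV vec3" by simp
qed

lemma norm_vec3_power2: "(norm (vec3 (w, s)))\<^sup>2 = (norm w)\<^sup>2 + s\<^sup>2"
  by (simp add: power2_norm_eq_inner inner_vec_def sum_3) (cases w, simp add: power2_eq_square)

text \<open>Transfers Fubini to \<open>R3\<close>. The plane is kept as one Euclidean factor, so
  that the area of its discs is available.\<close>

lemma lborel_distr_vec3: "distr (lborel \<Otimes>\<^sub>M lborel) borel vec3 = lborel"
proof (rule lborel_eqI[symmetric])
  fix l u :: R3 assume le: "\<And>b. b \<in> Basis \<Longrightarrow> l \<bullet> b \<le> u \<bullet> b"
  have "l $ i \<le> u $ i" for i
    using le[of "axis i 1"] by (simp add: inner_axis axis_in_Basis_iff)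
  from this[of 1] this[of 2] this[of 3] have le': "l $ 1 \<le> u $ 1" "l $ 2 \<le> u $ 2" "l $ 3 \<le> u $ 3" .
  have vi: "vec3 -` box l u = ({l $ 1 <..< u $ 1} \<times> {l $ 2 <..< u $ 2}) \<times> {l $ 3 <..< u $ 3}"
    by (auto simp: mem_box_cart forall_3)
  have "(\<Prod>b\<in>Basis. (u - l) \<bullet> b) = (\<Prod>i\<in>UNIV. (u - l) $ i)"
  proof -
    have "(Basis :: R3 set) = range (\<lambda>i. axis i 1)" by (auto simp: Basis_vec_def)
    moreover have "inj (\<lambda>i::3. axis i (1::real))" by (auto simp: inj_on_def axis_eq_axis)
    ultimately have "(\<Prod>b\<in>Basis. (u - l) \<bullet> b) = (\<Prod>i\<in>UNIV. (u - l) \<bullet> axis i 1)"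
      by (metis (mono_tags, lifting) prod.reindex_cong)
    then show ?thesis by (simp add: inner_axis)
  qed
  also have "\<dots> = (u $ 1 - l $ 1) * (u $ 2 - l $ 2) * (u $ 3 - l $ 3)"
    unfolding UNIV_3 by simp
  finally have B: "(\<Prod>b\<in>Basis. (u - l) \<bullet> b) = (u $ 1 - l $ 1) * (u $ 2 - l $ 2) * (u $ 3 - l $ 3)" .
  have "emeasure (distr (lborel \<Otimes>\<^sub>M lborel) borel vec3) (box l u) = emeasure (lborel \<Otimes>\<^sub>M lborel) (vec3 -` box l u)"
    by (subst emeasure_distr) (auto simp: lborel_prod)
  also have "\<dots> = emeasure (lborel \<Otimes>\<^sub>M lborel) ({l $ 1 <..< u $ 1} \<times> {l $ 2 <..< u $ 2}) * emeasure lborel {l $ 3 <..< u $ 3}"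
    unfolding vi lborel_prod[where 'a=real and 'b=real, symmetric]
    by (subst lborel.emeasure_pair_measure_Times[of _ "lborel \<Otimes>\<^sub>M lborel"]) auto
  also have "\<dots> = ennreal (u $ 1 - l $ 1) * ennreal (u $ 2 - l $ 2) * ennreal (u $ 3 - l $ 3)"
    using le' by (subst lborel.emeasure_pair_measure_Times) auto
  also have "\<dots> = (\<Prod>b\<in>Basis. (u - l) \<bullet> b)"
    using le' by (simp add: B ennreal_mult)
  finally show "emeasure (distr (lborel \<Otimes>\<^sub>M lborel) borel vec3) (box l u) = (\<Prod>b\<in>Basis. (u - l) \<bullet> b)" .
qed simp

lemma nn_integral_vec3:
  assumes [measurable]: "f \<in> borel_measurable borel"
  shows "(\<integral>\<^sup>+x. f x \<partial>lborel) = (\<integral>\<^sup>+s. \<integral>\<^sup>+w. f (vec3 (w, s)) \<partial>lborel \<partial>lborel)"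
proof -
  have "(\<integral>\<^sup>+x. f x \<partial>lborel) = (\<integral>\<^sup>+p. f (vec3 p) \<partial>(lborel \<Otimes>\<^sub>M lborel))"
    by (subst lborel_distr_vec3[symmetric]) (simp add: nn_integral_distr lborel_prod)
  also have "\<dots> = (\<integral>\<^sup>+s. \<integral>\<^sup>+w. f (vec3 (w, s)) \<partial>lborel \<partial>lborel)"
    by (subst lborel_pair.nn_integral_snd[symmetric]) (auto simp: lborel_prod)
  finally show ?thesis .
qed

text \<open>A disc of radius sqrt a has area pi * a, which is linear in \<open>a\<close>; hence the
  squared radius has the constant density pi.\<close>

lemma distr_norm_power2_plane:
  "distr lborel borel (\<lambda>w::real \<times> real. (norm w)\<^sup>2) = density lborel (\<lambda>q. ennreal pi * indicator {0<..} q)"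
proof (rule measure_eqI_generator_eq)
  let ?E = "range (\<lambda>a::real. {..<a})"
  let ?M = "distr lborel borel (\<lambda>w::real \<times> real. (norm w)\<^sup>2)"
  let ?N = "density lborel (\<lambda>q. ennreal pi * indicator {0::real<..} q)"
  show "Int_stable ?E" 
  proof (rule Int_stableI)
    fix A B assume "A \<in> ?E" "B \<in> ?E"
    then obtain a b where "A = {..<a}" "B = {..<b}" by auto
    then have "A \<inter> B = {..<min a b}" by auto
    then show "A \<inter> B \<in> ?E" by blast
  qed
  have sets: "sets borel = sigma_sets UNIV ?E"
    unfolding borel_Iio by (rule sets_measure_of) simp
  show "sets ?M = sigma_sets UNIV ?E" "sets ?N = sigma_sets UNIV ?E"
    using sets by simp_all
  have M: "emeasure ?M {..<a} = ennreal (pi * max 0 a)" for a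
  proof -
    have "emeasure ?M {..<a} = emeasure lborel ((\<lambda>w::real \<times> real. (norm w)\<^sup>2) -` {..<a})"
      by (subst emeasure_distr) auto
    also have "(\<lambda>w::real \<times> real. (norm w)\<^sup>2) -` {..<a} = ball 0 (sqrt (max 0 a))"
    proof -
      have "(norm w)\<^sup>2 < a \<longleftrightarrow> norm w < sqrt (max 0 a)" for w :: "real \<times> real"
        using real_sqrt_less_iff[of "(norm w)\<^sup>2" "max 0 a"] zero_le_power2[of "norm w"]
        by (simp add: max_def split: if_splits) (smt (verit) zero_le_power2)
      then show ?thesis by auto
    qed
    also have "emeasure lborel \<dots> = ennreal (pi * max 0 a)"
      by (subst emeasure_ball) (auto simp: unit_ball_vol_2)
    finally show ?thesis .
  qed
  have N: "emeasure ?N {..<a} = ennreal (pi * max 0 a)" for a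
  proof -
    have "emeasure ?N {..<a} = (\<integral>\<^sup>+q. ennreal pi * indicator {0<..<a} q \<partial>lborel)"
      by (subst emeasure_density) (auto intro!: nn_integral_cong simp: indicator_def)
    also have "\<dots> = ennreal pi * emeasure lborel {0<..<a}"
      by (subst nn_integral_cmult) auto
    also have "\<dots> = ennreal (pi * max 0 a)"
      by (cases "a \<ge> 0") (auto simp: ennreal_mult max_def)
    finally show ?thesis .
  qed
  show "emeasure ?M X = emeasure ?N X" if "X \<in> ?E" for X
    using that M N by auto
  show "range (\<lambda>i. {..<real i}) \<subseteq> ?E" by auto
  show "(\<Union>i. {..<real i}) = UNIV" using reals_Archimedean2 by auto
  show "emeasure ?M {..<real i} \<noteq> \<infinity>" for i using M by simp
qed simp

lemma nn_integral_norm_power2_plane: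
  assumes [measurable]: "h \<in> borel_measurable borel"
  shows "(\<integral>\<^sup>+w. h ((norm (w :: real \<times> real))\<^sup>2) \<partial>lborel) = (\<integral>\<^sup>+q. ennreal pi * indicator {0<..} q * h q \<partial>lborel)"
proof -
  have "(\<integral>\<^sup>+w. h ((norm (w :: real \<times> real))\<^sup>2) \<partial>lborel) = (\<integral>\<^sup>+q. h q \<partial>distr lborel borel (\<lambda>w::real \<times> real. (norm w)\<^sup>2))"
    by (simp add: nn_integral_distr)
  also have "\<dots> = (\<integral>\<^sup>+q. ennreal pi * indicator {0<..} q * h q \<partial>lborel)"
    unfolding distr_norm_power2_plane by (simp add: nn_integral_density)
  finally show ?thesis .
qed

text \<open>Archimedes' hat-box theorem: the joint law of \<open>|x|\<^sup>2\<close> and of one coordinate of \<open>x\<close> is uniform.\<close>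

lemma nn_integral_norm_power2_coord:
  assumes [measurable]: "case_prod g \<in> borel_measurable (borel \<Otimes>\<^sub>M borel)"
  shows "(\<integral>\<^sup>+x. g ((norm (x::R3))\<^sup>2) (x $ 3) \<partial>lborel)
    = (\<integral>\<^sup>+q. \<integral>\<^sup>+s. ennreal pi * indicator {s\<^sup>2<..} q * g q s \<partial>lborel \<partial>lborel)"
proof -
  have [measurable]: "(\<lambda>x::R3. x $ 3) \<in> borel_measurable borel"
    by (intro borel_measurable_continuous_onI continuous_intros)
  have "(\<integral>\<^sup>+x. g ((norm (x::R3))\<^sup>2) (x $ 3) \<partial>lborel)
      = (\<integral>\<^sup>+s. \<integral>\<^sup>+w. g ((norm (w :: real \<times> real))\<^sup>2 + s\<^sup>2) s \<partial>lborel \<partial>lborel)"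
    by (subst nn_integral_vec3) (simp_all add: norm_vec3_power2)
  also have "\<dots> = (\<integral>\<^sup>+s. \<integral>\<^sup>+q. ennreal pi * indicator {0<..} q * g (q + s\<^sup>2) s \<partial>lborel \<partial>lborel)"
    by (intro nn_integral_cong nn_integral_norm_power2_plane) measurable
  also have "\<dots> = (\<integral>\<^sup>+s. \<integral>\<^sup>+q. ennreal pi * indicator {s\<^sup>2<..} q * g q s \<partial>lborel \<partial>lborel)"
  proof (rule nn_integral_cong)
    \<comment> \<open>For fixed \<open>s\<close> the shift by s^2 passes from the squared radius in
      the plane to the squared radius in space.\<close>
    fix s :: real
    have "(\<integral>\<^sup>+q. ennreal pi * indicator {s\<^sup>2<..} q * g q s \<partial>lborel)
      = (\<integral>\<^sup>+q. ennreal pi * indicator {s\<^sup>2<..} (s\<^sup>2 + 1 * q) * g (s\<^sup>2 + 1 * q) s \<partial>lborel)"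
      by (subst nn_integral_real_affine[where c=1 and t="s\<^sup>2"]) auto
    also have "\<dots> = (\<integral>\<^sup>+q. ennreal pi * indicator {0<..} q * g (q + s\<^sup>2) s \<partial>lborel)"
      by (intro nn_integral_cong) (auto simp: indicator_def add.commute)
    finally show "(\<integral>\<^sup>+q. ennreal pi * indicator {0<..} q * g (q + s\<^sup>2) s \<partial>lborel)
      = (\<integral>\<^sup>+q. ennreal pi * indicator {s\<^sup>2<..} q * g q s \<partial>lborel)" by simp
  qed
  also have "\<dots> = (\<integral>\<^sup>+q. \<integral>\<^sup>+s. ennreal pi * indicator {s\<^sup>2<..} q * g q s \<partial>lborel \<partial>lborel)"
  proof -
    have "(\<lambda>p. indicator {(snd p)\<^sup>2<..} (fst p) :: ennreal) = (\<lambda>p::real \<times> real. if (snd p)\<^sup>2 < fst p then 1 else 0)"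
      by (auto simp: fun_eq_iff indicator_def)
    moreover have "\<dots> \<in> borel_measurable (lborel \<Otimes>\<^sub>M lborel)" by measurable
    ultimately have [measurable]: "(\<lambda>p::real \<times> real. indicator {(snd p)\<^sup>2<..} (fst p) :: ennreal) \<in> borel_measurable (lborel \<Otimes>\<^sub>M lborel)"
      by simp
    have "(\<lambda>p. g (fst p) (snd p)) \<in> borel_measurable (lborel \<Otimes>\<^sub>M lborel)" by measurable
    then have "(\<lambda>p. ennreal pi * indicator {(snd p)\<^sup>2<..} (fst p) * g (fst p) (snd p)) \<in> borel_measurable (lborel \<Otimes>\<^sub>M lborel)"
      by measurable
    then show ?thesis
      by (intro lborel_pair.Fubini'[of "\<lambda>q s. ennreal pi * indicator {s\<^sup>2<..} q * g q s"]) (simp add: case_prod_beta')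
  qed
  finally show ?thesis .
qed

text \<open>A primitive in \<open>s\<close> is - sqrt (a^2 + q - 2 a s) / a. Its end values are, up
  to sign, |a - sqrt q| / a and (a + sqrt q) / a; their difference 2 min a (sqrt q) / a is the
  origin of the maximum in the shell theorem. The assumption \<open>q \<noteq> a\<^sup>2\<close>
  keeps the integrand finite at the end point s = sqrt q.\<close>

lemma nn_integral_inverse_dist_axis:
  assumes a: "a > 0" and q: "q > 0" "q \<noteq> a\<^sup>2"
  shows "(\<integral>\<^sup>+s. indicator {s\<^sup>2<..} q * ennreal (1 / sqrt (a\<^sup>2 + q - 2 * a * s)) \<partial>lborel)
    = ennreal (2 * sqrt q / max a (sqrt q))"
proof -
  let ?r = "sqrt q"
  have r: "?r > 0" "?r\<^sup>2 = q" "?r \<noteq> a" using q a by auto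
  have pos: "a\<^sup>2 + q - 2 * a * s > 0" if "s \<le> ?r" for s
  proof -
    have "a\<^sup>2 + q - 2 * a * s \<ge> a\<^sup>2 + ?r\<^sup>2 - 2 * a * ?r" using that a r by simp
    also have "a\<^sup>2 + ?r\<^sup>2 - 2 * a * ?r = (a - ?r)\<^sup>2" by (simp add: power2_diff)
    finally show ?thesis using r by (smt (verit) zero_less_power2)
  qed
  have "(\<integral>\<^sup>+s. indicator {s\<^sup>2<..} q * ennreal (1 / sqrt (a\<^sup>2 + q - 2 * a * s)) \<partial>lborel)
     = (\<integral>\<^sup>+s. ennreal (if s \<le> ?r then 1 / sqrt (a\<^sup>2 + q - 2 * a * s) else 0) * indicator {-?r..?r} s \<partial>lborel)"
  proof (rule nn_integral_cong_AE)
    have "AE s in lborel. s \<noteq> ?r" "AE s in lborel. s \<noteq> -?r" by (rule AE_lborel_singleton)+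
    then show "AE s in lborel. indicator {s\<^sup>2<..} q * ennreal (1 / sqrt (a\<^sup>2 + q - 2 * a * s)) =
        ennreal (if s \<le> ?r then 1 / sqrt (a\<^sup>2 + q - 2 * a * s) else 0) * indicator {-?r..?r} s"
    proof eventually_elim
      fix s assume "s \<noteq> ?r" "s \<noteq> -?r"
      then have "s\<^sup>2 < q \<longleftrightarrow> -?r \<le> s \<and> s \<le> ?r"
        using real_sqrt_less_iff[of "s\<^sup>2" q] by auto
      then show "indicator {s\<^sup>2<..} q * ennreal (1 / sqrt (a\<^sup>2 + q - 2 * a * s)) =
        ennreal (if s \<le> ?r then 1 / sqrt (a\<^sup>2 + q - 2 * a * s) else 0) * indicator {-?r..?r} s"
        by (auto simp: indicator_def)
    qed
  qed
  also have "\<dots> = ennreal ((- sqrt (a\<^sup>2 + q - 2 * a * ?r) / a) - (- sqrt (a\<^sup>2 + q - 2 * a * (-?r)) / a))"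
  proof (rule nn_integral_FTC_Icc)
    fix x assume x: "x \<in> {-?r..?r}"
    have lin: "((\<lambda>s. a\<^sup>2 + q - 2 * a * s) has_real_derivative - (2 * a)) (at x)"
      by (auto intro!: derivative_eq_intros)
    have "a\<^sup>2 + q - 2 * a * x > 0" using x pos[of x] by simp
    from DERIV_chain2[OF DERIV_real_sqrt[OF this] lin]
    have "((\<lambda>s. sqrt (a\<^sup>2 + q - 2 * a * s)) has_real_derivative inverse (sqrt (a\<^sup>2 + q - 2 * a * x)) / 2 * (- (2 * a))) (at x)" .
    note D = DERIV_cdivide[OF DERIV_minus[OF this], of a]
    have "- (inverse u / 2 * (- (2 * a))) / a = 1 / u" for u
      using a by (simp add: field_simps)
    from D[unfolded this]
    have "((\<lambda>s. - sqrt (a\<^sup>2 + q - 2 * a * s) / a) has_real_derivative 1 / sqrt (a\<^sup>2 + q - 2 * a * x)) (at x)" .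
    then show "((\<lambda>s. - sqrt (a\<^sup>2 + q - 2 * a * s) / a) has_real_derivative
        (if x \<le> ?r then 1 / sqrt (a\<^sup>2 + q - 2 * a * x) else 0)) (at x)"
      using x by simp
    show "0 \<le> (if x \<le> ?r then 1 / sqrt (a\<^sup>2 + q - 2 * a * x) else 0)"
      using x pos[of x] by simp
  qed (use r in auto)
  also have "a\<^sup>2 + q - 2 * a * ?r = (a - ?r)\<^sup>2" using r by (simp add: power2_diff)
  also have "a\<^sup>2 + q - 2 * a * (-?r) = (a + ?r)\<^sup>2" using r by (simp add: power2_sum)
  also have "- sqrt ((a - ?r)\<^sup>2) / a - - sqrt ((a + ?r)\<^sup>2) / a = 2 * ?r / max a ?r"
  proof -
    have "- \<bar>a - u\<bar> / a - - \<bar>a + u\<bar> / a = 2 * u / max a u" if "u > 0" for u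
      using a that by (auto simp: field_simps max_def abs_if)
    from this[OF r(1)] show ?thesis by simp
  qed
  finally show ?thesis .
qed

lemma nn_integral_indicator_power2:
  assumes "q > 0"
  shows "(\<integral>\<^sup>+s. indicator {s\<^sup>2<..} q * c \<partial>lborel) = ennreal (2 * sqrt q) * c"
proof -
  have "(\<integral>\<^sup>+s. indicator {s\<^sup>2<..} q * c \<partial>lborel) = (\<integral>\<^sup>+s. c * indicator {- sqrt q <..< sqrt q} s \<partial>lborel)"
  proof (intro nn_integral_cong)
    fix s :: real
    have "s\<^sup>2 < q \<longleftrightarrow> - sqrt q < s \<and> s < sqrt q"
      using real_sqrt_less_iff[of "s\<^sup>2" q] by auto
    then show "indicator {s\<^sup>2<..} q * c = c * indicator {- sqrt q <..< sqrt q} s"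
      by (auto simp: indicator_def)
  qed
  also have "\<dots> = ennreal (2 * sqrt q) * c"
    using assms by (subst nn_integral_cmult_indicator) (auto simp: mult.commute)
  finally show ?thesis .
qed

text \<open>Polar coordinates in q = r^2, where 4 pi r^2 dr becomes 2 pi sqrt q dq.\<close>

lemma nn_integral_radial:
  assumes [measurable]: "F \<in> borel_measurable borel"
  shows "(\<integral>\<^sup>+x. F ((norm (x::R3))\<^sup>2) \<partial>lborel)
    = (\<integral>\<^sup>+q. ennreal (2 * pi * sqrt q) * indicator {0<..} q * F q \<partial>lborel)"
proof -
  have "(\<integral>\<^sup>+x. F ((norm (x::R3))\<^sup>2) \<partial>lborel)
    = (\<integral>\<^sup>+q. \<integral>\<^sup>+s. ennreal pi * indicator {s\<^sup>2<..} q * F q \<partial>lborel \<partial>lborel)"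
    by (rule nn_integral_norm_power2_coord[of "\<lambda>q s. F q"]) measurable
  also have "\<dots> = (\<integral>\<^sup>+q. ennreal (2 * pi * sqrt q) * indicator {0<..} q * F q \<partial>lborel)"
  proof (intro nn_integral_cong)
    fix q :: real
    show "(\<integral>\<^sup>+s. ennreal pi * indicator {s\<^sup>2<..} q * F q \<partial>lborel) = ennreal (2 * pi * sqrt q) * indicator {0<..} q * F q"
    proof (cases "q > 0")
      case True
      have "(\<integral>\<^sup>+s. ennreal pi * indicator {s\<^sup>2<..} q * F q \<partial>lborel)
          = (\<integral>\<^sup>+s. indicator {s\<^sup>2<..} q * (ennreal pi * F q) \<partial>lborel)"
        by (simp only: ac_simps)
      also have "\<dots> = (ennreal (2 * sqrt q) * ennreal pi) * F q"
        unfolding nn_integral_indicator_power2[OF True] by (simp only: ac_simps)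
      also have "ennreal (2 * sqrt q) * ennreal pi = ennreal (2 * pi * sqrt q)"
        using True by (subst ennreal_mult[symmetric]) (auto simp: ac_simps)
      finally show ?thesis using True by simp
    next
      case False
      then have "\<not> s\<^sup>2 < q" for s by (smt (verit) zero_le_power2)
      then show ?thesis using False by simp
    qed
  qed
  finally show ?thesis .
qed

text \<open>The mirror is the perpendicular bisector of \<open>x\<close> and
  \<open>y\<close>.\<close>

lemma hrefl_swap:
  assumes "x \<noteq> y"
  shows "hrefl (sgn (x - y)) ((x + y) \<bullet> sgn (x - y) / 2) x = y"
proof -
  have "2 * (x \<bullet> sgn (x - y) - (x + y) \<bullet> sgn (x - y) / 2) = (x - y) \<bullet> sgn (x - y)"
    by (simp add: algebra_simps inner_add_left inner_diff_left)
  also have "\<dots> = norm (x - y)"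
    using assms by (simp add: sgn_div_norm dot_square_norm power2_eq_square)
  finally show ?thesis
    using assms by (simp add: hrefl_def sgn_div_norm)
qed

text \<open>The mean of 1 / |x - z| over the sphere |z| = r is 1 / max |x| r. Both sides may be
  infinite, which matters as long as the potential is not known to be finite.\<close>

lemma newton_shell:
  assumes [measurable]: "F \<in> borel_measurable borel"
  shows "(\<integral>\<^sup>+z. F ((norm (z::R3))\<^sup>2) * ennreal (1 / norm (x - z)) \<partial>lborel)
    = (\<integral>\<^sup>+z. F ((norm (z::R3))\<^sup>2) * ennreal (1 / max (norm x) (norm z)) \<partial>lborel)"
proof (cases "x = 0")
  case False
  define a where "a = norm x"
  define y :: R3 where "y = a *\<^sub>R axis 3 1"
  have a: "a > 0" and ny: "norm y = a" using False by (auto simp: a_def y_def norm_axis_1)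
  have "(\<integral>\<^sup>+z. F ((norm z)\<^sup>2) * ennreal (1 / norm (x - z)) \<partial>lborel)
    = (\<integral>\<^sup>+z. F ((norm z)\<^sup>2) * ennreal (1 / norm (y - z)) \<partial>lborel)"
  proof (cases "x = y")
    case False
    \<comment> \<open>\<open>x\<close> and \<open>y\<close> have the same norm, so their bisecting
      plane contains the origin and the reflection preserves |z|; this moves \<open>x\<close> to the
      third axis.\<close>
    define e where "e = sgn (x - y)"
    have e: "norm e = 1" using False by (simp add: e_def norm_sgn)
    have "(x + y) \<bullet> (x - y) = 0"
      using ny a_def by (simp add: inner_add_left inner_diff_right inner_commute[of y x] dot_square_norm)
    then have "(x + y) \<bullet> e = 0" by (simp add: e_def sgn_div_norm)
    then have xy: "hrefl e 0 x = y" using hrefl_swap[OF False] by (simp add: e_def)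
    have "norm (x - hrefl e 0 z) = norm (y - z)" for z
      using norm_hrefl_diff'[OF e, of 0 x z] by (simp add: xy)
    moreover have "(\<integral>\<^sup>+z. F ((norm z)\<^sup>2) * ennreal (1 / norm (x - z)) \<partial>lborel)
      = (\<integral>\<^sup>+z. F ((norm (hrefl e 0 z))\<^sup>2) * ennreal (1 / norm (x - hrefl e 0 z)) \<partial>lborel)"
      by (rule nn_integral_hrefl[OF e, symmetric]) measurable
    ultimately show ?thesis by (simp add: norm_hrefl_0[OF e])
  qed simp
  also have "\<dots> = (\<integral>\<^sup>+z. F ((norm (z::R3))\<^sup>2) * ennreal (1 / sqrt (a\<^sup>2 + (norm z)\<^sup>2 - 2 * a * z $ 3)) \<partial>lborel)"
  proof (intro nn_integral_cong)
    fix z :: R3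
    have "(norm (y - z))\<^sup>2 = a\<^sup>2 + (norm z)\<^sup>2 - 2 * (y \<bullet> z)"
      unfolding ny[symmetric] power2_norm_eq_inner
      by (simp add: inner_diff_left inner_diff_right inner_commute)
    also have "y \<bullet> z = a * z $ 3" by (simp add: y_def inner_axis inner_commute)
    finally have "(norm (y - z))\<^sup>2 = a\<^sup>2 + (norm z)\<^sup>2 - 2 * a * z $ 3" by (simp only: mult.assoc)
    from real_sqrt_unique[OF this norm_ge_zero]
    have "norm (y - z) = sqrt (a\<^sup>2 + (norm z)\<^sup>2 - 2 * a * z $ 3)" by simp
    then show "F ((norm z)\<^sup>2) * ennreal (1 / norm (y - z)) = F ((norm z)\<^sup>2) * ennreal (1 / sqrt (a\<^sup>2 + (norm z)\<^sup>2 - 2 * a * z $ 3))"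
      by simp
  qed
  also have "\<dots> = (\<integral>\<^sup>+q. \<integral>\<^sup>+s. ennreal pi * indicator {s\<^sup>2<..} q * (F q * ennreal (1 / sqrt (a\<^sup>2 + q - 2 * a * s))) \<partial>lborel \<partial>lborel)"
    by (rule nn_integral_norm_power2_coord[of "\<lambda>q s. F q * ennreal (1 / sqrt (a\<^sup>2 + q - 2 * a * s))"]) measurable
  also have "\<dots> = (\<integral>\<^sup>+q. ennreal (2 * pi * sqrt q) * indicator {0<..} q * (F q * ennreal (1 / max a (sqrt q))) \<partial>lborel)"
  proof (rule nn_integral_cong_AE)
    have "AE q in lborel. q \<noteq> a\<^sup>2" by (rule AE_lborel_singleton)
    then show "AE q in lborel. (\<integral>\<^sup>+s. ennreal pi * indicator {s\<^sup>2<..} q * (F q * ennreal (1 / sqrt (a\<^sup>2 + q - 2 * a * s))) \<partial>lborel)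
      = ennreal (2 * pi * sqrt q) * indicator {0<..} q * (F q * ennreal (1 / max a (sqrt q)))"
    proof eventually_elim
      fix q assume qa: "q \<noteq> a\<^sup>2"
      show "(\<integral>\<^sup>+s. ennreal pi * indicator {s\<^sup>2<..} q * (F q * ennreal (1 / sqrt (a\<^sup>2 + q - 2 * a * s))) \<partial>lborel)
        = ennreal (2 * pi * sqrt q) * indicator {0<..} q * (F q * ennreal (1 / max a (sqrt q)))"
      proof (cases "q > 0")
        case True
        have meas: "(\<lambda>s. indicator {s\<^sup>2<..} q * ennreal (1 / sqrt (a\<^sup>2 + q - 2 * a * s))) \<in> borel_measurable lborel"
        proof -
          have "(\<lambda>s. indicator {s\<^sup>2<..} q :: ennreal) = (\<lambda>s. if s\<^sup>2 < q then 1 else 0)"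
            by (auto simp: fun_eq_iff indicator_def)
          then have [measurable]: "(\<lambda>s. indicator {s\<^sup>2<..} q :: ennreal) \<in> borel_measurable lborel"
            by simp
          show ?thesis by measurable
        qed
        have "(\<integral>\<^sup>+s. ennreal pi * indicator {s\<^sup>2<..} q * (F q * ennreal (1 / sqrt (a\<^sup>2 + q - 2 * a * s))) \<partial>lborel)
          = (\<integral>\<^sup>+s. (ennreal pi * F q) * (indicator {s\<^sup>2<..} q * ennreal (1 / sqrt (a\<^sup>2 + q - 2 * a * s))) \<partial>lborel)"
          by (simp only: ac_simps)
        also have "\<dots> = (ennreal pi * F q) * ennreal (2 * sqrt q / max a (sqrt q))"
          using nn_integral_cmult[OF meas] nn_integral_inverse_dist_axis[OF a True qa] by simp
        also have "ennreal (2 * sqrt q / max a (sqrt q)) = ennreal (2 * sqrt q) * ennreal (1 / max a (sqrt q))"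
          using True a by (subst ennreal_mult[symmetric]) (auto simp: le_max_iff_disj)
        also have "ennreal pi * F q * (ennreal (2 * sqrt q) * ennreal (1 / max a (sqrt q)))
          = (ennreal (2 * sqrt q) * ennreal pi) * (F q * ennreal (1 / max a (sqrt q)))"
          by (simp only: ac_simps)
        also have "ennreal (2 * sqrt q) * ennreal pi = ennreal (2 * pi * sqrt q)"
          using True by (subst ennreal_mult[symmetric]) (auto simp: ac_simps)
        finally show ?thesis using True by simp
      next
        case False
        then have "\<not> s\<^sup>2 < q" for s by (smt (verit) zero_le_power2)
        then show ?thesis using False by simp
      qed
    qed
  qed
  also have "\<dots> = (\<integral>\<^sup>+z. F ((norm (z::R3))\<^sup>2) * ennreal (1 / max a (sqrt ((norm z)\<^sup>2))) \<partial>lborel)"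
    by (rule nn_integral_radial[of "\<lambda>q. F q * ennreal (1 / max a (sqrt q))", symmetric]) measurable
  finally show ?thesis by (simp add: a_def)
qed (auto simp: max_def)

section \<open>The Coulomb energy\<close>

text \<open>The power -5/2 is integrable at the origin, dominates the |z|^(-2) of
  \<open>kernel_bound\<close>, and equals |z|^(-3/2) / |z|, the singularity met in
  \<open>U_0_finite\<close>.\<close>

definition near_kernel :: "R3 \<Rightarrow> real" where
  "near_kernel z = indicator (ball 0 1) z * norm z powr (-5/2)"

lemma borel_measurable_near_kernel [measurable]: "near_kernel \<in> borel_measurable borel"
proof -
  have [measurable]: "(\<lambda>z::R3. norm z powr (-5/2)) \<in> borel_measurable borel"
    by (intro powr_real_measurable) auto
  have [measurable]: "(\<lambda>z::R3. indicator (ball 0 1) z :: real) \<in> borel_measurable borel"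
    by (intro borel_measurable_indicator) auto
  show ?thesis unfolding near_kernel_def [abs_def] by (intro borel_measurable_times) measurable
qed

lemma near_kernel_nonneg [simp]: "0 \<le> near_kernel z"
  by (simp add: near_kernel_def)

lemma integrable_near_kernel: "integrable lborel near_kernel"
proof (rule integrableI_nonneg)
  define F where "F q = ennreal (indicator {..<1} q * sqrt q powr (-5/2))" for q
  have [measurable]: "F \<in> borel_measurable borel" unfolding F_def by measurable
  \<comment> \<open>In q = |z|^2 the Jacobian sqrt q turns |z|^(-5/2) into q^(-3/4), whose integral
    over the unit interval is 4.\<close>
  have hi: "((\<lambda>q. q powr (-3/4)) has_integral 4) {0..1::real}"
    using has_integral_powr_from_0[of "-3/4" 1] by simp
  then have "((\<lambda>q. if q \<in> {0..1} then q powr (-3/4) else 0) has_integral 4) (UNIV::real set)"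
    unfolding has_integral_restrict_UNIV .
  then have fin: "(\<integral>\<^sup>+q. ennreal (if q \<in> {0..1} then q powr (-3/4) else 0) \<partial>lborel) = ennreal 4"
    by (intro nn_integral_has_integral_lborel) auto
  have "(\<integral>\<^sup>+z. ennreal (near_kernel z) \<partial>lborel) = (\<integral>\<^sup>+z. F ((norm (z::R3))\<^sup>2) \<partial>lborel)"
  proof (intro nn_integral_cong)
    fix z :: R3
    have "(norm z)\<^sup>2 < 1 \<longleftrightarrow> norm z < 1" using power_less_one_iff[of "norm z" 2] by simp
    then show "ennreal (near_kernel z) = F ((norm z)\<^sup>2)"
      by (simp add: near_kernel_def F_def indicator_def)
  qed
  also have "\<dots> = (\<integral>\<^sup>+q. ennreal (2 * pi * sqrt q) * indicator {0<..} q * F q \<partial>lborel)"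
    by (rule nn_integral_radial) measurable
  also have "\<dots> \<le> (\<integral>\<^sup>+q. ennreal (2 * pi) * ennreal (if q \<in> {0..1} then q powr (-3/4) else 0) \<partial>lborel)"
  proof (intro nn_integral_mono)
    fix q :: real
    show "ennreal (2 * pi * sqrt q) * indicator {0<..} q * F q
      \<le> ennreal (2 * pi) * ennreal (if q \<in> {0..1} then q powr (-3/4) else 0)"
    proof (cases "0 < q \<and> q < 1")
      case True
      have "sqrt q * sqrt q powr (-5/2) = q powr (-3/4)"
        using True by (simp add: powr_half_sqrt[symmetric] powr_powr powr_add[symmetric])
      then have "2 * pi * sqrt q * (sqrt q powr (-5/2)) = 2 * pi * q powr (-3/4)"
        by (simp only: mult.assoc)
      then show ?thesis using True by (simp add: F_def flip: ennreal_mult)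
    qed (auto simp: F_def)
  qed
  also have "\<dots> = ennreal (2 * pi) * ennreal 4"
    unfolding fin[symmetric] by (rule nn_integral_cmult) measurable
  also have "\<dots> < \<infinity>" by (simp add: ennreal_mult_less_top)
  finally show "(\<integral>\<^sup>+z. ennreal (near_kernel z) \<partial>lborel) < \<infinity>" .
qed auto

lemma lborel_distr_diff: "distr lborel borel (\<lambda>y. x - y) = (lborel :: 'a::euclidean_space measure)"
  using lborel_affine[of "-1" x] by (simp add: density_1)

lemma integral_near_kernel_diff:
  "integrable lborel (\<lambda>y. near_kernel (x - y))"
  "(\<integral>y. near_kernel (x - y) \<partial>lborel) = (\<integral>y. near_kernel y \<partial>lborel)"
proof -
  have "integrable (distr lborel borel (\<lambda>y. x - y)) near_kernel"
    unfolding lborel_distr_diff by (rule integrable_near_kernel)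
  from integrable_distr[OF _ this] show "integrable lborel (\<lambda>y. near_kernel (x - y))" by simp
  have "(\<integral>y. near_kernel y \<partial>distr lborel borel (\<lambda>y. x - y)) = (\<integral>y. near_kernel (x - y) \<partial>lborel)"
    by (rule integral_distr) auto
  then show "(\<integral>y. near_kernel (x - y) \<partial>lborel) = (\<integral>y. near_kernel y \<partial>lborel)"
    by (simp add: lborel_distr_diff)
qed

lemma inverse_power2_le_near_kernel:
  assumes "norm z < 1" "z \<noteq> 0" shows "1 / (norm z)\<^sup>2 \<le> near_kernel z"
proof -
  have "1 / (norm z)\<^sup>2 = norm z powr (-2)"
    using assms by (simp add: powr_minus_divide)
  also have "\<dots> \<le> norm z powr (-5/2)" using assms by (intro powr_mono') auto
  finally show ?thesis using assms by (simp add: near_kernel_def)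
qed

definition energy_class :: "(R3 \<Rightarrow> real) \<Rightarrow> bool" where
  "energy_class f \<longleftrightarrow> integrable lborel f \<and> (\<forall>x. 0 \<le> f x) \<and> integrable lborel (\<lambda>x. f x powr (4/3))"

lemma cube_root_powers:
  fixes u :: real assumes "u \<ge> 0"
  shows "(u powr (1/3)) ^ 3 = u" "(u powr (1/3)) ^ 4 = u powr (4/3)"
  using assms by (simp_all add: powr_powr flip: powr_realpow')

text \<open>The case \<open>p = 4/3\<close> of Young's inequality for convolutions, pointwise: with \<open>a = s\<^sup>3\<close>,
  \<open>b = t\<^sup>3\<close> it is AM-GM applied twice to \<open>(s\<^sup>2 t\<^sup>2) (s t / r)\<close>.\<close>

lemma kernel_bound:
  assumes a: "a \<ge> 0" and b: "b \<ge> 0"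
  shows "a * b / norm z \<le> a * b + a powr (4/3) * b powr (4/3) / 2 + (a powr (4/3) + b powr (4/3)) / 4 * near_kernel z"
proof (cases "norm z < 1 \<and> z \<noteq> 0")
  case True
  define s where "s = a powr (1/3)"
  define t where "t = b powr (1/3)"
  have ab: "a = s ^ 3" "b = t ^ 3" "a powr (4/3) = s ^ 4" "b powr (4/3) = t ^ 4"
    using cube_root_powers[OF a] cube_root_powers[OF b] by (simp_all add: s_def t_def)
  define w where "w = 1 / norm z"
  have am: "x * y \<le> (x\<^sup>2 + y\<^sup>2) / 2" for x y :: real
    using sum_squares_bound[of x y] by simp
  have "a * b / norm z = (s\<^sup>2 * t\<^sup>2) * (s * t * w)"
    by (simp add: ab w_def power2_eq_square power3_eq_cube)
  also have "\<dots> \<le> ((s\<^sup>2 * t\<^sup>2)\<^sup>2 + (s * t * w)\<^sup>2) / 2" by (rule am)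
  also have "\<dots> = s ^ 4 * t ^ 4 / 2 + (s\<^sup>2 * t\<^sup>2) * w\<^sup>2 / 2"
    by (simp add: power_mult_distrib add_divide_distrib flip: power_mult)
  also have "\<dots> \<le> s ^ 4 * t ^ 4 / 2 + ((s\<^sup>2)\<^sup>2 + (t\<^sup>2)\<^sup>2) / 2 * w\<^sup>2 / 2"
    using am[of "s\<^sup>2" "t\<^sup>2"] by (intro add_left_mono divide_right_mono mult_right_mono) auto
  also have "\<dots> = s ^ 4 * t ^ 4 / 2 + (s ^ 4 + t ^ 4) / 4 * w\<^sup>2"
    by (simp flip: power_mult)
  also have "\<dots> \<le> s ^ 4 * t ^ 4 / 2 + (s ^ 4 + t ^ 4) / 4 * near_kernel z"
    using inverse_power2_le_near_kernel[of z] True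
    by (intro add_left_mono mult_left_mono) (auto simp: w_def power_divide)
  also have "\<dots> \<le> a * b + a powr (4/3) * b powr (4/3) / 2 + (a powr (4/3) + b powr (4/3)) / 4 * near_kernel z"
    using a b unfolding ab(3,4) by simp
  finally show ?thesis .
next
  case False
  have "a * b / norm z \<le> a * b"
  proof (cases "z = 0")
    case False
    with \<open>\<not> (norm z < 1 \<and> z \<noteq> 0)\<close> have "norm z \<ge> 1" by simp
    then have "a * b \<le> a * b * norm z" using a b using mult_left_mono[of 1 "norm z" "a * b"] by simp
    then show ?thesis using \<open>norm z \<ge> 1\<close> \<open>z \<noteq> 0\<close> by (simp add: divide_le_eq)
  qed (use a b in simp)
  also have "\<dots> \<le> a * b + a powr (4/3) * b powr (4/3) / 2 + (a powr (4/3) + b powr (4/3)) / 4 * near_kernel z"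
    by simp
  finally show ?thesis .
qed

lemma integrable_tensor:
  fixes f g :: "R3 \<Rightarrow> real"
  assumes f: "integrable lborel f" and g: "integrable lborel g"
  shows "integrable (lborel \<Otimes>\<^sub>M lborel) (\<lambda>p. f (fst p) * g (snd p))"
proof (rule lborel_pair.Fubini_integrable)
  show "AE x in lborel. integrable lborel (\<lambda>y. f (fst (x, y)) * g (snd (x, y)))"
    using g by simp
  show "integrable lborel (\<lambda>x. \<integral>y. norm (f (fst (x, y)) * g (snd (x, y))) \<partial>lborel)"
    using f by (simp add: abs_mult)
qed (use f g in measurable)

lemma integrable_tensor_near_kernel:
  assumes f: "integrable lborel f"
  shows "integrable (lborel \<Otimes>\<^sub>M lborel) (\<lambda>p. f (fst p) * near_kernel (fst p - snd p))"
    and "integrable (lborel \<Otimes>\<^sub>M lborel) (\<lambda>p. f (snd p) * near_kernel (fst p - snd p))"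
proof -
  have [measurable]: "f \<in> borel_measurable borel" using f by auto
  show 1: "integrable (lborel \<Otimes>\<^sub>M lborel) (\<lambda>p. f (fst p) * near_kernel (fst p - snd p))"
  proof (rule lborel_pair.Fubini_integrable)
    show "AE x in lborel. integrable lborel (\<lambda>y. f (fst (x, y)) * near_kernel (fst (x, y) - snd (x, y)))"
      using integral_near_kernel_diff(1) by simp
    show "integrable lborel (\<lambda>x. \<integral>y. norm (f (fst (x, y)) * near_kernel (fst (x, y) - snd (x, y))) \<partial>lborel)"
      using f by (simp add: abs_mult integral_near_kernel_diff)
  qed measurable
  have sym: "near_kernel (x - y) = near_kernel (y - x)" for x y
    by (simp add: near_kernel_def norm_minus_commute indicator_def)
  have "integrable (lborel \<Otimes>\<^sub>M lborel) (\<lambda>(x, y). (\<lambda>p. f (fst p) * near_kernel (fst p - snd p)) (y, x))"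
    by (rule lborel_pair.integrable_product_swap[OF 1])
  then show "integrable (lborel \<Otimes>\<^sub>M lborel) (\<lambda>p. f (snd p) * near_kernel (fst p - snd p))"
    by (simp add: case_prod_beta' sym)
qed

text \<open>A single integral over the product measure, so that symmetry and reflections of either
  argument are changes of variables.\<close>

definition coulomb :: "(R3 \<Rightarrow> real) \<Rightarrow> (R3 \<Rightarrow> real) \<Rightarrow> real" where
  "coulomb f g = (\<integral>p. f (fst p) * g (snd p) / norm (fst p - snd p) \<partial>(lborel \<Otimes>\<^sub>M lborel))"

text \<open>Each term on the right of \<open>kernel_bound\<close> is either a tensor product of
  integrable functions or an integrable function of one point times \<open>near_kernel\<close> of
  the difference.\<close>

lemma integrable_coulomb:
  assumes f: "energy_class f" and g: "energy_class g"
  shows "integrable (lborel \<Otimes>\<^sub>M lborel) (\<lambda>p. f (fst p) * g (snd p) / norm (fst p - snd p))"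
proof (rule Bochner_Integration.integrable_bound[OF _ _ AE_I2])
  let ?F = "\<lambda>x. f x powr (4/3)" and ?G = "\<lambda>x. g x powr (4/3)"
  have fg: "integrable lborel f" "integrable lborel g" "integrable lborel ?F" "integrable lborel ?G"
    and nn: "f x \<ge> 0" "g x \<ge> 0" for x
    using f g by (auto simp: energy_class_def)
  have [measurable]: "f \<in> borel_measurable borel" "g \<in> borel_measurable borel" using fg by auto
  show "integrable (lborel \<Otimes>\<^sub>M lborel) (\<lambda>p. f (fst p) * g (snd p) + ?F (fst p) * ?G (snd p) / 2
      + (?F (fst p) * near_kernel (fst p - snd p) + ?G (snd p) * near_kernel (fst p - snd p)) / 4)"
    using fg by (intro Bochner_Integration.integrable_add integrable_tensor integrable_tensor_near_kernel integrable_divide) auto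
  show "(\<lambda>p. f (fst p) * g (snd p) / norm (fst p - snd p)) \<in> borel_measurable (lborel \<Otimes>\<^sub>M lborel)" by measurable
  fix p :: "R3 \<times> R3"
  have "f (fst p) * g (snd p) / norm (fst p - snd p) \<le> f (fst p) * g (snd p) + ?F (fst p) * ?G (snd p) / 2
      + (?F (fst p) * near_kernel (fst p - snd p) + ?G (snd p) * near_kernel (fst p - snd p)) / 4"
    using kernel_bound[OF nn(1)[of "fst p"] nn(2)[of "snd p"], of "fst p - snd p"] by (simp add: algebra_simps)
  then show "norm (f (fst p) * g (snd p) / norm (fst p - snd p)) \<le> norm (f (fst p) * g (snd p) + ?F (fst p) * ?G (snd p) / 2
      + (?F (fst p) * near_kernel (fst p - snd p) + ?G (snd p) * near_kernel (fst p - snd p)) / 4)"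
    using nn by simp
qed

lemma coulomb_sym:
  assumes [measurable]: "f \<in> borel_measurable borel" "g \<in> borel_measurable borel"
  shows "coulomb f g = coulomb g f"
proof -
  have "coulomb f g = (\<integral>(x, y). (\<lambda>p. f (fst p) * g (snd p) / norm (fst p - snd p)) (y, x) \<partial>(lborel \<Otimes>\<^sub>M lborel))"
    unfolding coulomb_def by (rule lborel_pair.integral_product_swap[symmetric]) measurable
  then show ?thesis by (simp add: coulomb_def case_prod_beta' norm_minus_commute mult.commute)
qed

lemma Epot_coulomb:
  assumes "energy_class f"
  shows "Epot f = - coulomb f f / 2"
  using lborel_pair.integral_fst'[OF integrable_coulomb[OF assms assms]]
  by (simp add: Epot_def coulomb_def)

lemma integrable_mult_Vpot:
  assumes "energy_class f" "energy_class g"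
  shows "integrable lborel (\<lambda>x. g x * Vpot f x)"
    and "(\<integral>x. g x * Vpot f x \<partial>lborel) = - coulomb g f"
proof -
  note * = integrable_coulomb[OF assms(2,1)]
  \<comment> \<open>Valid also where the potential integral diverges, since both sides then default
    to 0.\<close>
  have eq: "(\<integral>y. g x * f y / norm (x - y) \<partial>lborel) = - (g x * Vpot f x)" for x
    by (simp add: Vpot_def flip: times_divide_eq_right)
  have "integrable lborel (\<lambda>x. \<integral>y. g (fst (x, y)) * f (snd (x, y)) / norm (fst (x, y) - snd (x, y)) \<partial>lborel)"
    by (rule lborel_pair.integrable_fst'[OF *])
  then show "integrable lborel (\<lambda>x. g x * Vpot f x)" by (simp add: eq)
  have "(\<integral>x. (\<integral>y. g (fst (x, y)) * f (snd (x, y)) / norm (fst (x, y) - snd (x, y)) \<partial>lborel) \<partial>lborel) = coulomb g f"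
    unfolding coulomb_def by (rule lborel_pair.integral_fst'[OF *])
  then show "(\<integral>x. g x * Vpot f x \<partial>lborel) = - coulomb g f" by (simp add: eq)
qed

lemma energy_class_indicator:
  fixes A :: "R3 set"
  assumes [measurable]: "A \<in> sets borel" and "bounded A" and "c \<ge> 0"
  shows "energy_class (\<lambda>x. c * indicator A x)"
proof -
  have fin: "emeasure lborel A < \<infinity>" using assms emeasure_bounded_finite by blast
  have "(c * indicator A x) powr (4/3) = c powr (4/3) * indicator A x" for x :: R3
    by (simp add: indicator_def)
  then show ?thesis using fin assms by (simp add: energy_class_def)
qed

lemma coulomb_convex:
  assumes f: "energy_class f" and g: "energy_class g"
  shows "coulomb (\<lambda>x. (1 - t) * f x + t * g x) (\<lambda>x. (1 - t) * f x + t * g x)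
    = (1 - t)\<^sup>2 * coulomb f f + 2 * t * (1 - t) * coulomb g f + t\<^sup>2 * coulomb g g"
proof -
  note i = integrable_coulomb[OF f f] integrable_coulomb[OF f g] integrable_coulomb[OF g f] integrable_coulomb[OF g g]
  have "coulomb (\<lambda>x. (1 - t) * f x + t * g x) (\<lambda>x. (1 - t) * f x + t * g x)
    = (\<integral>p. (1 - t)\<^sup>2 * (f (fst p) * f (snd p) / norm (fst p - snd p)) + t * (1 - t) * (f (fst p) * g (snd p) / norm (fst p - snd p))
       + t * (1 - t) * (g (fst p) * f (snd p) / norm (fst p - snd p)) + t\<^sup>2 * (g (fst p) * g (snd p) / norm (fst p - snd p)) \<partial>(lborel \<Otimes>\<^sub>M lborel))"
    unfolding coulomb_def by (intro Bochner_Integration.integral_cong) (auto simp: algebra_simps power2_eq_square add_divide_distrib diff_divide_distrib)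
  also have "\<dots> = (1 - t)\<^sup>2 * coulomb f f + t * (1 - t) * coulomb f g + t * (1 - t) * coulomb g f + t\<^sup>2 * coulomb g g"
    unfolding coulomb_def
    by (subst Bochner_Integration.integral_add | intro Bochner_Integration.integrable_add integrable_mult_right i | subst integral_mult_right_zero | rule refl)+
  also have "coulomb f g = coulomb g f"
    using f g by (intro coulomb_sym) (auto simp: energy_class_def)
  finally show ?thesis by simp
qed

section \<open>The conjugate of the energy density\<close>

locale casimir =
  fixes \<Phi> dPhi :: "real \<Rightarrow> real" and n :: real
  assumes Phi_C1: "\<And>r. r \<ge> 0 \<Longrightarrow> (\<Phi> has_real_derivative dPhi r) (at r within {0..})"
    and dPhi_cont: "continuous_on {0..} dPhi"
    and Phi0 [simp]: "\<Phi> 0 = 0" and dPhi0 [simp]: "dPhi 0 = 0"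
    and Phi1: "strict_convex_on {0..} \<Phi>"
    and n: "0 < n" "n < 3"
    and Phi2: "\<exists>C>0. \<exists>R. \<forall>r. r \<ge> R \<longrightarrow> \<Phi> r \<ge> C * r powr (1 + 1/n)"
begin

lemma convex_Phi: "convex_on {0..} \<Phi>"
proof (rule convex_onI)
  fix t x y :: real assume t: "t > 0" "t < 1" and xy: "x \<in> {0..}" "y \<in> {0..}"
  show "\<Phi> ((1 - t) *\<^sub>R x + t *\<^sub>R y) \<le> (1 - t) * \<Phi> x + t * \<Phi> y"
  proof (cases "x = y")
    case False
    then show ?thesis using Phi1 t xy unfolding strict_convex_on_def by (auto intro: less_imp_le)
  qed (simp add: algebra_simps)
qed (simp add: convex_real_interval)

text \<open>One-sided along the segment from \<open>x\<close> towards \<open>y\<close>, as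
  \<open>x\<close> may be 0, where only the derivative within the half-line is given.\<close>

lemma Phi_slope_tendsto:
  assumes "x \<ge> 0" "y \<ge> 0"
  shows "((\<lambda>t. (\<Phi> (x + t * (y - x)) - \<Phi> x) / t) \<longlongrightarrow> dPhi x * (y - x)) (at 0 within {0..1})"
proof -
  define g where "g t = x + t * (y - x)" for t :: real
  have g: "g t \<ge> 0" if "t \<in> {0..1}" for t
  proof -
    have "g t = (1 - t) * x + t * y" by (simp add: g_def algebra_simps)
    then show ?thesis using that assms by simp
  qed
  have g': "(g has_real_derivative y - x) (at 0 within {0..1})"
    unfolding g_def by (auto intro!: derivative_eq_intros)
  have "(\<Phi> has_real_derivative dPhi x) (at (g 0) within {0..})"
    using Phi_C1[OF assms(1)] by (simp add: g_def)
  then have "(\<Phi> has_real_derivative dPhi x) (at (g 0) within g ` {0..1})"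
    by (rule DERIV_subset) (use g in auto)
  from DERIV_image_chain[OF this g']
  have "((\<lambda>t. \<Phi> (g t)) has_real_derivative dPhi x * (y - x)) (at 0 within {0..1})"
    by (simp add: o_def)
  then show ?thesis by (simp add: has_field_derivative_iff g_def)
qed

text \<open>The point at parameter \<open>s\<close> is a convex combination of \<open>x\<close> and
  the point at parameter \<open>t\<close>. This monotonicity is what permits monotone convergence in
  \<open>first_variation\<close>.\<close>

lemma Phi_slope_mono:
  assumes "x \<ge> 0" "y \<ge> 0" "0 < s" "s \<le> t" "t \<le> 1"
  shows "(\<Phi> (x + s * (y - x)) - \<Phi> x) / s \<le> (\<Phi> (x + t * (y - x)) - \<Phi> x) / t"
proof -
  have "x + t * (y - x) = (1 - t) * x + t * y" by (simp add: algebra_simps)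
  then have "x + t * (y - x) \<ge> 0" using assms by simp
  moreover have "x + s * (y - x) = (1 - s / t) *\<^sub>R x + (s / t) *\<^sub>R (x + t * (y - x))"
    using assms by (simp add: field_simps)
  ultimately have "\<Phi> (x + s * (y - x)) \<le> (1 - s / t) * \<Phi> x + s / t * \<Phi> (x + t * (y - x))"
    using convex_onD[OF convex_Phi, of "s / t" x "x + t * (y - x)"] assms by simp
  also have "\<dots> = \<Phi> x + (\<Phi> (x + t * (y - x)) - \<Phi> x) / t * s"
  proof -
    have "(1 - s / t) * X + s / t * Q = X + (Q - X) / t * s" for X Q
      using assms by (simp add: field_simps)
    then show ?thesis .
  qed
  finally show ?thesis using assms(3) by (simp add: pos_divide_le_eq)
qed

lemma Phi_tangent:
  assumes "x \<ge> 0" "y \<ge> 0"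
  shows "\<Phi> x + dPhi x * (y - x) \<le> \<Phi> y"
proof -
  have "eventually (\<lambda>t. (\<Phi> (x + t * (y - x)) - \<Phi> x) / t \<le> \<Phi> y - \<Phi> x) (at (0::real) within {0..1})"
    using Phi_slope_mono[OF assms, of _ 1]
    by (intro eventually_at_topological[THEN iffD2] exI[of _ UNIV]) auto
  moreover have "at (0::real) within {0..1} \<noteq> bot"
    by (simp add: trivial_limit_within islimpt_Icc)
  ultimately have "dPhi x * (y - x) \<le> \<Phi> y - \<Phi> x"
    using tendsto_upperbound[OF Phi_slope_tendsto[OF assms]] by blast
  then show ?thesis by simp
qed

text \<open>At the midpoint the graph lies above the tangents at \<open>x\<close> and at
  \<open>y\<close> but strictly below the chord.\<close>

lemma dPhi_strict_mono:
  assumes "0 \<le> x" "x < y"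
  shows "dPhi x < dPhi y"
proof -
  let ?z = "(1 - 1/2) * x + 1/2 * y"
  have "\<Phi> ?z < (1 - 1/2) * \<Phi> x + 1/2 * \<Phi> y"
    using Phi1[unfolded strict_convex_on_def, rule_format, of x y "1/2"] assms by auto
  moreover have "\<Phi> x + dPhi x * (?z - x) \<le> \<Phi> ?z" "\<Phi> y + dPhi y * (?z - y) \<le> \<Phi> ?z"
    by (rule Phi_tangent; use assms in simp)+
  moreover have "?z - x = (y - x) / 2" "?z - y = - ((y - x) / 2)" by (auto simp: field_simps)
  ultimately have "dPhi x * ((y - x) / 2) < dPhi y * ((y - x) / 2)"
    by (simp add: field_simps)
  then show ?thesis using assms by simp
qed

lemma dPhi_mono: "0 \<le> x \<Longrightarrow> x \<le> y \<Longrightarrow> dPhi x \<le> dPhi y"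
  using dPhi_strict_mono[of x y] by (cases "x = y") auto

lemma dPhi_nonneg: "0 \<le> x \<Longrightarrow> 0 \<le> dPhi x"
  using dPhi_mono[of 0 x] by simp

lemma Phi_nonneg: "0 \<le> x \<Longrightarrow> 0 \<le> \<Phi> x"
  using Phi_tangent[of 0 x] by simp

lemma Phi_le: "0 \<le> x \<Longrightarrow> \<Phi> x \<le> x * dPhi x"
  using Phi_tangent[of x 0] by (simp add: mult.commute)

lemma Phi_growth: "\<exists>C>0. \<exists>R\<ge>1. \<forall>r\<ge>R. C * r powr (1 + 1/n) \<le> \<Phi> r"
proof -
  obtain C R where "C > 0" "\<forall>r. r \<ge> R \<longrightarrow> \<Phi> r \<ge> C * r powr (1 + 1/n)" using Phi2 by blast
  then show ?thesis by (intro exI[of _ C] conjI exI[of _ "max 1 R"]) auto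
qed

lemma dPhi_growth: "\<exists>C>0. \<exists>R\<ge>1. \<forall>r\<ge>R. C * r powr (1/n) \<le> dPhi r"
proof -
  obtain C R where CR: "C > 0" "R \<ge> 1" "\<And>r. r \<ge> R \<Longrightarrow> \<Phi> r \<ge> C * r powr (1 + 1/n)"
    using Phi_growth by blast
  have "dPhi r \<ge> C * r powr (1/n)" if "r \<ge> R" for r
  proof -
    have "r > 0" using that CR by simp
    have "r * (C * r powr (1/n)) = C * r powr (1 + 1/n)"
      using \<open>r > 0\<close> by (simp add: powr_add)
    also have "\<dots> \<le> r * dPhi r" using CR(3)[OF that] Phi_le[of r] \<open>r > 0\<close> by simp
    finally show ?thesis using \<open>r > 0\<close> by simp
  qed
  with CR show ?thesis by blast
qed

lemma dPhi_surj:
  assumes "s \<ge> 0" obtains r where "r \<ge> 0" "dPhi r = s"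
proof -
  obtain C R where CR: "C > 0" "R \<ge> 1" "\<And>r. r \<ge> R \<Longrightarrow> dPhi r \<ge> C * r powr (1/n)" 
    using dPhi_growth by blast
  \<comment> \<open>The second entry makes C * b^(1/n) at least \<open>s\<close>; the first makes
    the growth bound applicable at \<open>b\<close>.\<close>
  define b where "b = max R ((s / C) powr n)"
  have "b \<ge> 1" using CR by (simp add: b_def)
  have "s / C = ((s / C) powr n) powr (1/n)"
    using n assms CR by (simp add: powr_powr)
  also have "\<dots> \<le> b powr (1/n)"
    using n by (intro powr_mono2) (auto simp: b_def)
  finally have "s \<le> C * b powr (1/n)" using CR by (simp add: field_simps)
  also have "\<dots> \<le> dPhi b" by (rule CR) (simp add: b_def)
  finally have "\<exists>x\<ge>0. x \<le> b \<and> dPhi x = s"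
    using assms \<open>b \<ge> 1\<close> dPhi_cont
    by (intro IVT') (auto intro: continuous_on_subset)
  then show ?thesis using that by blast
qed

text \<open>The inverse of \<open>dPhi\<close>, extended by 0 to negative arguments; this merges the
  two cases of the Euler-Lagrange formula into one continuous function.\<close>

definition phi :: "real \<Rightarrow> real" where "phi s = inv_into {0..} dPhi (max 0 s)"

lemma inj_dPhi: "inj_on dPhi {0..}"
  by (rule inj_onI) (metis atLeast_iff dPhi_strict_mono less_irrefl linorder_less_linear)

lemma image_dPhi: "dPhi ` {0..} = {0..}"
  using dPhi_nonneg by (auto, metis atLeast_iff dPhi_surj image_iff)

lemma phi_nonneg [simp]: "phi s \<ge> 0"
  using inv_into_into[of "max 0 s" dPhi "{0..}"] by (simp add: phi_def image_dPhi)

lemma dPhi_phi: "dPhi (phi s) = max 0 s"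
  unfolding phi_def by (rule f_inv_into_f) (simp add: image_dPhi)

lemma phi_dPhi: "r \<ge> 0 \<Longrightarrow> phi (dPhi r) = r"
  unfolding phi_def using inj_dPhi by (simp add: dPhi_nonneg max_def)

lemma phi_nonpos [simp]: "s \<le> 0 \<Longrightarrow> phi s = 0"
  using phi_dPhi[of 0] by (simp add: phi_def)

lemma phi_less_iff: "r \<ge> 0 \<Longrightarrow> phi s < r \<longleftrightarrow> max 0 s < dPhi r"
  by (metis dPhi_mono dPhi_phi dPhi_strict_mono phi_nonneg leI leD)

lemma phi_le_iff: "r \<ge> 0 \<Longrightarrow> phi s \<le> r \<longleftrightarrow> max 0 s \<le> dPhi r"
  by (metis dPhi_mono dPhi_phi dPhi_strict_mono phi_nonneg leI leD)

lemma phi_mono: "s \<le> t \<Longrightarrow> phi s \<le> phi t"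
  by (subst phi_le_iff) (auto simp: dPhi_phi)

lemma phi_pos: "s > 0 \<Longrightarrow> phi s > 0"
  using phi_le_iff[of 0 s] by simp

text \<open>By \<open>phi_less_iff\<close> and \<open>phi_le_iff\<close>, strict bounds on
  \<open>phi t\<close> are strict bounds on \<open>max 0 t\<close>, hence open conditions on
  \<open>t\<close>.\<close>

lemma continuous_phi: "continuous_on UNIV phi"
proof -
  have "phi \<midarrow>s\<rightarrow> phi s" for s
  proof (rule order_tendstoI)
    fix a assume a: "phi s < a"
    then have "a \<ge> 0" by (smt (verit) phi_nonneg)
    then have iff: "phi t < a \<longleftrightarrow> max 0 t < dPhi a" for t by (rule phi_less_iff)
    have "((\<lambda>t. max 0 t) \<longlongrightarrow> max 0 s) (at s)" by (intro tendsto_intros)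
    from order_tendstoD(2)[OF this, of "dPhi a"] show "eventually (\<lambda>t. phi t < a) (at s)"
      using a by (simp add: iff)
  next
    fix a assume a: "a < phi s"
    show "eventually (\<lambda>t. a < phi t) (at s)"
    proof (cases "a \<ge> 0")
      case True
      then have iff: "a < phi t \<longleftrightarrow> dPhi a < max 0 t" for t using phi_le_iff[of a t] by linarith
      have "((\<lambda>t. max 0 t) \<longlongrightarrow> max 0 s) (at s)" by (intro tendsto_intros)
      from order_tendstoD(1)[OF this, of "dPhi a"] show ?thesis
        using a by (simp add: iff)
    next
      case False
      then have "a < phi t" for t using phi_nonneg[of t] by linarith
      then show ?thesis by simp
    qed
  qed
  then show ?thesis by (simp add: continuous_on_def)
qed

text \<open>The form in which n < 3 enters the second bootstrap step: as \<open>dPhi\<close> grows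
  at least like r^(1/n), its inverse grows at most like s^n, hence at most cubically.\<close>

lemma phi_growth:
  obtains K where "K > 0" "\<And>s. s \<ge> 0 \<Longrightarrow> phi s \<le> K * (1 + s ^ 3)"
proof -
  obtain C R where CR: "C > 0" "R \<ge> 1" "\<And>r. r \<ge> R \<Longrightarrow> dPhi r \<ge> C * r powr (1/n)" 
    using dPhi_growth by blast
  define K where "K = R + 1 / C ^ 3"
  have "phi s \<le> K * (1 + s ^ 3)" if s: "s \<ge> 0" for s
  proof (cases "phi s \<le> R")
    case True
    have "R * 1 \<le> K * (1 + s ^ 3)"
      using CR s by (intro mult_mono) (auto simp: K_def)
    with True show ?thesis by simp
  next
    case False
    let ?u = "phi s powr (1/n)"
    have "C * ?u \<le> s" using CR(3)[of "phi s"] False s by (simp add: dPhi_phi)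
    then have u: "?u \<le> s / C" using CR by (simp add: field_simps)
    have r1: "phi s \<ge> 1" using False CR by simp
    have "phi s = ?u powr n" using n r1 by (simp add: powr_powr)
    also have "\<dots> \<le> ?u powr 3" using n r1 by (intro powr_mono) (auto simp: ge_one_powr_ge_zero)
    also have "\<dots> = ?u ^ 3" using r1 by (simp add: powr_numeral)
    also have "\<dots> \<le> (s / C) ^ 3" using u by (intro power_mono) auto
    also have "\<dots> = 1 / C ^ 3 * s ^ 3" by (simp add: power_divide)
    also have "\<dots> \<le> K * (1 + s ^ 3)"
      using CR s by (intro mult_mono) (auto simp: K_def)
    finally show ?thesis .
  qed
  moreover have "K > 0" using CR by (simp add: K_def add_pos_pos)
  ultimately show ?thesis by (intro that)
qed

text \<open>n < 3 means 4/3 < 1 + 1/n, so \<Phi> controls the large values; below \<open>R\<close>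
  the linear term suffices.\<close>

lemma power_four_thirds_le:
  obtains K where "K > 0" "\<And>r. r \<ge> 0 \<Longrightarrow> r powr (4/3) \<le> K * (r + \<Phi> r)"
proof -
  obtain C R where CR: "C > 0" "R \<ge> 1" "\<And>r. r \<ge> R \<Longrightarrow> \<Phi> r \<ge> C * r powr (1 + 1/n)"
    using Phi_growth by blast
  define K where "K = R + 1 / C"
  have "r powr (4/3) \<le> K * (r + \<Phi> r)" if r: "r \<ge> 0" for r
  proof (cases "r \<ge> R")
    case True
    then have r1: "r \<ge> 1" using CR by simp
    have "r powr (4/3) \<le> r powr (1 + 1/n)"
      using n r1 by (intro powr_mono) (auto simp: field_simps)
    also have "\<dots> \<le> 1 / C * \<Phi> r" using CR(3)[OF True] CR(1) by (simp add: field_simps)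
    also have "\<dots> \<le> K * (r + \<Phi> r)"
      using CR r Phi_nonneg[OF r] by (intro mult_mono) (auto simp: K_def)
    finally show ?thesis .
  next
    case False
    have "r powr (4/3) = r * r powr (1/3)" using r powr_add[of r 1 "1/3"] by simp
    also have "\<dots> \<le> r * R powr (1/3)" using False r by (intro mult_left_mono powr_mono2) auto
    also have "\<dots> \<le> r * R powr 1" using r CR by (intro mult_left_mono powr_mono) auto
    also have "\<dots> \<le> (r + \<Phi> r) * K"
      using CR r Phi_nonneg[OF r] by (intro mult_mono) (auto simp: K_def)
    finally show ?thesis by (simp add: mult.commute)
  qed
  moreover have "K > 0" using CR by (simp add: K_def add_pos_pos)
  ultimately show ?thesis by (intro that)
qed

text \<open>Composition with max 0 is inserted because continuity is known on the closed half-line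
  only.\<close>

lemma borel_measurable_Phi_comp:
  assumes [measurable]: "f \<in> borel_measurable M" and "\<And>x. 0 \<le> f x"
  shows "(\<lambda>x. \<Phi> (f x)) \<in> borel_measurable M" "(\<lambda>x. dPhi (f x)) \<in> borel_measurable M"
proof -
  have "continuous_on {0..} \<Phi>"
    using Phi_C1 by (intro continuous_on_eq_continuous_within[THEN iffD2] ballI) (auto intro: DERIV_continuous)
  have m: "continuous_on UNIV (\<lambda>r::real. max 0 r)" by (intro continuous_intros)
  have "continuous_on UNIV (\<lambda>r. \<Phi> (max 0 r))"
    by (rule continuous_on_compose2[OF \<open>continuous_on {0..} \<Phi>\<close> m]) auto
  moreover have "continuous_on UNIV (\<lambda>r. dPhi (max 0 r))"
    by (rule continuous_on_compose2[OF dPhi_cont m]) auto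
  ultimately have [measurable]: "(\<lambda>r. \<Phi> (max 0 r)) \<in> borel_measurable borel" "(\<lambda>r. dPhi (max 0 r)) \<in> borel_measurable borel"
    by (auto intro: borel_measurable_continuous_onI)
  have "(\<lambda>x. \<Phi> (max 0 (f x))) \<in> borel_measurable M" "(\<lambda>x. dPhi (max 0 (f x))) \<in> borel_measurable M"
    by measurable
  then show "(\<lambda>x. \<Phi> (f x)) \<in> borel_measurable M" "(\<lambda>x. dPhi (f x)) \<in> borel_measurable M"
    using assms(2) by (simp_all add: max_def)
qed

definition psi :: "real \<Rightarrow> real" where "psi s = s * phi s - \<Phi> (phi s)"

text \<open>\<open>psi t\<close> is the maximum of t * r - \<Phi> r over r \<ge> 0, attained at r =
  \<open>phi t\<close>; the competitor r = \<open>phi s\<close> gives the claim. For t < 0 the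
  maximum sits at the boundary point 0, hence the case split.\<close>

lemma psi_subgradient: "(t - s) * phi s \<le> psi t - psi s"
proof -
  have "\<Phi> (phi t) + t * (phi s - phi t) \<le> \<Phi> (phi s)"
  proof (cases "t \<ge> 0")
    case True
    then show ?thesis using Phi_tangent[of "phi t" "phi s"] by (simp add: dPhi_phi max_def)
  next
    case False
    then have "t * phi s \<le> 0" by (simp add: mult_nonpos_nonneg)
    then show ?thesis using False Phi_nonneg[of "phi s"] by simp
  qed
  then show ?thesis by (simp add: psi_def algebra_simps)
qed

text \<open>The pressure, as a function of the enthalpy, is the Legendre transform of \<open>\<Phi>\<close>; it is
  squeezed between its subgradients.\<close>

lemma DERIV_psi: "(psi has_real_derivative phi s) (at s)"
proof -
  have "(\<lambda>t. (psi t - psi s) / (t - s)) \<midarrow>s\<rightarrow> phi s"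
  proof (rule Lim_transform_bound[where g = "\<lambda>t. \<bar>phi t - phi s\<bar>", THEN Lim_null[THEN iffD2], unfolded o_def])
    show "\<forall>\<^sub>F t in at s. norm ((psi t - psi s) / (t - s) - phi s) \<le> norm \<bar>phi t - phi s\<bar>"
    proof (rule eventually_at_topological[THEN iffD2], intro exI[of _ UNIV] conjI ballI impI)
      fix t assume "t \<noteq> s"
      have "(t - s) * phi s \<le> psi t - psi s" "psi t - psi s \<le> (t - s) * phi t"
        using psi_subgradient[of t s] psi_subgradient[of s t] by (auto simp: algebra_simps)
      then show "norm ((psi t - psi s) / (t - s) - phi s) \<le> norm \<bar>phi t - phi s\<bar>"
      proof (cases "t > s")
        case True
        then have "phi s \<le> (psi t - psi s) / (t - s)" "(psi t - psi s) / (t - s) \<le> phi t"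
          using \<open>_ \<le> psi t - psi s\<close> \<open>psi t - psi s \<le> _\<close>
          by (simp_all add: pos_le_divide_eq pos_divide_le_eq mult.commute)
        then show ?thesis by simp
      next
        case False
        then have "t - s < 0" using \<open>t \<noteq> s\<close> by simp
        then have "phi t \<le> (psi t - psi s) / (t - s)" "(psi t - psi s) / (t - s) \<le> phi s"
          using \<open>_ \<le> psi t - psi s\<close> \<open>psi t - psi s \<le> _\<close>
          by (simp_all add: neg_le_divide_eq neg_divide_le_eq mult.commute)
        then show ?thesis by simp
      qed
    qed auto
    have "phi \<midarrow>s\<rightarrow> phi s" using continuous_phi by (simp add: continuous_on_def)
    then show "(\<lambda>t. \<bar>phi t - phi s\<bar>) \<midarrow>s\<rightarrow> 0"
      using tendsto_rabs_zero Lim_null by blast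
  qed
  then show ?thesis by (simp add: has_field_derivative_iff)
qed

text \<open>Integration by parts: r * dPhi r - \<Phi> r is a primitive of the integrand. The
  interior form of the fundamental theorem is used because \<open>dPhi\<close> may fail to be
  differentiable at 0.\<close>

lemma pressure_phi:
  assumes Phi_C2: "\<And>r. r > 0 \<Longrightarrow> (dPhi has_real_derivative ddPhi r) (at r)"
  shows "integral {0..phi s} (\<lambda>\<sigma>. \<sigma> * ddPhi \<sigma>) = psi s"
proof -
  let ?F = "\<lambda>r. r * dPhi r - \<Phi> r"
  have "continuous_on {0..} \<Phi>"
    using Phi_C1 by (intro continuous_on_eq_continuous_within[THEN iffD2] ballI) (auto intro: DERIV_continuous)
  then have "((\<lambda>\<sigma>. \<sigma> * ddPhi \<sigma>) has_integral ?F (phi s) - ?F 0) {0..phi s}"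
  proof (intro fundamental_theorem_of_calculus_interior)
    show "continuous_on {0..phi s} ?F"
      using \<open>continuous_on {0..} \<Phi>\<close> dPhi_cont
      by (intro continuous_intros) (auto intro: continuous_on_subset)
    fix x assume x: "x \<in> {0<..<phi s}"
    then have "(\<Phi> has_real_derivative dPhi x) (at x)"
      using Phi_C1[of x] at_within_interior[of x "{0..}"] by (auto simp: interior_real_atLeast)
    then show "(?F has_vector_derivative x * ddPhi x) (at x)"
      using Phi_C2[of x] x unfolding has_real_derivative_iff_has_vector_derivative[symmetric]
      by (auto intro!: derivative_eq_intros)
  qed auto
  then have "integral {0..phi s} (\<lambda>\<sigma>. \<sigma> * ddPhi \<sigma>) = ?F (phi s) - ?F 0" by (rule integral_unique)
  also have "\<dots> = psi s" by (cases "s \<ge> 0") (auto simp: psi_def dPhi_phi)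
  finally show ?thesis .
qed

end

section \<open>Polarization\<close>

definition polarize :: "R3 \<Rightarrow> real \<Rightarrow> (R3 \<Rightarrow> real) \<Rightarrow> R3 \<Rightarrow> real" where
  "polarize e t f x = (if x \<bullet> e > t then max (f x) (f (hrefl e t x)) else min (f x) (f (hrefl e t x)))"

text \<open>Polarization keeps the part that is even under the reflection and replaces the odd part
  by its absolute value with the sign of the side. On the mirror the odd part vanishes, in
  accordance with sgn 0 = 0.\<close>

lemma polarize_eq:
  "norm e = 1 \<Longrightarrow> polarize e t f x
    = (f x + f (hrefl e t x)) / 2 + sgn (x \<bullet> e - t) * \<bar>f x - f (hrefl e t x)\<bar> / 2"
proof -
  have "hrefl e t x = x" if "x \<bullet> e = t" using that by (simp add: hrefl_def)
  then show ?thesis by (auto simp: polarize_def sgn_real_def max_def min_def field_simps)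
qed

lemma polarize_hrefl_eq:
  "norm e = 1 \<Longrightarrow> polarize e t f (hrefl e t x)
    = (f x + f (hrefl e t x)) / 2 - sgn (x \<bullet> e - t) * \<bar>f x - f (hrefl e t x)\<bar> / 2"
  by (subst polarize_eq) (auto simp: hrefl_inner sgn_real_def abs_minus_commute add.commute)

lemma polarize_cases: "polarize e t f x = f x \<or> polarize e t f x = f (hrefl e t x)"
  by (auto simp: polarize_def max_def min_def)

text \<open>On a mirror pair the two values are either kept or exchanged.\<close>

lemma sum_polarize:
  assumes "norm e = 1"
  shows "G (polarize e t f x) + G (polarize e t f (hrefl e t x)) = G (f x) + (G (f (hrefl e t x)) :: real)"
proof -
  have "hrefl e t x = x" if "x \<bullet> e = t" using that by (simp add: hrefl_def)
  then show ?thesis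
    using assms by (auto simp: polarize_def hrefl_inner max_def min_def)
qed

text \<open>Only the composite of \<open>G\<close> with \<open>f\<close> is assumed measurable,
  because \<Phi> is controlled on the half-line only; the polarized composite is therefore written
  as a selection between that composite and its reflection.\<close>

lemma borel_measurable_comp_polarize:
  assumes [measurable]: "f \<in> borel_measurable borel" "(\<lambda>x. G (f x)) \<in> borel_measurable borel"
  shows "(\<lambda>x. G (polarize e t f x) :: real) \<in> borel_measurable borel"
proof -
  have "(\<lambda>x. G (polarize e t f x)) = (\<lambda>x. if x \<bullet> e > t
      then (if f x \<le> f (hrefl e t x) then G (f (hrefl e t x)) else G (f x))
      else (if f x \<le> f (hrefl e t x) then G (f x) else G (f (hrefl e t x))))"
    by (auto simp: polarize_def max_def min_def fun_eq_iff)
  moreover have "(\<lambda>x. G (f (hrefl e t x))) \<in> borel_measurable borel"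
    using measurable_compose[OF borel_measurable_hrefl assms(2)] by simp
  ultimately show ?thesis by simp
qed

text \<open>Adding to an integral its reflected copy groups the integrand into mirror pairs, to
  which \<open>sum_polarize\<close> applies. The instances are the identity, the power 4/3 and
  \<Phi>.\<close>

lemma integrable_comp_polarize:
  assumes e: "norm e = 1" and [measurable]: "f \<in> borel_measurable borel"
    and G: "integrable lborel (\<lambda>x. G (f x))"
  shows "integrable lborel (\<lambda>x. G (polarize e t f x) :: real)"
    and "(\<integral>x. G (polarize e t f x) \<partial>lborel) = (\<integral>x. G (f x) \<partial>lborel)"
proof -
  have m: "(\<lambda>x. G (f x)) \<in> borel_measurable borel" using G by auto
  note [measurable] = m borel_measurable_comp_polarize[where G=G, OF _ m]
  show i: "integrable lborel (\<lambda>x. G (polarize e t f x))"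
  proof (rule Bochner_Integration.integrable_bound[OF _ _ AE_I2])
    show "integrable lborel (\<lambda>x. \<bar>G (f x)\<bar> + \<bar>G (f (hrefl e t x))\<bar>)"
      using G integrable_hrefl[OF e G] by simp
    show "norm (G (polarize e t f x)) \<le> norm (\<bar>G (f x)\<bar> + \<bar>G (f (hrefl e t x))\<bar>)" for x
      using polarize_cases[of e t f x] by auto
  qed measurable
  have "2 * (\<integral>x. G (polarize e t f x) \<partial>lborel)
      = (\<integral>x. G (polarize e t f x) \<partial>lborel) + (\<integral>x. G (polarize e t f (hrefl e t x)) \<partial>lborel)"
    by (subst integral_hrefl[OF e, of "\<lambda>x. G (polarize e t f x)"]) auto
  also have "\<dots> = (\<integral>x. G (polarize e t f x) + G (polarize e t f (hrefl e t x)) \<partial>lborel)"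
    using i integrable_hrefl[OF e i] by simp
  also have "\<dots> = (\<integral>x. G (f x) + G (f (hrefl e t x)) \<partial>lborel)"
    by (simp add: sum_polarize[OF e])
  also have "\<dots> = (\<integral>x. G (f x) \<partial>lborel) + (\<integral>x. G (f (hrefl e t x)) \<partial>lborel)"
    using G integrable_hrefl[OF e G] by simp
  also have "\<dots> = 2 * (\<integral>x. G (f x) \<partial>lborel)"
    by (subst integral_hrefl[OF e m]) simp
  finally show "(\<integral>x. G (polarize e t f x) \<partial>lborel) = (\<integral>x. G (f x) \<partial>lborel)" by simp
qed

lemma energy_class_polarize:
  assumes e: "norm e = 1" and f: "energy_class f"
  shows "energy_class (polarize e t f)"
proof -
  have "0 \<le> polarize e t f x" for x
    using polarize_cases[of e t f x] f by (auto simp: energy_class_def)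
  then show ?thesis
    using f integrable_comp_polarize(1)[OF e, of f "\<lambda>u. u" t] integrable_comp_polarize(1)[OF e, of f "\<lambda>u. u powr (4/3)" t]
    by (auto simp: energy_class_def)
qed

lemma lborel_pair_distr:
  fixes S T :: "R3 \<Rightarrow> R3"
  assumes S: "distr lborel borel S = lborel" and T: "distr lborel borel T = lborel"
    and [measurable]: "S \<in> borel \<rightarrow>\<^sub>M borel" "T \<in> borel \<rightarrow>\<^sub>M borel"
  shows "distr (lborel \<Otimes>\<^sub>M lborel) (borel \<Otimes>\<^sub>M borel) (\<lambda>(x, y). (S x, T y)) = lborel \<Otimes>\<^sub>M lborel"
proof -
  have "sigma_finite_measure (distr lborel borel T)" unfolding T by (rule sigma_finite_lborel)
  from pair_measure_distr[of S lborel borel T lborel borel, OF _ _ this]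
  show ?thesis by (simp add: S T)
qed

lemma integrable_pair_transform:
  fixes S T :: "R3 \<Rightarrow> R3" and F :: "R3 \<times> R3 \<Rightarrow> real"
  assumes S: "distr lborel borel S = lborel" and T: "distr lborel borel T = lborel"
    and m [measurable]: "S \<in> borel \<rightarrow>\<^sub>M borel" "T \<in> borel \<rightarrow>\<^sub>M borel"
    and F: "integrable (lborel \<Otimes>\<^sub>M lborel) F"
  shows "integrable (lborel \<Otimes>\<^sub>M lborel) (\<lambda>p. F (S (fst p), T (snd p)))"
    and "(\<integral>p. F (S (fst p), T (snd p)) \<partial>(lborel \<Otimes>\<^sub>M lborel)) = (\<integral>p. F p \<partial>(lborel \<Otimes>\<^sub>M lborel))"
proof -
  have [measurable]: "F \<in> borel_measurable (borel \<Otimes>\<^sub>M borel)"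
    using borel_measurable_integrable[OF F] by simp
  have mST: "(\<lambda>(x, y). (S x, T y)) \<in> lborel \<Otimes>\<^sub>M lborel \<rightarrow>\<^sub>M borel \<Otimes>\<^sub>M borel" by measurable
  have "integrable (distr (lborel \<Otimes>\<^sub>M lborel) (borel \<Otimes>\<^sub>M borel) (\<lambda>(x, y). (S x, T y))) F"
    using F unfolding lborel_pair_distr[OF S T m] .
  from integrable_distr[OF mST this] show "integrable (lborel \<Otimes>\<^sub>M lborel) (\<lambda>p. F (S (fst p), T (snd p)))"
    by (simp add: case_prod_beta')
  have "(\<integral>p. F p \<partial>distr (lborel \<Otimes>\<^sub>M lborel) (borel \<Otimes>\<^sub>M borel) (\<lambda>(x, y). (S x, T y)))
     = (\<integral>p. F (S (fst p), T (snd p)) \<partial>(lborel \<Otimes>\<^sub>M lborel))"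
    by (subst integral_distr[OF mST]) (auto simp: case_prod_beta')
  then show "(\<integral>p. F (S (fst p), T (snd p)) \<partial>(lborel \<Otimes>\<^sub>M lborel)) = (\<integral>p. F p \<partial>(lborel \<Otimes>\<^sub>M lborel))"
    unfolding lborel_pair_distr[OF S T m] by simp
qed

text \<open>\<open>K\<close> sums the Coulomb integrand over the four ways of reflecting neither,
  one or both points; none of them changes the integral, and by isometry only two different
  distances occur.\<close>

lemma coulomb_fold:
  fixes e t f
  assumes e: "norm e = 1" and f: "energy_class f"
  defines "s \<equiv> hrefl e t"
  defines "K \<equiv> \<lambda>p. (f (fst p) * f (snd p) + f (s (fst p)) * f (s (snd p))) / norm (fst p - snd p)
      + (f (s (fst p)) * f (snd p) + f (fst p) * f (s (snd p))) / norm (fst p - s (snd p))"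
  shows "integrable (lborel \<Otimes>\<^sub>M lborel) K" and "(\<integral>p. K p \<partial>(lborel \<Otimes>\<^sub>M lborel)) = 4 * coulomb f f"
proof -
  let ?F = "\<lambda>p. f (fst p) * f (snd p) / norm (fst p - snd p)"
  have s: "distr lborel borel s = lborel" "s \<in> borel \<rightarrow>\<^sub>M borel"
    unfolding s_def using lborel_distr_hrefl[OF e] by auto
  have i: "distr lborel borel (\<lambda>x::R3. x) = lborel" "(\<lambda>x::R3. x) \<in> borel \<rightarrow>\<^sub>M borel"
    by (simp_all add: distr_id2)
  note F = integrable_coulomb[OF f f]
  note 1 = integrable_pair_transform[OF s(1) s(1) s(2) s(2) F]
  note 2 = integrable_pair_transform[OF s(1) i(1) s(2) i(2) F]
  note 3 = integrable_pair_transform[OF i(1) s(1) i(2) s(2) F]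
  have K: "K = (\<lambda>p. ?F p + ?F (s (fst p), s (snd p)) + ?F (s (fst p), snd p) + ?F (fst p, s (snd p)))"
    using norm_hrefl_diff[OF e] norm_hrefl_diff'[OF e]
    by (simp add: K_def s_def fun_eq_iff add_divide_distrib)
  show "integrable (lborel \<Otimes>\<^sub>M lborel) K"
    unfolding K using F 1(1) 2(1) 3(1) by (intro Bochner_Integration.integrable_add)
  show "(\<integral>p. K p \<partial>(lborel \<Otimes>\<^sub>M lborel)) = 4 * coulomb f f"
    unfolding K
    apply (subst Bochner_Integration.integral_add, intro Bochner_Integration.integrable_add F 1 2, rule 3)
    apply (subst Bochner_Integration.integral_add, intro Bochner_Integration.integrable_add F 1, rule 2)
    apply (subst Bochner_Integration.integral_add, rule F, rule 1)
    apply (simp only: 1(2) 2(2) 3(2))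
    apply (simp add: coulomb_def)
    done
qed

lemma kernel_reflection_sgn:
  assumes e: "norm e = 1" and "x \<bullet> e \<noteq> t" "y \<bullet> e \<noteq> t" "x \<noteq> y" "x \<noteq> hrefl e t y"
  shows "0 < sgn (x \<bullet> e - t) * sgn (y \<bullet> e - t) * (1 / norm (x - y) - 1 / norm (x - hrefl e t y))"
proof -
  let ?a = "norm (x - y)" and ?b = "norm (x - hrefl e t y)"
  have pos: "?a > 0" "?b > 0" using assms by auto
  have eq: "?b\<^sup>2 = ?a\<^sup>2 + 4 * ((x \<bullet> e - t) * (y \<bullet> e - t))"
    using norm_diff_hrefl_power2[OF e, of x t y] by (simp only: mult.assoc)
  let ?s = "sgn ((x \<bullet> e - t) * (y \<bullet> e - t))"
  have "?s * (1 / ?a - 1 / ?b) > 0"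
  proof (cases "(x \<bullet> e - t) * (y \<bullet> e - t) > 0")
    case True
    then have "?a\<^sup>2 < ?b\<^sup>2" unfolding eq by linarith
    then have "?a < ?b" using pos by (simp add: power2_less_imp_less)
    then show ?thesis using True pos by (simp add: field_simps)
  next
    case False
    then have neg: "(x \<bullet> e - t) * (y \<bullet> e - t) < 0" using assms by (simp add: less_le)
    then have "?b\<^sup>2 < ?a\<^sup>2" unfolding eq by linarith
    then have "?b < ?a" using pos by (simp add: power2_less_imp_less)
    then show ?thesis using neg pos by (simp add: field_simps)
  qed
  then show ?thesis by (simp add: sgn_mult)
qed

text \<open>After folding, the gain in Coulomb energy is the integral of \<open>D\<close>, which is
  |z| - z times a positive factor, with z = v x * v y and \<open>v\<close> the odd part signed by
  the side. Absence of a gain forces z \<ge> 0 for almost all pairs, hence a constant sign of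
  \<open>v\<close>, which is the alternative claimed.\<close>

lemma polarization_rigidity:
  assumes e: "norm e = 1" and f: "energy_class f"
    and le: "coulomb (polarize e t f) (polarize e t f) \<le> coulomb f f"
  shows "(AE x in lborel. x \<bullet> e > t \<longrightarrow> f (hrefl e t x) \<le> f x) \<or>
         (AE x in lborel. x \<bullet> e > t \<longrightarrow> f x \<le> f (hrefl e t x))"
proof -
  define s where "s = hrefl e t"
  define S where "S x = sgn (x \<bullet> e - t)" for x
  define w where "w x = f x - f (s x)" for x
  let ?g = "polarize e t f"
  define K where "K f p = (f (fst p) * f (snd p) + f (s (fst p)) * f (s (snd p))) / norm (fst p - snd p)
      + (f (s (fst p)) * f (snd p) + f (fst p) * f (s (snd p))) / norm (fst p - s (snd p))"
    for f :: "R3 \<Rightarrow> real" and p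
  define D where "D p = (S (fst p) * S (snd p) * (\<bar>w (fst p)\<bar> * \<bar>w (snd p)\<bar>) - w (fst p) * w (snd p))
      * (1 / norm (fst p - snd p) - 1 / norm (fst p - s (snd p))) / 2" for p
  have KD: "K ?g p - K f p = D p" for p
  proof -
    let ?a = "f (fst p)" and ?a' = "f (s (fst p))" and ?b = "f (snd p)" and ?b' = "f (s (snd p))"
    let ?k = "1 / norm (fst p - snd p)" and ?l = "1 / norm (fst p - s (snd p))"
    let ?u = "S (fst p) * \<bar>w (fst p)\<bar>" and ?v = "S (snd p) * \<bar>w (snd p)\<bar>"
    have g: "?g (fst p) = (?a + ?a') / 2 + ?u / 2" "?g (s (fst p)) = (?a + ?a') / 2 - ?u / 2"
        "?g (snd p) = (?b + ?b') / 2 + ?v / 2" "?g (s (snd p)) = (?b + ?b') / 2 - ?v / 2"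
      unfolding s_def S_def w_def by (rule polarize_eq[OF e] polarize_hrefl_eq[OF e])+
    \<comment> \<open>The even parts cancel; only the products of the odd parts, weighted by the
      difference of the two kernels, survive.\<close>
    have alg: "((A + u/2) * (B + v/2) + (A - u/2) * (B - v/2)) * k + ((A - u/2) * (B + v/2) + (A + u/2) * (B - v/2)) * l
        - ((a * b + a' * b') * k + (a' * b + a * b') * l)
      = (u * v - (a - a') * (b - b')) * (k - l) / 2"
      if "A = (a + a') / 2" "B = (b + b') / 2" for A B a a' b b' u v k l :: real
      unfolding that by (simp add: field_simps)
    have "K ?g p - K f p = (?u * ?v - w (fst p) * w (snd p)) * (?k - ?l) / 2"
      unfolding K_def g w_def
      using alg[OF refl refl, of ?a ?a' ?u ?b ?b' ?v ?k ?l] by (simp add: w_def)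
    then show ?thesis by (simp add: D_def mult_ac)
  qed
  have fold': "integrable (lborel \<Otimes>\<^sub>M lborel) (K h)" "(\<integral>p. K h p \<partial>(lborel \<Otimes>\<^sub>M lborel)) = 4 * coulomb h h"
    if "energy_class h" for h
    using coulomb_fold[OF e that, of t] by (simp_all add: K_def[abs_def] s_def)
  note fold = fold'[OF f] fold'[OF energy_class_polarize[OF e f, of t]]
  have iD: "integrable (lborel \<Otimes>\<^sub>M lborel) D" and ID: "(\<integral>p. D p \<partial>(lborel \<Otimes>\<^sub>M lborel)) \<le> 0"
  proof -
    have "integrable (lborel \<Otimes>\<^sub>M lborel) (\<lambda>p. K ?g p - K f p)"
      using fold by (intro Bochner_Integration.integrable_diff)
    then show "integrable (lborel \<Otimes>\<^sub>M lborel) D" by (simp add: KD)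
    have "(\<integral>p. K ?g p - K f p \<partial>(lborel \<Otimes>\<^sub>M lborel)) = 4 * coulomb ?g ?g - 4 * coulomb f f"
      using fold by (subst Bochner_Integration.integral_diff) auto
    then show "(\<integral>p. D p \<partial>(lborel \<Otimes>\<^sub>M lborel)) \<le> 0" using le by (simp add: KD)
  qed
  have e0: "e \<noteq> 0" using e by auto
  have [measurable]: "s \<in> borel \<rightarrow>\<^sub>M borel" unfolding s_def by simp
  \<comment> \<open>Off these null sets both distances are nonzero and the kernel difference has a
    definite sign.\<close>
  have generic: "AE p in lborel \<Otimes>\<^sub>M lborel. fst p \<bullet> e \<noteq> t \<and> snd p \<bullet> e \<noteq> t \<and> fst p \<noteq> snd p \<and> fst p \<noteq> s (snd p)"
  proof (rule lborel_pair.AE_pair_measure)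
    show "{p \<in> space (lborel \<Otimes>\<^sub>M lborel). fst p \<bullet> e \<noteq> t \<and> snd p \<bullet> e \<noteq> t \<and> fst p \<noteq> snd p \<and> fst p \<noteq> s (snd p)}
        \<in> sets (lborel \<Otimes>\<^sub>M lborel)"
      by measurable
    show "AE x in lborel. AE y in lborel. fst (x, y) \<bullet> e \<noteq> t \<and> snd (x, y) \<bullet> e \<noteq> t \<and> fst (x, y) \<noteq> snd (x, y) \<and> fst (x, y) \<noteq> s (snd (x, y))"
      using AE_inner_neq[OF e0, of t]
    proof eventually_elim
      fix x :: R3 assume "x \<bullet> e \<noteq> t"
      have "AE y in lborel. y \<noteq> x" "AE y in lborel. y \<noteq> s x" by (rule AE_lborel_singleton)+
      then show "AE y in lborel. fst (x, y) \<bullet> e \<noteq> t \<and> snd (x, y) \<bullet> e \<noteq> t \<and> fst (x, y) \<noteq> snd (x, y) \<and> fst (x, y) \<noteq> s (snd (x, y))"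
        using AE_inner_neq[OF e0, of t]
        by eventually_elim (use \<open>x \<bullet> e \<noteq> t\<close> hrefl_hrefl[OF e] in \<open>auto simp: s_def\<close>)
    qed
  qed
  define v where "v x = S x * w x" for x
  have key: "0 \<le> D p \<and> (D p = 0 \<longrightarrow> 0 \<le> v (fst p) * v (snd p))"
    if *: "fst p \<bullet> e \<noteq> t \<and> snd p \<bullet> e \<noteq> t \<and> fst p \<noteq> snd p \<and> fst p \<noteq> s (snd p)" for p
  proof -
    let ?c = "S (fst p) * S (snd p)"
    let ?k = "1 / norm (fst p - snd p) - 1 / norm (fst p - s (snd p))"
    have c: "?c * ?c = 1" using * by (simp add: S_def sgn_real_def)
    have pos: "?c * ?k > 0" unfolding S_def s_def by (rule kernel_reflection_sgn[OF e]) (use * in \<open>auto simp: s_def\<close>)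
    have vv: "v (fst p) * v (snd p) = ?c * (w (fst p) * w (snd p))" by (simp add: v_def mult_ac)
    have absv: "\<bar>v (fst p) * v (snd p)\<bar> = \<bar>w (fst p)\<bar> * \<bar>w (snd p)\<bar>"
    proof -
      have "\<bar>?c\<bar> = 1" using c by (simp add: abs_mult_self_eq flip: power2_eq_square) (simp add: power2_eq_1_iff abs_if; linarith)
      then show ?thesis unfolding vv by (simp add: abs_mult)
    qed
    have "D p = (?c * ?c) * (?c * \<bar>v (fst p) * v (snd p)\<bar> - w (fst p) * w (snd p)) * ?k / 2"
      unfolding c absv by (simp add: D_def mult_ac)
    also have "\<dots> = ((?c * ?c) * \<bar>v (fst p) * v (snd p)\<bar> - v (fst p) * v (snd p)) * (?c * ?k) / 2"
      unfolding vv by (simp add: algebra_simps)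
    finally have "D p = (\<bar>v (fst p) * v (snd p)\<bar> - v (fst p) * v (snd p)) * (?c * ?k) / 2"
      unfolding c by simp
    moreover have "0 \<le> (\<bar>z\<bar> - z) * q / 2 \<and> ((\<bar>z\<bar> - z) * q / 2 = 0 \<longrightarrow> 0 \<le> z)" if "q > 0" for z q :: real
      using that by (cases "z \<ge> 0") (auto simp: mult_nonpos_nonneg)
    ultimately show ?thesis using pos by metis
  qed
  have nnD: "AE p in lborel \<Otimes>\<^sub>M lborel. 0 \<le> D p" using generic by eventually_elim (use key in blast)
  have "(\<integral>p. D p \<partial>(lborel \<Otimes>\<^sub>M lborel)) = 0"
    using ID integral_nonneg_AE[OF nnD] by simp
  then have "AE p in lborel \<Otimes>\<^sub>M lborel. D p = 0"
    using integral_nonneg_eq_0_iff_AE[OF iD nnD] by simp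
  then have "AE p in lborel \<Otimes>\<^sub>M lborel. 0 \<le> v (fst p) * v (snd p)"
    using generic by eventually_elim (use key in blast)
  from lborel_pair.AE_pair[OF this] have ae: "AE x in lborel. AE y in lborel. 0 \<le> v x * v y" by simp
  have "(AE x in lborel. 0 \<le> v x) \<or> (AE x in lborel. v x \<le> 0)"
  proof (rule disjCI)
    assume not: "\<not> (AE x in lborel. v x \<le> 0)"
    \<comment> \<open>A single good point \<open>x\<close> with v x > 0 fixes the sign of
      \<open>v\<close> at almost every \<open>y\<close>.\<close>
    have "\<exists>x. (AE y in lborel. 0 \<le> v x * v y) \<and> \<not> v x \<le> 0"
    proof (rule ccontr)
      assume "\<not> ?thesis"
      then have "AE x in lborel. v x \<le> 0" using ae by (auto elim: eventually_mono)
      with not show False ..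
    qed
    then obtain x where x: "AE y in lborel. 0 \<le> v x * v y" "v x > 0" by auto
    show "AE x in lborel. 0 \<le> v x"
      using x(1) by eventually_elim (use x(2) in \<open>simp add: zero_le_mult_iff\<close>)
  qed
  then show ?thesis
  proof
    assume "AE x in lborel. 0 \<le> v x"
    then have "AE x in lborel. x \<bullet> e > t \<longrightarrow> f (hrefl e t x) \<le> f x"
      by eventually_elim (auto simp: v_def S_def w_def s_def)
    then show ?thesis ..
  next
    assume "AE x in lborel. v x \<le> 0"
    then have "AE x in lborel. x \<bullet> e > t \<longrightarrow> f x \<le> f (hrefl e t x)"
      by eventually_elim (auto simp: v_def S_def w_def s_def)
    then show ?thesis ..
  qed
qed

section \<open>Radial symmetry\<close>

definition newton :: "(R3 \<Rightarrow> real) \<Rightarrow> R3 \<Rightarrow> ennreal" where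
  "newton f x = (\<integral>\<^sup>+y. ennreal (f y / norm (x - y)) \<partial>lborel)"

definition polar_rigid :: "(R3 \<Rightarrow> real) \<Rightarrow> bool" where
  "polar_rigid f \<longleftrightarrow> (\<forall>e t. norm e = 1 \<longrightarrow>
     (AE x in lborel. x \<bullet> e > t \<longrightarrow> f (hrefl e t x) \<le> f x) \<or>
     (AE x in lborel. x \<bullet> e > t \<longrightarrow> f x \<le> f (hrefl e t x)))"

locale rigid_density =
  fixes f :: "R3 \<Rightarrow> real" and M :: real
  assumes int_f: "integrable lborel f" and f_nonneg: "\<And>x. 0 \<le> f x"
    and mass: "(\<integral>x. f x \<partial>lborel) = M" and M_pos: "M > 0" and rigid: "polar_rigid f"
begin

lemma f_measurable [measurable]: "f \<in> borel_measurable borel" using int_f by auto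

section \<open>Masses of half-spaces and the centre of symmetry\<close>

definition half_mass :: "R3 \<Rightarrow> real \<Rightarrow> real" where
  "half_mass e t = (\<integral>x. f x * indicator {x. x \<bullet> e > t} x \<partial>lborel)"

lemma integrable_half [simp]:
  "integrable lborel (\<lambda>x. f x * indicator {x. x \<bullet> e > t} x)" "integrable lborel (\<lambda>x. f x * indicator {x. x \<bullet> e < t} x)"
  by (rule integrable_real_mult_indicator; use int_f in measurable)+

lemma half_mass_compl:
  assumes "e \<noteq> 0"
  shows "(\<integral>x. f x * indicator {x. x \<bullet> e < t} x \<partial>lborel) = M - half_mass e t"
proof -
  have "M = (\<integral>x. f x * indicator {x. x \<bullet> e < t} x + f x * indicator {x. x \<bullet> e > t} x \<partial>lborel)"
    unfolding mass[symmetric]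
  proof (rule integral_cong_AE)
    show "AE x in lborel. f x = f x * indicator {x. x \<bullet> e < t} x + f x * indicator {x. x \<bullet> e > t} x"
      using AE_inner_neq[OF assms, of t] by eventually_elim (auto simp: indicator_def)
  qed measurable
  also have "\<dots> = (\<integral>x. f x * indicator {x. x \<bullet> e < t} x \<partial>lborel) + half_mass e t"
    unfolding half_mass_def by simp
  finally show ?thesis by simp
qed

text \<open>With the limit \<open>g\<close> as a parameter this covers continuity in the offset as
  well as both limits at infinity, where \<open>g\<close> is 0 or 1.\<close>

lemma half_mass_limit:
  assumes lim: "AE x in lborel. (\<lambda>k. indicator {x. x \<bullet> e > T k} x :: real) \<longlonglongrightarrow> g x"
    and [measurable]: "g \<in> borel_measurable borel"
  shows "(\<lambda>k. half_mass e (T k)) \<longlonglongrightarrow> (\<integral>x. f x * g x \<partial>lborel)"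
  unfolding half_mass_def
proof (rule integral_dominated_convergence[where w = f])
  show "AE x in lborel. (\<lambda>k. f x * indicator {x. x \<bullet> e > T k} x) \<longlonglongrightarrow> f x * g x"
    using lim by eventually_elim (intro tendsto_mult tendsto_const)
  show "AE x in lborel. norm (f x * indicator {x. x \<bullet> e > T k} x) \<le> f x" for k
    using f_nonneg by (auto simp: indicator_def)
qed (use int_f in measurable)

lemma continuous_half_mass:
  assumes e: "e \<noteq> 0" shows "continuous_on UNIV (half_mass e)"
proof (rule continuous_at_imp_continuous_on, intro ballI)
  fix t
  show "isCont (half_mass e) t"
    unfolding continuous_at_sequentially
  proof (intro allI impI)
    fix T :: "nat \<Rightarrow> real" assume T: "T \<longlonglongrightarrow> t"
    show "(half_mass e \<circ> T) \<longlonglongrightarrow> half_mass e t"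
      unfolding o_def half_mass_def[of e t]
    proof (rule half_mass_limit)
      show "AE x in lborel. (\<lambda>k. indicator {x. x \<bullet> e > T k} x :: real) \<longlonglongrightarrow> indicator {x. x \<bullet> e > t} x"
        using AE_inner_neq[OF e, of t]
      proof eventually_elim
        fix x :: R3 assume "x \<bullet> e \<noteq> t"
        then consider "x \<bullet> e > t" | "x \<bullet> e < t" by linarith
        then show "(\<lambda>k. indicator {x. x \<bullet> e > T k} x :: real) \<longlonglongrightarrow> indicator {x. x \<bullet> e > t} x"
        proof cases
          case 1
          from order_tendstoD(2)[OF T 1] show ?thesis
            using 1 by (intro tendsto_eventually) (auto elim!: eventually_mono)
        next
          case 2
          from order_tendstoD(1)[OF T 2] show ?thesis
            using 2 by (intro tendsto_eventually) (auto elim!: eventually_mono)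
        qed
      qed
    qed measurable
  qed
qed

lemma median_exists:
  assumes e: "e \<noteq> 0" obtains t where "half_mass e t = M / 2"
proof -
  have "(\<lambda>k. half_mass e (real k)) \<longlonglongrightarrow> (\<integral>x. f x * 0 \<partial>lborel)"
  proof (rule half_mass_limit)
    show "AE x in lborel. (\<lambda>k. indicator {x. x \<bullet> e > real k} x :: real) \<longlonglongrightarrow> 0"
    proof (rule AE_I2, rule tendsto_eventually)
      fix x :: R3
      obtain K :: nat where "x \<bullet> e < real K" using reals_Archimedean2 by blast
      then have "x \<bullet> e \<le> real k" if "k \<ge> K" for k using that by (smt (verit) of_nat_mono)
      then show "\<forall>\<^sub>F k in sequentially. (indicator {x. x \<bullet> e > real k} x :: real) = 0"
        by (intro eventually_sequentiallyI[of K]) (auto simp: not_less)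
    qed
  qed simp
  from order_tendstoD(2)[OF this, of "M / 2"] M_pos
  have "\<forall>\<^sub>F k in sequentially. half_mass e (real k) < M / 2" by simp
  then obtain b where b: "half_mass e (real b) < M / 2" by (auto simp: eventually_sequentially)
  have "(\<lambda>k. half_mass e (- real k)) \<longlonglongrightarrow> (\<integral>x. f x * 1 \<partial>lborel)"
  proof (rule half_mass_limit)
    show "AE x in lborel. (\<lambda>k. indicator {x. x \<bullet> e > - real k} x :: real) \<longlonglongrightarrow> 1"
    proof (rule AE_I2, rule tendsto_eventually)
      fix x :: R3
      obtain K :: nat where "- (x \<bullet> e) < real K" using reals_Archimedean2 by blast
      then have "x \<bullet> e > - real k" if "k \<ge> K" for k using that by (smt (verit) of_nat_mono)
      then show "\<forall>\<^sub>F k in sequentially. (indicator {x. x \<bullet> e > - real k} x :: real) = 1"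
        by (intro eventually_sequentiallyI[of K]) auto
    qed
  qed simp
  from order_tendstoD(1)[OF this, of "M / 2"] M_pos mass
  have "\<forall>\<^sub>F k in sequentially. half_mass e (- real k) > M / 2" by simp
  then obtain a where a: "half_mass e (- real a) > M / 2" by (auto simp: eventually_sequentially)
  have "\<exists>x\<ge>- real a. x \<le> real b \<and> half_mass e x = M / 2"
    using a b by (intro IVT2') (auto intro: continuous_on_subset[OF continuous_half_mass[OF e]])
  then show ?thesis using that by blast
qed

text \<open>The reflection carries the mass of the opposite side, \<open>M - half_mass e t\<close>,
  onto this side.\<close>

lemma half_mass_difference:
  assumes e: "norm e = 1"
  shows "integrable lborel (\<lambda>x. (f x - f (hrefl e t x)) * indicator {x. x \<bullet> e > t} x)"
    and "(\<integral>x. (f x - f (hrefl e t x)) * indicator {x. x \<bullet> e > t} x \<partial>lborel) = 2 * half_mass e t - M"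
proof -
  have e0: "e \<noteq> 0" using e by auto
  have ind: "indicator {x. x \<bullet> e > t} x = (indicator {x. x \<bullet> e < t} (hrefl e t x) :: real)" for x
    by (auto simp: indicator_def hrefl_inner[OF e])
  have split: "(f x - f (hrefl e t x)) * indicator {x. x \<bullet> e > t} x = f x * indicator {x. x \<bullet> e > t} x
      - f (hrefl e t x) * indicator {x. x \<bullet> e < t} (hrefl e t x)" for x
    by (simp add: ind left_diff_distrib)
  have i2: "integrable lborel (\<lambda>x. f (hrefl e t x) * indicator {x. x \<bullet> e < t} (hrefl e t x))"
    by (rule integrable_hrefl[OF e, of "\<lambda>x. f x * indicator {x. x \<bullet> e < t} x"]) simp
  show "integrable lborel (\<lambda>x. (f x - f (hrefl e t x)) * indicator {x. x \<bullet> e > t} x)"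
    unfolding split using i2 by simp
  have "(\<integral>x. f (hrefl e t x) * indicator {x. x \<bullet> e < t} (hrefl e t x) \<partial>lborel) = M - half_mass e t"
    unfolding half_mass_compl[OF e0, symmetric]
    by (rule integral_hrefl[OF e, of "\<lambda>x. f x * indicator {x. x \<bullet> e < t} x"]) measurable
  then show "(\<integral>x. (f x - f (hrefl e t x)) * indicator {x. x \<bullet> e > t} x \<partial>lborel) = 2 * half_mass e t - M"
    unfolding split using i2 by (simp add: half_mass_def)
qed

text \<open>If rigidity offers the opposite inequality, the integrand of
  \<open>half_mass_difference\<close> is nonnegative with nonpositive integral, so both inequalities
  hold.\<close>

lemma reflection_le:
  assumes e: "norm e = 1" and le: "half_mass e t \<le> M / 2"
  shows "AE x in lborel. x \<bullet> e > t \<longrightarrow> f x \<le> f (hrefl e t x)"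
proof -
  let ?D = "\<lambda>x. (f x - f (hrefl e t x)) * indicator {x. x \<bullet> e > t} x"
  consider "AE x in lborel. x \<bullet> e > t \<longrightarrow> f (hrefl e t x) \<le> f x" |
    "AE x in lborel. x \<bullet> e > t \<longrightarrow> f x \<le> f (hrefl e t x)"
    using rigid e by (auto simp: polar_rigid_def)
  then show ?thesis
  proof cases
    case 1
    then have nn: "AE x in lborel. 0 \<le> ?D x" by eventually_elim (auto simp: indicator_def)
    then have "(\<integral>x. ?D x \<partial>lborel) \<ge> 0" by (rule integral_nonneg_AE)
    then have "(\<integral>x. ?D x \<partial>lborel) = 0" using le half_mass_difference(2)[OF e, of t] by simp
    then have "AE x in lborel. ?D x = 0"
      using integral_nonneg_eq_0_iff_AE[OF half_mass_difference(1)[OF e] nn] by simp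
    then show ?thesis by eventually_elim (auto simp: indicator_def)
  qed
qed

lemma reflection_ge:
  assumes e: "norm e = 1" and ge: "half_mass e t \<ge> M / 2"
  shows "AE x in lborel. x \<bullet> e > t \<longrightarrow> f (hrefl e t x) \<le> f x"
proof -
  let ?D = "\<lambda>x. (f (hrefl e t x) - f x) * indicator {x. x \<bullet> e > t} x"
  have eq: "?D x = - ((f x - f (hrefl e t x)) * indicator {x. x \<bullet> e > t} x)" for x
    by (simp add: algebra_simps)
  have D: "integrable lborel ?D" "(\<integral>x. ?D x \<partial>lborel) = M - 2 * half_mass e t"
    unfolding eq using half_mass_difference[OF e, of t] by simp_all
  consider "AE x in lborel. x \<bullet> e > t \<longrightarrow> f (hrefl e t x) \<le> f x" |
    "AE x in lborel. x \<bullet> e > t \<longrightarrow> f x \<le> f (hrefl e t x)"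
    using rigid e by (auto simp: polar_rigid_def)
  then show ?thesis
  proof cases
    case 2
    then have nn: "AE x in lborel. 0 \<le> ?D x" by eventually_elim (auto simp: indicator_def)
    then have "(\<integral>x. ?D x \<partial>lborel) \<ge> 0" by (rule integral_nonneg_AE)
    then have "(\<integral>x. ?D x \<partial>lborel) = 0" using ge D(2) by simp
    then have "AE x in lborel. ?D x = 0"
      using integral_nonneg_eq_0_iff_AE[OF D(1) nn] by simp
    then show ?thesis by eventually_elim (auto simp: indicator_def)
  qed
qed

lemma reflection_eq:
  assumes e: "norm e = 1" and eq: "half_mass e t = M / 2"
  shows "AE x in lborel. f (hrefl e t x) = f x"
proof -
  have 1: "AE x in lborel. x \<bullet> e > t \<longrightarrow> f (hrefl e t x) = f x"
    using reflection_le[OF e, of t] reflection_ge[OF e, of t] eq by auto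
  have e0: "e \<noteq> 0" using e by auto
  show ?thesis
    using 1 AE_hrefl[OF e 1, of t] AE_inner_neq[OF e0, of t]
    by eventually_elim (use e in \<open>auto simp: hrefl_inner linorder_neq_iff\<close>)
qed

text \<open>The centre is the common point of the median hyperplanes in three orthogonal directions.\<close>

lemma center_exists:
  obtains c where "AE x in lborel. f (2 *\<^sub>R c - x) = f x"
proof -
  have ax: "norm (axis i (1::real) :: R3) = 1" for i by (simp add: norm_axis_1)
  have "\<exists>t. half_mass (axis i 1) t = M / 2" for i
    using median_exists[of "axis i 1"] by (metis ax norm_zero zero_neq_one)
  then obtain t where t: "\<And>i. half_mass (axis i 1) (t i) = M / 2" by metis
  define c :: R3 where "c = (\<chi> i. t i)"
  define s where "s i = hrefl (axis i 1) (t i)" for i :: 3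
  have s: "AE x in lborel. f (s i x) = f x" for i
    unfolding s_def by (rule reflection_eq[OF ax t])
  have s2: "AE x in lborel. f (s i (s j x)) = f (s j x)" for i j
    using AE_hrefl[OF ax s[of i], of j "t j"] by (simp add: s_def)
  have s3: "AE x in lborel. f (s i (s j (s k x))) = f (s j (s k x))" for i j k
    using AE_hrefl[OF ax s2[of i j], of k "t k"] by (simp add: s_def)
  have comp: "s 1 (s 2 (s 3 x)) = 2 *\<^sub>R c - x" for x
    by (simp add: vec_eq_iff forall_3 s_def hrefl_def c_def inner_axis) (simp add: axis_def)
  have "AE x in lborel. f (2 *\<^sub>R c - x) = f x"
    using s3[of 1 2 3] s2[of 2 3] s[of 3] unfolding comp by eventually_elim simp
  then show ?thesis using that by blast
qed

lemma half_mass_center: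
  assumes c: "AE x in lborel. f (2 *\<^sub>R c - x) = f x" and e: "norm e = 1"
  shows "half_mass e (c \<bullet> e) = M / 2"
proof -
  have e0: "e \<noteq> 0" using e by auto
  let ?g = "\<lambda>x. f x * indicator {x. x \<bullet> e < c \<bullet> e} x"
  have "M - half_mass e (c \<bullet> e) = (\<integral>x. ?g x \<partial>lborel)"
    by (rule half_mass_compl[OF e0, symmetric])
  also have "\<dots> = (\<integral>x. ?g x \<partial>distr lborel borel (\<lambda>x. 2 *\<^sub>R c - x))" by (simp add: lborel_distr_diff)
  also have "\<dots> = (\<integral>x. ?g (2 *\<^sub>R c - x) \<partial>lborel)" by (rule integral_distr) measurable
  also have "\<dots> = half_mass e (c \<bullet> e)" unfolding half_mass_def
  proof (rule integral_cong_AE)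
    show "AE x in lborel. ?g (2 *\<^sub>R c - x) = f x * indicator {x. x \<bullet> e > c \<bullet> e} x"
      using c by eventually_elim (auto simp: indicator_def inner_diff_left)
  qed measurable
  finally show ?thesis by simp
qed

lemma half_mass_antimono: "s \<le> t \<Longrightarrow> half_mass e t \<le> half_mass e s"
  unfolding half_mass_def
  by (rule integral_mono[OF integrable_half(1) integrable_half(1)])
    (use f_nonneg in \<open>auto simp: indicator_def\<close>)

text \<open>\<open>c\<close> lies on the bisector of \<open>x\<close> and \<open>y\<close> or on the
  side of \<open>y\<close>. On that side the density takes the larger value of each mirror pair, and
  its points are closer to \<open>y\<close> than to \<open>x\<close>.\<close>

lemma newton_antimono:
  assumes c: "AE x in lborel. f (2 *\<^sub>R c - x) = f x" and le: "norm (y - c) \<le> norm (x - c)"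
  shows "newton f x \<le> newton f y"
proof (cases "x = y")
  case False
  define e where "e = sgn (x - y)"
  define t where "t = (x + y) \<bullet> e / 2"
  have e: "norm e = 1" using False by (simp add: e_def norm_sgn)
  have e0: "e \<noteq> 0" using e by auto
  have xy: "hrefl e t x = y" using hrefl_swap[OF False] by (simp add: e_def t_def)
  then have yx: "hrefl e t y = x" using e hrefl_hrefl by blast
  have "(norm (y - c))\<^sup>2 \<le> (norm (x - c))\<^sup>2" using le by (intro power_mono) auto
  then have "0 \<le> (x - y) \<bullet> (x + y - 2 *\<^sub>R c)"
    unfolding power2_norm_eq_inner
    by (simp add: inner_diff_left inner_diff_right inner_add_right inner_commute algebra_simps)
  then have "0 \<le> e \<bullet> (x + y - 2 *\<^sub>R c)"
    by (simp add: e_def sgn_div_norm)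
  then have ct: "c \<bullet> e \<le> t"
    by (simp add: t_def inner_diff_right inner_add_right inner_add_left inner_commute)
  have "half_mass e t \<le> M / 2"
    using half_mass_antimono[OF ct, of e] half_mass_center[OF c e] by simp
  then have 1: "AE z in lborel. z \<bullet> e > t \<longrightarrow> f z \<le> f (hrefl e t z)" by (rule reflection_le[OF e])
  let ?r = "hrefl e t"
  have xr: "norm (x - ?r z) = norm (y - z)" "norm (y - ?r z) = norm (x - z)" for z
    using norm_hrefl_diff'[OF e, of t x z] norm_hrefl_diff'[OF e, of t y z] by (simp_all add: xy yx)
  have sq: "(norm (y - z))\<^sup>2 = (norm (x - z))\<^sup>2 + 4 * (x \<bullet> e - t) * (z \<bullet> e - t)" for z
    using norm_diff_hrefl_power2[OF e, of x t z] xr(1)[of z] by simp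
  have xt: "x \<bullet> e > t"
  proof -
    have "x \<bullet> e - t = (x - y) \<bullet> e / 2" by (simp add: t_def inner_add_left inner_diff_left field_simps)
    also have "(x - y) \<bullet> e = norm (x - y)"
      using False by (simp add: e_def sgn_div_norm dot_square_norm power2_eq_square)
    finally have "x \<bullet> e - t = norm (x - y) / 2" .
    moreover have "norm (x - y) > 0" using False by simp
    ultimately show ?thesis by linarith
  qed
  \<comment> \<open>Doubling pairs each \<open>z\<close> with its mirror image, which makes the
    comparison pointwise.\<close>
  have twice: "newton f w + newton f w = (\<integral>\<^sup>+z. ennreal (f z / norm (w - z) + f (?r z) / norm (w - ?r z)) \<partial>lborel)" for w
  proof -
    have "(\<integral>\<^sup>+z. ennreal (f (?r z) / norm (w - ?r z)) \<partial>lborel) = newton f w"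
      unfolding newton_def by (rule nn_integral_hrefl[OF e, of "\<lambda>z. ennreal (f z / norm (w - z))"]) measurable
    then have "newton f w + newton f w = newton f w + (\<integral>\<^sup>+z. ennreal (f (?r z) / norm (w - ?r z)) \<partial>lborel)" by simp
    also have "\<dots> = (\<integral>\<^sup>+z. ennreal (f z / norm (w - z)) + ennreal (f (?r z) / norm (w - ?r z)) \<partial>lborel)"
      unfolding newton_def by (rule nn_integral_add[symmetric]) measurable
    finally show ?thesis using f_nonneg by (simp add: ennreal_plus)
  qed
  have "newton f x + newton f x \<le> newton f y + newton f y"
    unfolding twice
  proof (rule nn_integral_mono_AE)
    have "AE z in lborel. z \<noteq> x" "AE z in lborel. z \<noteq> y" by (rule AE_lborel_singleton)+
    then show "AE z in lborel. ennreal (f z / norm (x - z) + f (?r z) / norm (x - ?r z))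
        \<le> ennreal (f z / norm (y - z) + f (?r z) / norm (y - ?r z))"
      using 1 AE_hrefl[OF e 1, of t] AE_inner_neq[OF e0, of t]
    proof eventually_elim
      fix z assume z: "z \<noteq> x" "z \<noteq> y" "z \<bullet> e > t \<longrightarrow> f z \<le> f (?r z)"
        "?r z \<bullet> e > t \<longrightarrow> f (?r z) \<le> f (?r (?r z))" "z \<bullet> e \<noteq> t"
      have pos: "norm (x - z) > 0" "norm (y - z) > 0" using z by auto
      let ?a = "1 / norm (x - z)" and ?b = "1 / norm (y - z)"
      have "(f z - f (?r z)) * (?a - ?b) \<le> 0"
      proof (cases "z \<bullet> e > t")
        case True
        then have "0 \<le> 4 * (x \<bullet> e - t) * (z \<bullet> e - t)" using xt by simp
        then have "(norm (x - z))\<^sup>2 \<le> (norm (y - z))\<^sup>2" unfolding sq by linarith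
        from power2_le_imp_le[OF this norm_ge_zero] have "norm (x - z) \<le> norm (y - z)" .
        then have "?b \<le> ?a" using pos by (simp add: frac_le)
        then show ?thesis using True z by (simp add: mult_nonpos_nonneg)
      next
        case False
        then have lt: "z \<bullet> e < t" using z by simp
        then have "4 * (x \<bullet> e - t) * (z \<bullet> e - t) \<le> 0" using xt by (simp add: mult_nonneg_nonpos)
        then have "(norm (y - z))\<^sup>2 \<le> (norm (x - z))\<^sup>2" unfolding sq by linarith
        from power2_le_imp_le[OF this norm_ge_zero] have "norm (y - z) \<le> norm (x - z)" .
        then have "?a \<le> ?b" using pos by (simp add: frac_le)
        moreover have "f (?r z) \<le> f z" using lt z e by (simp add: hrefl_inner)
        ultimately show ?thesis by (simp add: mult_nonneg_nonpos)
      qed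
      then have "f z / norm (x - z) + f (?r z) / norm (x - ?r z) \<le> f z / norm (y - z) + f (?r z) / norm (y - ?r z)"
        unfolding xr by (simp add: algebra_simps)
      then show "ennreal (f z / norm (x - z) + f (?r z) / norm (x - ?r z))
        \<le> ennreal (f z / norm (y - z) + f (?r z) / norm (y - ?r z))" by (rule ennreal_leI)
    qed
  qed
  then show ?thesis
    by (metis add_strict_mono leD leI)
qed simp

end

section \<open>The Euler--Lagrange equation\<close>

locale steady_state = casimir +
  fixes M :: real and \<rho> :: "R3 \<Rightarrow> real"
  assumes M_pos: "M > 0" and minimizer: "is_minimizer \<Phi> M \<rho>"
begin

lemma energy_class_FM:
  assumes "\<sigma> \<in> FM \<Phi> M" shows "energy_class \<sigma>"
proof -
  have \<sigma>: "integrable lborel \<sigma>" "\<And>x. 0 \<le> \<sigma> x" "integrable lborel (\<lambda>x. \<Phi> (\<sigma> x))"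
    using assms by (auto simp: FM_def)
  obtain K where K: "K > 0" "\<And>r. r \<ge> 0 \<Longrightarrow> r powr (4/3) \<le> K * (r + \<Phi> r)"
    using power_four_thirds_le by blast
  have "integrable lborel (\<lambda>x. \<sigma> x powr (4/3))"
  proof (rule Bochner_Integration.integrable_bound[OF _ _ AE_I2])
    show "integrable lborel (\<lambda>x. K * (\<sigma> x + \<Phi> (\<sigma> x)))" using \<sigma> by simp
    show "norm (\<sigma> x powr (4/3)) \<le> norm (K * (\<sigma> x + \<Phi> (\<sigma> x)))" for x
      using K(2)[OF \<sigma>(2)[of x]] by simp
  qed (use \<sigma> in measurable)
  then show ?thesis using \<sigma> by (simp add: energy_class_def)
qed

lemma rho_FM: "\<rho> \<in> FM \<Phi> M" using minimizer by (simp add: is_minimizer_def)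

lemmas energy_class_rho = energy_class_FM[OF rho_FM]

lemma rho: "integrable lborel \<rho>" "\<And>x. 0 \<le> \<rho> x" "integrable lborel (\<lambda>x. \<Phi> (\<rho> x))" "(\<integral>x. \<rho> x \<partial>lborel) = M"
  using rho_FM by (auto simp: FM_def)

lemma rho_measurable [measurable]: "\<rho> \<in> borel_measurable borel" using rho(1) by auto

lemma minimal:
  assumes "\<sigma> \<in> FM \<Phi> M"
  shows "(\<integral>x. \<Phi> (\<rho> x) \<partial>lborel) - coulomb \<rho> \<rho> / 2 \<le> (\<integral>x. \<Phi> (\<sigma> x) \<partial>lborel) - coulomb \<sigma> \<sigma> / 2"
  using minimizer assms Epot_coulomb[OF energy_class_rho] Epot_coulomb[OF energy_class_FM[OF assms]]
  by (auto simp: is_minimizer_def Hr_def)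

lemma polar_rigid_rho: "polar_rigid \<rho>"
  unfolding polar_rigid_def
proof (intro allI impI)
  fix e :: R3 and t :: real assume e: "norm e = 1"
  have pol: "polarize e t \<rho> \<in> FM \<Phi> M"
  proof -
    have "0 \<le> polarize e t \<rho> x" for x using polarize_cases[of e t \<rho> x] rho(2) by auto
    then show ?thesis
      using integrable_comp_polarize[OF e rho_measurable, where G="\<lambda>u. u" and t=t, OF rho(1)]
        integrable_comp_polarize[OF e rho_measurable, where G=\<Phi> and t=t, OF rho(3)] rho(4)
      by (simp add: FM_def)
  qed
  have "coulomb (polarize e t \<rho>) (polarize e t \<rho>) \<le> coulomb \<rho> \<rho>"
    using minimal[OF pol] integrable_comp_polarize(2)[OF e rho_measurable rho(3), of t] by simp
  then show "(AE x in lborel. x \<bullet> e > t \<longrightarrow> \<rho> (hrefl e t x) \<le> \<rho> x) \<or>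
     (AE x in lborel. x \<bullet> e > t \<longrightarrow> \<rho> x \<le> \<rho> (hrefl e t x))"
    by (rule polarization_rigidity[OF e energy_class_rho])
qed

sublocale rigid_density \<rho> M
  using rho M_pos polar_rigid_rho by unfold_locales

text \<open>Includes points of infinite potential: there the Bochner integral and
  \<open>enn2real\<close> both return 0.\<close>

lemma Vpot_newton: "Vpot \<rho> x = - enn2real (newton \<rho> x)"
  unfolding Vpot_def newton_def by (subst integral_eq_nn_integral) (use rho(2) in auto)

lemma Vpot_measurable [measurable]: "Vpot \<rho> \<in> borel_measurable borel"
proof -
  have "(\<lambda>x. \<integral>y. \<rho> y / norm (x - y) \<partial>lborel) \<in> borel_measurable lborel"
    by (rule lborel.borel_measurable_lebesgue_integral) measurable
  then show ?thesis unfolding Vpot_def[abs_def] by simp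
qed

text \<open>The variational derivative of the reduced energy at the minimizer.\<close>

definition lam :: "R3 \<Rightarrow> real" where "lam x = dPhi (\<rho> x) + Vpot \<rho> x"

lemma lam_measurable [measurable]: "lam \<in> borel_measurable borel"
  unfolding lam_def[abs_def] using borel_measurable_Phi_comp(2)[OF rho_measurable rho(2)] by measurable

lemma first_variation:
  assumes \<sigma>: "\<sigma> \<in> FM \<Phi> M"
  shows "integrable lborel (\<lambda>x. lam x * (\<sigma> x - \<rho> x))" and "0 \<le> (\<integral>x. lam x * (\<sigma> x - \<rho> x) \<partial>lborel)"
proof -
  define t where "t k = 1 / real (Suc k)" for k
  have t: "0 < t k" "t k \<le> 1" for k by (auto simp: t_def)
  have t_mono: "t l \<le> t k" if "k \<le> l" for k l using that by (simp add: t_def frac_le)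
  have t_lim: "t \<longlonglongrightarrow> 0" unfolding t_def by (rule LIMSEQ_Suc) (rule lim_1_over_n)
  have ec: "energy_class \<sigma>" by (rule energy_class_FM[OF \<sigma>])
  have s: "integrable lborel \<sigma>" "\<And>x. 0 \<le> \<sigma> x" "integrable lborel (\<lambda>x. \<Phi> (\<sigma> x))" "(\<integral>x. \<sigma> x \<partial>lborel) = M"
    using \<sigma> by (auto simp: FM_def)
  have [measurable]: "\<sigma> \<in> borel_measurable borel" using s(1) by auto
  define u where "u k x = \<rho> x + t k * (\<sigma> x - \<rho> x)" for k x
  have u_eq: "u k = (\<lambda>x. (1 - t k) * \<rho> x + t k * \<sigma> x)" for k
    by (simp add: u_def fun_eq_iff algebra_simps)
  have u_nn: "0 \<le> u k x" for k x unfolding u_eq using t[of k] rho(2) s(2) by simp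
  have u_meas [measurable]: "u k \<in> borel_measurable borel" for k unfolding u_def[abs_def] by measurable
  have u_Phi: "integrable lborel (\<lambda>x. \<Phi> (u k x))" for k
  proof (rule Bochner_Integration.integrable_bound[OF _ _ AE_I2])
    show "integrable lborel (\<lambda>x. (1 - t k) * \<Phi> (\<rho> x) + t k * \<Phi> (\<sigma> x))" using rho s by simp
    show "(\<lambda>x. \<Phi> (u k x)) \<in> borel_measurable lborel"
      using borel_measurable_Phi_comp(1)[OF u_meas u_nn] by simp
    fix x
    have "\<Phi> (u k x) \<le> (1 - t k) * \<Phi> (\<rho> x) + t k * \<Phi> (\<sigma> x)"
      using convex_onD[OF convex_Phi, of "t k" "\<rho> x" "\<sigma> x"] t[of k] rho(2) s(2) by (simp add: u_eq)
    then show "norm (\<Phi> (u k x)) \<le> norm ((1 - t k) * \<Phi> (\<rho> x) + t k * \<Phi> (\<sigma> x))"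
      using Phi_nonneg[OF u_nn[of k x]] by simp
  qed
  have u_FM: "u k \<in> FM \<Phi> M" for k
  proof -
    have "integrable lborel (u k)" "(\<integral>x. u k x \<partial>lborel) = M"
      unfolding u_eq using rho s by (simp_all add: algebra_simps)
    then show ?thesis using u_nn u_Phi by (simp add: FM_def)
  qed
  define Q where "Q k x = (\<Phi> (u k x) - \<Phi> (\<rho> x)) / t k" for k x
  define g where "g k x = - (Q k x + Vpot \<rho> x * (\<sigma> x - \<rho> x))" for k x
  \<comment> \<open>The Coulomb form of the difference \<sigma> - \<rho>, the coefficient of the
    quadratic remainder.\<close>
  define B where "B = coulomb \<rho> \<rho> - 2 * coulomb \<sigma> \<rho> + coulomb \<sigma> \<sigma>"
  have iV: "integrable lborel (\<lambda>x. Vpot \<rho> x * (\<sigma> x - \<rho> x))"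
    and IV: "(\<integral>x. Vpot \<rho> x * (\<sigma> x - \<rho> x) \<partial>lborel) = coulomb \<rho> \<rho> - coulomb \<sigma> \<rho>"
    using integrable_mult_Vpot[OF energy_class_rho ec] integrable_mult_Vpot[OF energy_class_rho energy_class_rho]
    by (simp_all add: right_diff_distrib mult.commute[of "Vpot \<rho> _"])
  have iQ: "integrable lborel (Q k)" for k
    unfolding Q_def[abs_def] using u_Phi rho(3) by simp
  have ig: "integrable lborel (g k)" for k
    unfolding g_def[abs_def] using iQ iV by simp
  have Ig: "(\<integral>x. g k x \<partial>lborel) \<le> - (t k * B / 2)" for k
  proof -
    let ?P = "(\<integral>x. \<Phi> (u k x) \<partial>lborel) - (\<integral>x. \<Phi> (\<rho> x) \<partial>lborel)"
    have "coulomb (u k) (u k) = (1 - t k)\<^sup>2 * coulomb \<rho> \<rho> + 2 * t k * (1 - t k) * coulomb \<sigma> \<rho> + (t k)\<^sup>2 * coulomb \<sigma> \<sigma>"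
      unfolding u_eq by (rule coulomb_convex[OF energy_class_rho ec])
    then have "0 \<le> ?P - ((1 - t k)\<^sup>2 * coulomb \<rho> \<rho> + 2 * t k * (1 - t k) * coulomb \<sigma> \<rho> + (t k)\<^sup>2 * coulomb \<sigma> \<sigma>) / 2 + coulomb \<rho> \<rho> / 2"
      using minimal[OF u_FM[of k]] by simp
    also have "\<dots> = ?P + t k * (coulomb \<rho> \<rho> - coulomb \<sigma> \<rho>) - t k * (t k * B / 2)"
      by (simp add: B_def field_simps power2_eq_square)
    finally have "t k * (t k * B / 2) \<le> t k * (?P / t k + (coulomb \<rho> \<rho> - coulomb \<sigma> \<rho>))"
      using t(1)[of k] by (simp add: distrib_left)
    then have *: "t k * B / 2 \<le> ?P / t k + (coulomb \<rho> \<rho> - coulomb \<sigma> \<rho>)"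
      using t(1)[of k] by (simp only: mult_le_cancel_left_pos)
    have "(\<integral>x. Q k x \<partial>lborel) = ?P / t k"
      unfolding Q_def using u_Phi rho(3) by simp
    then have "(\<integral>x. g k x \<partial>lborel) = - (?P / t k + (coulomb \<rho> \<rho> - coulomb \<sigma> \<rho>))"
      unfolding g_def using iQ iV IV by simp
    with * show ?thesis by linarith
  qed
  have Q_mono: "Q l x \<le> Q k x" if "k \<le> l" for k l x
    using Phi_slope_mono[OF rho(2) s(2), of "t l" "t k" x x] t t_mono[OF that] by (simp add: Q_def u_def)
  have g_mono: "g k x \<le> g l x" if "k \<le> l" for k l x
    using Q_mono[OF that] by (simp add: g_def)
  have Q_lim: "(\<lambda>k. Q k x) \<longlonglongrightarrow> dPhi (\<rho> x) * (\<sigma> x - \<rho> x)" for x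
  proof -
    have "filterlim t (at 0 within {0..1}) sequentially"
      unfolding filterlim_at using t_lim t less_imp_neq[OF t(1)] by (auto simp: less_imp_le)
    from filterlim_compose[OF Phi_slope_tendsto[OF rho(2) s(2), of x x] this]
    show ?thesis by (simp add: Q_def u_def)
  qed
  have g_lim: "(\<lambda>k. g k x) \<longlonglongrightarrow> - (lam x * (\<sigma> x - \<rho> x))" for x
    unfolding g_def lam_def distrib_right by (intro tendsto_intros Q_lim)
  define J where "J k = (\<integral>x. g k x \<partial>lborel)" for k
  have J_mono: "incseq J"
    unfolding J_def by (intro monoI integral_mono ig g_mono)
  have J_le: "J k \<le> \<bar>B\<bar> / 2" for k
  proof -
    have "J k \<le> - (t k * B / 2)" unfolding J_def by (rule Ig)
    also have "\<dots> \<le> \<bar>t k * B\<bar> / 2" by simp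
    also have "\<dots> \<le> \<bar>B\<bar> / 2" using t[of k] by (simp add: abs_mult mult_left_le_one_le)
    finally show ?thesis .
  qed
  obtain j where j: "J \<longlonglongrightarrow> j" using incseq_convergent[OF J_mono] J_le by blast
  have meas: "(\<lambda>x. - (lam x * (\<sigma> x - \<rho> x))) \<in> borel_measurable lborel" by measurable
  have mono: "AE x in lborel. mono (\<lambda>k. g k x)" by (intro AE_I2 monoI g_mono)
  have lim: "AE x in lborel. (\<lambda>k. g k x) \<longlonglongrightarrow> - (lam x * (\<sigma> x - \<rho> x))" by (intro AE_I2 g_lim)
  note mc = integrable_monotone_convergence[OF ig mono lim j[unfolded J_def] meas]
    integral_monotone_convergence[OF ig mono lim j[unfolded J_def] meas]
  show "integrable lborel (\<lambda>x. lam x * (\<sigma> x - \<rho> x))"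
    using integrable_minus[OF mc(1)] by simp
  have "j \<le> 0"
  proof (rule LIMSEQ_le[OF j])
    have "(\<lambda>k. - (t k * B / 2)) \<longlonglongrightarrow> - (0 * B / 2)" by (intro tendsto_intros t_lim) simp
    then show "(\<lambda>k. - (t k * B / 2)) \<longlonglongrightarrow> 0" by simp
    show "\<exists>N. \<forall>k\<ge>N. J k \<le> - (t k * B / 2)" using Ig by (auto simp: J_def)
  qed
  then show "0 \<le> (\<integral>x. lam x * (\<sigma> x - \<rho> x) \<partial>lborel)" using mc(2) by simp
qed

text \<open>Bounded sets with bounded density, on which \<open>lam\<close> is integrable; they
  exhaust space.\<close>

definition core :: "nat \<Rightarrow> R3 set" where "core k = {x \<in> ball 0 (real k). \<rho> x \<le> real k}"

lemma core_measurable [measurable]: "core k \<in> sets borel"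
proof -
  have "core k = ball 0 (real k) \<inter> {x. \<rho> x \<le> real k}" by (auto simp: core_def)
  moreover have "{x. \<rho> x \<le> real k} \<in> sets borel" by measurable
  ultimately show ?thesis by auto
qed

lemma bounded_core: "A \<subseteq> core k \<Longrightarrow> bounded A"
  by (rule bounded_subset[of "ball 0 (real k)"]) (auto simp: core_def)

lemma core_exhaust: "\<exists>k. x \<in> core k"
proof -
  obtain k :: nat where "max (norm x) (\<rho> x) < real k" using reals_Archimedean2 by blast
  then show ?thesis by (auto simp: core_def intro!: exI[of _ k])
qed

text \<open>The competitor spreads the mass uniformly over \<open>A\<close>. The first variation
  then says that the mean of \<open>lam\<close> over \<open>A\<close> is at least its
  \<rho>-weighted mean, here cleared of denominators.\<close>

lemma uniform_variation:
  assumes A [measurable]: "A \<in> sets borel" and sub: "A \<subseteq> core k" and pos: "measure lborel A > 0"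
  shows "integrable lborel (\<lambda>x. lam x * indicator A x)" and "integrable lborel (\<lambda>x. lam x * \<rho> x)"
    and "(\<integral>x. lam x * \<rho> x \<partial>lborel) * measure lborel A \<le> M * (\<integral>x. lam x * indicator A x \<partial>lborel)"
proof -
  have bd: "bounded A" by (rule bounded_core[OF sub])
  have fin: "emeasure lborel A < \<infinity>" by (rule emeasure_bounded_finite[OF bd])
  define c where "c = M / measure lborel A"
  have c: "c > 0" using M_pos pos by (simp add: c_def)
  have FM: "(\<lambda>x. c * indicator A x) \<in> FM \<Phi> M"
  proof -
    have "\<Phi> (c * indicator A x) = \<Phi> c * indicator A x" for x :: R3 by (simp add: indicator_def)
    then show ?thesis using fin c pos by (simp add: FM_def) (simp add: c_def)
  qed
  have iA: "integrable lborel (indicator A :: R3 \<Rightarrow> real)" using fin by simp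
  have dA: "integrable lborel (\<lambda>x. dPhi (\<rho> x) * indicator A x)"
  proof (rule Bochner_Integration.integrable_bound[OF _ _ AE_I2])
    show "integrable lborel (\<lambda>x. dPhi (real k) * indicator A x)" using iA by simp
    show "(\<lambda>x. dPhi (\<rho> x) * indicator A x) \<in> borel_measurable lborel"
      using borel_measurable_Phi_comp(2)[OF rho_measurable rho(2)] by measurable
    show "norm (dPhi (\<rho> x) * indicator A x) \<le> norm (dPhi (real k) * indicator A x)" for x
      using sub dPhi_mono[OF rho(2), of x "real k"] dPhi_nonneg[OF rho(2), of x]
      by (auto simp: indicator_def core_def)
  qed
  have VA: "integrable lborel (\<lambda>x. Vpot \<rho> x * indicator A x)"
    using integrable_mult_Vpot(1)[OF energy_class_rho energy_class_indicator[OF A bd, of 1]]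
    by (simp add: mult.commute)
  show lA: "integrable lborel (\<lambda>x. lam x * indicator A x)"
    using Bochner_Integration.integrable_add[OF dA VA] by (simp add: lam_def distrib_right)
  note v = first_variation[OF FM]
  have "integrable lborel (\<lambda>x. c * (lam x * indicator A x) - lam x * (c * indicator A x - \<rho> x))"
    using lA v(1) by (intro Bochner_Integration.integrable_diff integrable_mult_right)
  then show lr: "integrable lborel (\<lambda>x. lam x * \<rho> x)" by (simp add: algebra_simps)
  have "(\<integral>x. lam x * (c * indicator A x - \<rho> x) \<partial>lborel) = (\<integral>x. c * (lam x * indicator A x) - lam x * \<rho> x \<partial>lborel)"
    by (simp add: algebra_simps)
  also have "\<dots> = c * (\<integral>x. lam x * indicator A x \<partial>lborel) - (\<integral>x. lam x * \<rho> x \<partial>lborel)"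
    using lA lr by simp
  finally have "(\<integral>x. lam x * \<rho> x \<partial>lborel) \<le> c * (\<integral>x. lam x * indicator A x \<partial>lborel)"
    using v(2) by simp
  then show "(\<integral>x. lam x * \<rho> x \<partial>lborel) * measure lborel A \<le> M * (\<integral>x. lam x * indicator A x \<partial>lborel)"
    using pos by (simp add: c_def field_simps)
qed

text \<open>The Lagrange multiplier, as the mean of \<open>lam\<close> with respect to the mass
  density.\<close>

definition E0 :: real where "E0 = (\<integral>x. lam x * \<rho> x \<partial>lborel) / M"

text \<open>If \<open>lam\<close> were below \<open>E0\<close> on a set of positive measure, so
  would be its mean over a piece of that set inside some \<open>core k\<close>, against
  \<open>uniform_variation\<close>.\<close>

lemma lam_ge_E0: "AE x in lborel. E0 \<le> lam x"
proof -
  have "AE x in lborel. x \<in> core k \<longrightarrow> E0 \<le> lam x" for k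
  proof -
    define A where "A = {x \<in> core k. lam x < E0}"
    have "A = core k \<inter> {x. lam x < E0}" by (auto simp: A_def)
    moreover have "{x. lam x < E0} \<in> sets borel" by measurable
    ultimately have A [measurable]: "A \<in> sets borel" by auto
    have fin: "emeasure lborel A < \<infinity>"
      by (rule emeasure_bounded_finite, rule bounded_core[of _ k]) (auto simp: A_def)
    have "A \<in> null_sets lborel"
    proof (rule ccontr)
      assume "A \<notin> null_sets lborel"
      then have pos: "measure lborel A > 0"
        using fin by (auto simp: null_sets_def measure_def enn2real_positive_iff zero_less_iff_neq_zero)
      have sub: "A \<subseteq> core k" by (auto simp: A_def)
      note v = uniform_variation[OF A sub pos]
      have iA: "integrable lborel (indicator A :: R3 \<Rightarrow> real)" using fin by simp
      have i: "integrable lborel (\<lambda>x. (E0 - lam x) * indicator A x)"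
        using v(1) iA by (simp add: left_diff_distrib)
      have "(\<integral>x. (E0 - lam x) * indicator A x \<partial>lborel) = E0 * measure lborel A - (\<integral>x. lam x * indicator A x \<partial>lborel)"
        using v(1) iA by (simp add: left_diff_distrib)
      also have "\<dots> \<le> 0" using v(3) M_pos by (simp add: E0_def field_simps)
      finally have le: "(\<integral>x. (E0 - lam x) * indicator A x \<partial>lborel) \<le> 0" .
      have nn: "AE x in lborel. 0 \<le> (E0 - lam x) * indicator A x" by (auto simp: A_def indicator_def)
      have "(\<integral>x. (E0 - lam x) * indicator A x \<partial>lborel) = 0" using le integral_nonneg_AE[OF nn] by simp
      then have "AE x in lborel. (E0 - lam x) * indicator A x = 0"
        using integral_nonneg_eq_0_iff_AE[OF i nn] by simp
      then have "AE x in lborel. x \<notin> A" by eventually_elim (auto simp: A_def indicator_def)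
      then have "A \<in> null_sets lborel" by (subst AE_iff_null_sets) auto
      with \<open>A \<notin> null_sets lborel\<close> show False ..
    qed
    then have "AE x in lborel. x \<notin> A" by (rule AE_not_in)
    then show ?thesis by eventually_elim (auto simp: A_def)
  qed
  then have "AE x in lborel. \<forall>k. x \<in> core k \<longrightarrow> E0 \<le> lam x" unfolding AE_all_countable by blast
  then show ?thesis by eventually_elim (use core_exhaust in blast)
qed

lemma integrable_lam_rho: "integrable lborel (\<lambda>x. lam x * \<rho> x)"
proof -
  have "\<exists>k. core k \<notin> null_sets lborel"
  proof (rule ccontr)
    assume "\<not> ?thesis"
    then have "(\<Union>k. core k) \<in> null_sets lborel" by (intro null_sets_UN) auto
    moreover have "(\<Union>k. core k) = UNIV" using core_exhaust by auto
    ultimately show False by (simp add: null_sets_def)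
  qed
  then obtain k where k: "core k \<notin> null_sets lborel" ..
  have "emeasure lborel (core k) < \<infinity>"
    by (rule emeasure_bounded_finite, rule bounded_core[of _ k]) auto
  with k have "measure lborel (core k) > 0"
    by (auto simp: null_sets_def measure_def enn2real_positive_iff zero_less_iff_neq_zero)
  from uniform_variation(2)[OF core_measurable order_refl this] show ?thesis .
qed

text \<open>\<open>lam\<close> is at least \<open>E0\<close> and has \<rho>-weighted mean
  \<open>E0\<close>, so equality holds where \<rho> > 0. Where \<rho> = 0 the bound reads
  \<open>E0 \<le> Vpot \<rho> x\<close>, as \<open>dPhi 0 = 0\<close>, and \<open>phi\<close>
  vanishes.\<close>

lemma euler_lagrange: "AE x in lborel. \<rho> x = phi (E0 - Vpot \<rho> x)"
proof -
  have i: "integrable lborel (\<lambda>x. (lam x - E0) * \<rho> x)"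
    using integrable_lam_rho rho(1) by (simp add: left_diff_distrib)
  have nn: "AE x in lborel. 0 \<le> (lam x - E0) * \<rho> x"
    using lam_ge_E0 by eventually_elim (simp add: rho(2))
  have "(\<integral>x. (lam x - E0) * \<rho> x \<partial>lborel) = 0"
    using integrable_lam_rho rho(1) rho(4) M_pos by (simp add: left_diff_distrib E0_def)
  then have "AE x in lborel. (lam x - E0) * \<rho> x = 0"
    using integral_nonneg_eq_0_iff_AE[OF i nn] by simp
  then show ?thesis using lam_ge_E0
  proof eventually_elim
    fix x assume x: "(lam x - E0) * \<rho> x = 0" "E0 \<le> lam x"
    show "\<rho> x = phi (E0 - Vpot \<rho> x)"
    proof (cases "\<rho> x = 0")
      case True
      then show ?thesis using x(2) by (simp add: lam_def)
    next
      case False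
      then have "E0 - Vpot \<rho> x = dPhi (\<rho> x)" using x(1) by (simp add: lam_def)
      then show ?thesis using phi_dPhi[OF rho(2)] by simp
    qed
  qed
qed

end

section \<open>Boundedness of the potential\<close>

context steady_state
begin

definition center :: R3 where "center = (SOME c. AE x in lborel. \<rho> (2 *\<^sub>R c - x) = \<rho> x)"

lemma center: "AE x in lborel. \<rho> (2 *\<^sub>R center - x) = \<rho> x"
  unfolding center_def using center_exists by (rule someI_ex) blast

lemma newton_radial_mono: "norm (y - center) \<le> norm (x - center) \<Longrightarrow> newton \<rho> x \<le> newton \<rho> y"
  by (rule newton_antimono[OF center])

lemma newton_measurable [measurable]: "newton \<rho> \<in> borel_measurable borel"
proof -
  have "(\<lambda>x. \<integral>\<^sup>+y. ennreal (\<rho> y / norm (x - y)) \<partial>lborel) \<in> borel_measurable lborel"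
    by (rule lborel.borel_measurable_nn_integral) measurable
  then show ?thesis unfolding newton_def[abs_def] by simp
qed

text \<open>\<open>F\<close> is the density as a function of the squared distance to the center, which keeps square roots
  out of the derivatives below; \<open>U\<close> and \<open>g\<close> are the potential (up to sign) as a function of the
  distance itself.\<close>

definition F :: "real \<Rightarrow> real" where
  "F q = phi (E0 + enn2real (newton \<rho> (center + sqrt q *\<^sub>R axis 1 1)))"

lemma F_measurable [measurable]: "F \<in> borel_measurable borel"
proof -
  have [measurable]: "phi \<in> borel_measurable borel"
    by (rule borel_measurable_continuous_onI[OF continuous_phi])
  have "(\<lambda>q. center + sqrt q *\<^sub>R axis 1 1) \<in> borel \<rightarrow>\<^sub>M borel"
    by (intro borel_measurable_continuous_onI continuous_intros)
  then have "(\<lambda>q. newton \<rho> (center + sqrt q *\<^sub>R axis 1 1)) \<in> borel_measurable borel"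
    by (rule measurable_compose) simp
  then show ?thesis unfolding F_def[abs_def] by measurable
qed

lemma F_nonneg [simp]: "0 \<le> F q" by (simp add: F_def)

lemma newton_eq_profile: "newton \<rho> x = newton \<rho> (center + sqrt ((norm (x - center))\<^sup>2) *\<^sub>R axis 1 1)"
  by (rule antisym; rule newton_radial_mono; simp add: norm_axis_1)

lemma rho_eq_F: "AE x in lborel. \<rho> x = F ((norm (x - center))\<^sup>2)"
  using euler_lagrange
  by eventually_elim (simp only: F_def Vpot_newton newton_eq_profile[symmetric] diff_minus_eq_add)

lemma lborel_distr_shift: "distr lborel borel (\<lambda>z. center + z) = lborel"
  using lborel_affine[of 1 center] by (simp add: density_1)

lemma nn_integral_shift:
  assumes [measurable]: "h \<in> borel_measurable borel"
  shows "(\<integral>\<^sup>+z. h (center + z) \<partial>lborel) = (\<integral>\<^sup>+z. h z \<partial>lborel)"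
  by (subst (2) lborel_distr_shift[symmetric]) (simp add: nn_integral_distr)

text \<open>\<open>H\<close> sees the density and the displacement from the centre, so that the
  mass, the L^(4/3) bound and the potential are all instances.\<close>

lemma nn_integral_profile:
  assumes [measurable]: "(\<lambda>(a, z). H a z) \<in> borel_measurable (borel \<Otimes>\<^sub>M borel)"
  shows "(\<integral>\<^sup>+z. H (F ((norm z)\<^sup>2)) z \<partial>lborel) = (\<integral>\<^sup>+z. H (\<rho> z) (z - center) \<partial>lborel)"
proof -
  have "(\<integral>\<^sup>+z. H (\<rho> z) (z - center) \<partial>lborel) = (\<integral>\<^sup>+z. H (F ((norm (z - center))\<^sup>2)) (z - center) \<partial>lborel)"
    using rho_eq_F by (intro nn_integral_cong_AE) (auto elim: eventually_mono)
  also have "\<dots> = (\<integral>\<^sup>+z. H (F ((norm (center + z - center))\<^sup>2)) (center + z - center) \<partial>lborel)"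
    by (rule nn_integral_shift[symmetric]) measurable
  finally show ?thesis by simp
qed

lemma integrable_profile:
  "(\<integral>\<^sup>+z. ennreal (F ((norm (z::R3))\<^sup>2)) \<partial>lborel) = ennreal M"
  "(\<integral>\<^sup>+z. ennreal (F ((norm (z::R3))\<^sup>2) powr (4/3)) \<partial>lborel) < \<infinity>"
proof -
  have "(\<integral>\<^sup>+z. ennreal (F ((norm (z::R3))\<^sup>2)) \<partial>lborel) = (\<integral>\<^sup>+z. ennreal (\<rho> z) \<partial>lborel)"
    by (rule nn_integral_profile[of "\<lambda>a z. ennreal a"]) measurable
  also have "\<dots> = ennreal M"
    using nn_integral_eq_integral[OF rho(1)] rho(2,4) by simp
  finally show "(\<integral>\<^sup>+z. ennreal (F ((norm (z::R3))\<^sup>2)) \<partial>lborel) = ennreal M" .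
  have "(\<integral>\<^sup>+z. ennreal (F ((norm (z::R3))\<^sup>2) powr (4/3)) \<partial>lborel) = (\<integral>\<^sup>+z. ennreal (\<rho> z powr (4/3)) \<partial>lborel)"
    by (rule nn_integral_profile[of "\<lambda>a z. ennreal (a powr (4/3))"]) measurable
  also have "\<dots> < \<infinity>"
    using energy_class_rho nn_integral_eq_integral[of lborel "\<lambda>x. \<rho> x powr (4/3)"] by (simp add: energy_class_def)
  finally show "(\<integral>\<^sup>+z. ennreal (F ((norm (z::R3))\<^sup>2) powr (4/3)) \<partial>lborel) < \<infinity>" .
qed

definition U :: "real \<Rightarrow> ennreal" where
  "U r = (\<integral>\<^sup>+z. ennreal (F ((norm (z::R3))\<^sup>2) / max r (norm z)) \<partial>lborel)"

lemma newton_U: "newton \<rho> x = U (norm (x - center))"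
proof -
  have "newton \<rho> x = (\<integral>\<^sup>+z. ennreal (\<rho> z / norm (x - center - (z - center))) \<partial>lborel)"
    by (simp add: newton_def)
  also have "\<dots> = (\<integral>\<^sup>+z. ennreal (F ((norm z)\<^sup>2) / norm (x - center - z)) \<partial>lborel)"
    by (rule nn_integral_profile[of "\<lambda>a z. ennreal (a / norm (x - center - z))", symmetric]) measurable
  also have "\<dots> = (\<integral>\<^sup>+z. ennreal (F ((norm z)\<^sup>2)) * ennreal (1 / norm (x - center - z)) \<partial>lborel)"
    by (simp flip: ennreal_mult)
  also have "\<dots> = (\<integral>\<^sup>+z. ennreal (F ((norm (z::R3))\<^sup>2)) * ennreal (1 / max (norm (x - center)) (norm z)) \<partial>lborel)"
    by (rule newton_shell) measurable
  also have "\<dots> = U (norm (x - center))"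
    by (simp add: U_def le_max_iff_disj flip: ennreal_mult)
  finally show ?thesis .
qed

lemma F_U: "q \<ge> 0 \<Longrightarrow> F q = phi (E0 + enn2real (U (sqrt q)))"
  by (simp add: F_def newton_U norm_axis_1)

text \<open>First bootstrap step: it uses nothing about the density but its \<open>L^(4/3)\<close> bound.\<close>

lemma U_le_inverse_sqrt:
  obtains K where "K \<ge> 0" "\<And>r. 0 < r \<Longrightarrow> r \<le> 1 \<Longrightarrow> U r \<le> ennreal (K / sqrt r)"
proof -
  let ?a = "\<lambda>z::R3. F ((norm z)\<^sup>2)"
  define N where "N = (\<integral>\<^sup>+z. ennreal (?a z powr (4/3) + near_kernel z + ?a z) \<partial>lborel)"
  have "N = (\<integral>\<^sup>+z. ennreal (?a z powr (4/3)) + ennreal (near_kernel z) + ennreal (?a z) \<partial>lborel)"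
    unfolding N_def by (simp add: ennreal_plus)
  also have "\<dots> = (\<integral>\<^sup>+z. ennreal (?a z powr (4/3)) \<partial>lborel) + (\<integral>\<^sup>+z. ennreal (near_kernel z) \<partial>lborel) + (\<integral>\<^sup>+z. ennreal (?a z) \<partial>lborel)"
    by (subst nn_integral_add; (subst nn_integral_add)?) auto
  also have "\<dots> < \<infinity>"
    using integrable_profile integrable_near_kernel by (simp add: nn_integral_eq_integral)
  finally have "N < \<infinity>" .
  then have N: "N = ennreal (enn2real N)" by simp
  have "U r \<le> ennreal (enn2real N / sqrt r)" if r: "0 < r" "r \<le> 1" for r
  proof -
    define l where "l = 1 / sqrt r"
    have l: "l \<ge> 1" using r by (simp add: l_def)
    have l0: "l > 0" using l by simp
    have rl: "r = 1 / l\<^sup>2" using r by (simp add: l_def power_divide)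
    have pt: "ennreal (?a z / max r (norm z)) \<le> ennreal l * ennreal (?a z powr (4/3) + near_kernel z + ?a z)" if z: "z \<noteq> 0" for z :: R3
    proof -
      define k where "k = 1 / max r (norm z)"
      have k: "k > 0" using r by (simp add: k_def less_max_iff_disj)
      have "?a z * k \<le> l * (?a z powr (4/3) + near_kernel z + ?a z)"
      proof (cases "norm z < 1")
        case True
        define s where "s = ?a z powr (1/3)"
        have s: "?a z = s ^ 3" "?a z powr (4/3) = s ^ 4" "s \<ge> 0"
          using cube_root_powers[OF F_nonneg[of "(norm z)\<^sup>2"]] by (simp_all add: s_def)
        \<comment> \<open>Two of the four factors are bounded by 1 / r = l^2, the other two by 1 /
          |z|.\<close>
        have kz: "k ^ 4 \<le> l ^ 4 * near_kernel z"
        proof -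
          have k1: "k \<le> 1 / r" "k \<le> 1 / norm z"
            using r z by (simp_all add: k_def frac_le)
          have "k ^ 4 = k\<^sup>2 * k\<^sup>2" by simp
          also have "\<dots> \<le> (1 / r)\<^sup>2 * (1 / norm z)\<^sup>2"
            using k k1 r by (intro mult_mono power_mono) auto
          also have "(1 / r)\<^sup>2 = l ^ 4" using l0 by (simp add: rl flip: power_mult)
          also have "l ^ 4 * (1 / norm z)\<^sup>2 \<le> l ^ 4 * near_kernel z"
            using inverse_power2_le_near_kernel[OF True z] l0
            by (intro mult_left_mono) (auto simp: power_divide)
          finally show ?thesis .
        qed
        \<comment> \<open>Young's inequality with exponents 4/3 and 4, proved by comparing
          \<open>k\<close> with \<open>s * l\<close>: the larger of the two absorbs the
          product.\<close>
        have "s ^ 3 * k \<le> l * (s ^ 4 + near_kernel z)"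
        proof (cases "k \<le> s * l")
          case True
          have "s ^ 3 * k \<le> s ^ 3 * (s * l)" using True s by (intro mult_left_mono) auto
          also have "\<dots> = l * s ^ 4" by (simp add: power_def eval_nat_numeral)
          also have "\<dots> \<le> l * (s ^ 4 + near_kernel z)" using l0 by simp
          finally show ?thesis .
        next
          case False
          have "l ^ 3 * (s ^ 3 * k) = (s * l) ^ 3 * k" by (simp add: power_mult_distrib)
          also have "\<dots> \<le> k ^ 3 * k" using False s l0 k by (intro mult_right_mono power_mono) auto
          also have "\<dots> = k ^ 4" by (simp add: eval_nat_numeral)
          also have "\<dots> \<le> l ^ 4 * near_kernel z" by (rule kz)
          also have "\<dots> = l ^ 3 * (l * near_kernel z)" by (simp add: eval_nat_numeral)
          finally have "s ^ 3 * k \<le> l * near_kernel z"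
            using l0 by (simp only: mult_le_cancel_left_pos zero_less_power)
          also have "\<dots> \<le> l * (s ^ 4 + near_kernel z)" using l0 by simp
          finally show ?thesis .
        qed
        also have "\<dots> \<le> l * (s ^ 4 + near_kernel z + s ^ 3)" using l0 s by simp
        finally show ?thesis unfolding s(2) unfolding s(1) .
      next
        case False
        then have "1 \<le> max r (norm z)" by simp
        then have "k \<le> 1" unfolding k_def by (subst divide_le_eq_1_pos) auto
        then have "?a z * k \<le> 1 * ?a z" by (simp add: mult_left_le)
        also have "\<dots> \<le> l * (?a z powr (4/3) + near_kernel z + ?a z)" using l by (intro mult_mono) auto
        finally show ?thesis .
      qed
      then have "?a z / max r (norm z) \<le> l * (?a z powr (4/3) + near_kernel z + ?a z)" by (simp add: k_def)
      then show ?thesis using l0 by (subst ennreal_mult[symmetric]) (auto intro: ennreal_leI)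
    qed
    have "U r \<le> (\<integral>\<^sup>+z. ennreal l * ennreal (?a z powr (4/3) + near_kernel z + ?a z) \<partial>lborel)"
      unfolding U_def
      by (rule nn_integral_mono_AE) (use AE_lborel_singleton[of "0::R3"] in \<open>rule eventually_mono\<close>, rule pt)
    also have "\<dots> = ennreal l * N" unfolding N_def by (rule nn_integral_cmult) measurable
    also have "\<dots> = ennreal (enn2real N / sqrt r)"
      using l0 by (subst N) (simp add: l_def flip: ennreal_mult)
    finally show ?thesis .
  qed
  then show ?thesis by (intro that[of "enn2real N"]) auto
qed

text \<open>Second bootstrap step: inserting this into the Euler--Lagrange equation bounds
  \<open>F (r\<^sup>2) / r\<close> by the integrable singularity \<open>r^(-5/2)\<close>, because \<open>n < 3\<close>.\<close>

lemma U_0_finite: "U 0 < \<infinity>"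
proof -
  obtain K where K: "K \<ge> 0" "\<And>r. 0 < r \<Longrightarrow> r \<le> 1 \<Longrightarrow> U r \<le> ennreal (K / sqrt r)"
    using U_le_inverse_sqrt by blast
  obtain L where L: "L > 0" "\<And>s. s \<ge> 0 \<Longrightarrow> phi s \<le> L * (1 + s ^ 3)" using phi_growth by blast
  define C where "C = \<bar>E0\<bar> + K"
  define D where "D = L * (1 + C ^ 3)"
  have C: "C \<ge> 0" using K by (simp add: C_def)
  have D: "D \<ge> 0" using L C by (simp add: D_def)
  have pt: "ennreal (F ((norm z)\<^sup>2) / max 0 (norm z)) \<le> ennreal (D * near_kernel z + F ((norm z)\<^sup>2))"
    if z: "z \<noteq> 0" for z :: R3
  proof (rule ennreal_leI, cases "norm z < 1")
    case True
    \<comment> \<open>The potential is at most of order \<open>w\<close>, so by the cubic growth of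
      \<open>phi\<close> the profile is at most of order w^3 = |z|^(-3/2), and the kernel
      contributes another 1 / |z|. That \<open>w\<close> is at least 1 absorbs the additive
      constants.\<close>
    define w where "w = 1 / sqrt (norm z)"
    have w: "w \<ge> 1" using True z by (simp add: w_def)
    have "enn2real (U (norm z)) \<le> K * w"
      using K(2)[of "norm z"] K(1) z True by (auto simp: w_def intro!: enn2real_leI)
    then have "E0 + enn2real (U (norm z)) \<le> \<bar>E0\<bar> * 1 + K * w" by linarith
    also have "\<dots> \<le> \<bar>E0\<bar> * w + K * w" using w by (intro add_right_mono mult_left_mono) auto
    also have "\<dots> = C * w" by (simp add: C_def distrib_right)
    finally have "F ((norm z)\<^sup>2) \<le> phi (C * w)" by (simp add: F_U phi_mono)
    also have "\<dots> \<le> L * (1 + (C * w) ^ 3)" using C w by (intro L) auto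
    also have "\<dots> \<le> L * (w ^ 3 + (C * w) ^ 3)" using L w by (intro mult_left_mono add_right_mono) auto
    also have "\<dots> = D * w ^ 3" by (simp add: D_def power_mult_distrib algebra_simps)
    finally have "F ((norm z)\<^sup>2) / norm z \<le> D * (w ^ 3 / norm z)"
      using z by (simp add: divide_right_mono)
    also have "w ^ 3 / norm z = near_kernel z"
    proof -
      have "w = norm z powr (-1/2)" using z by (simp add: w_def powr_half_sqrt powr_minus_divide)
      then have "w ^ 3 = norm z powr (-3/2)" using z by (simp add: powr_powr flip: powr_realpow')
      moreover have "norm z powr (-3/2) / norm z = norm z powr (-3/2 - 1)"
        using z by (subst powr_diff) simp
      ultimately show ?thesis using True by (simp add: near_kernel_def)
    qed
    finally show "F ((norm z)\<^sup>2) / max 0 (norm z) \<le> D * near_kernel z + F ((norm z)\<^sup>2)"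
      by (simp add: max_def add_increasing2)
  next
    case False
    then have "F ((norm z)\<^sup>2) / norm z \<le> F ((norm z)\<^sup>2) / 1" by (intro divide_left_mono) auto
    then show "F ((norm z)\<^sup>2) / max 0 (norm z) \<le> D * near_kernel z + F ((norm z)\<^sup>2)"
      using D by (simp add: add_increasing)
  qed
  have "U 0 \<le> (\<integral>\<^sup>+z. ennreal (D * near_kernel z + F ((norm z)\<^sup>2)) \<partial>lborel)"
    unfolding U_def
    by (rule nn_integral_mono_AE) (use AE_lborel_singleton[of "0::R3"] in \<open>rule eventually_mono\<close>, rule pt)
  also have "\<dots> = (\<integral>\<^sup>+z. ennreal (D * near_kernel z) + ennreal (F ((norm z)\<^sup>2)) \<partial>lborel)"
    using D by (simp add: ennreal_plus)
  also have "\<dots> = (\<integral>\<^sup>+z. ennreal (D * near_kernel z) \<partial>lborel) + ennreal M"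
    by (subst nn_integral_add) (auto simp: integrable_profile)
  also have "(\<integral>\<^sup>+z. ennreal (D * near_kernel z) \<partial>lborel) = ennreal (\<integral>z. D * near_kernel z \<partial>lborel)"
    using integrable_near_kernel D by (intro nn_integral_eq_integral) auto
  finally show ?thesis by (auto simp: less_top[symmetric] top_unique)
qed

end

section \<open>Regularity of the radial profiles\<close>

context steady_state
begin

definition g :: "real \<Rightarrow> real" where "g r = enn2real (U r)"

lemma Vpot_g: "Vpot \<rho> x = - g (norm (x - center))"
  by (simp add: Vpot_newton newton_U g_def)

text \<open>The absolute value is there because \<open>sqrt\<close> is negative on negative
  arguments; it keeps the formula valid on the whole line.\<close>

lemma F_g: "F q = phi (E0 + g \<bar>sqrt q\<bar>)"
  by (simp add: F_def newton_U norm_axis_1 g_def)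

lemma g_nonneg [simp]: "0 \<le> g r" by (simp add: g_def)

lemma integrable_quot_0: "integrable lborel (\<lambda>z::R3. F ((norm z)\<^sup>2) / norm z)"
  using U_0_finite by (intro integrableI_nonneg) (auto simp: U_def max_def)

lemma quot_le: "z \<noteq> 0 \<Longrightarrow> F ((norm z)\<^sup>2) / max r (norm z) \<le> F ((norm (z::R3))\<^sup>2) / norm z"
  by (intro divide_left_mono) (auto simp: less_max_iff_disj)

lemma quot_nonneg: "0 \<le> F ((norm z)\<^sup>2) / max r (norm (z::R3))"
  by (simp add: le_max_iff_disj)

lemma integrable_quot: "integrable lborel (\<lambda>z::R3. F ((norm z)\<^sup>2) / max r (norm z))"
proof (rule Bochner_Integration.integrable_bound[OF integrable_quot_0])
  show "AE z::R3 in lborel. norm (F ((norm z)\<^sup>2) / max r (norm z)) \<le> norm (F ((norm z)\<^sup>2) / norm z)"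
    using AE_lborel_singleton[of "0::R3"]
  proof eventually_elim
    fix z :: R3 assume "z \<noteq> 0"
    from quot_le[OF this, of r] quot_nonneg[of z r]
    show "norm (F ((norm z)\<^sup>2) / max r (norm z)) \<le> norm (F ((norm z)\<^sup>2) / norm z)" by simp
  qed
qed measurable

lemma g_integral: "g r = (\<integral>z. F ((norm (z::R3))\<^sup>2) / max r (norm z) \<partial>lborel)"
  unfolding g_def U_def by (rule integral_eq_nn_integral[symmetric]) (use quot_nonneg in auto)

lemma g_antimono: "r \<le> s \<Longrightarrow> g s \<le> g r"
  unfolding g_integral
proof (rule integral_mono_AE[OF integrable_quot integrable_quot])
  assume rs: "r \<le> s"
  show "AE z::R3 in lborel. F ((norm z)\<^sup>2) / max s (norm z) \<le> F ((norm z)\<^sup>2) / max r (norm z)"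
    using AE_lborel_singleton[of "0::R3"]
    by eventually_elim (use rs in \<open>auto intro!: divide_left_mono simp: less_max_iff_disj\<close>)
qed

lemma continuous_g: "continuous_on UNIV g"
proof (rule continuous_at_imp_continuous_on, intro ballI)
  fix r
  show "isCont g r"
    unfolding continuous_at_sequentially
  proof (intro allI impI)
    fix R :: "nat \<Rightarrow> real" assume R: "R \<longlonglongrightarrow> r"
    show "(g \<circ> R) \<longlonglongrightarrow> g r"
      unfolding o_def g_integral
    proof (rule integral_dominated_convergence[OF _ _ integrable_quot_0])
      show "AE z::R3 in lborel. (\<lambda>i. F ((norm z)\<^sup>2) / max (R i) (norm z)) \<longlonglongrightarrow> F ((norm z)\<^sup>2) / max r (norm z)"
        using AE_lborel_singleton[of "0::R3"]
      proof eventually_elim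
        fix z :: R3 assume "z \<noteq> 0"
        then have "max r (norm z) \<noteq> 0" by (smt (verit) zero_less_norm_iff)
        then show "(\<lambda>i. F ((norm z)\<^sup>2) / max (R i) (norm z)) \<longlonglongrightarrow> F ((norm z)\<^sup>2) / max r (norm z)"
          by (intro tendsto_intros R)
      qed
      show "AE z::R3 in lborel. norm (F ((norm z)\<^sup>2) / max (R i) (norm z)) \<le> F ((norm z)\<^sup>2) / norm z" for i
        using AE_lborel_singleton[of "0::R3"]
      proof eventually_elim
        fix z :: R3 assume "z \<noteq> 0"
        from quot_le[OF this, of "R i"] quot_nonneg[of z "R i"]
        show "norm (F ((norm z)\<^sup>2) / max (R i) (norm z)) \<le> F ((norm z)\<^sup>2) / norm z" by simp
      qed
    qed measurable
  qed
qed

lemma g_at_top: "(g \<longlongrightarrow> 0) at_top"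
proof -
  have "((\<lambda>r. \<integral>z. F ((norm (z::R3))\<^sup>2) / max r (norm z) \<partial>lborel) \<longlongrightarrow> integral\<^sup>L lborel (\<lambda>z::R3. 0::real)) at_top"
  proof (rule integral_dominated_convergence_at_top[where w = "\<lambda>z::R3. F ((norm z)\<^sup>2) / norm z"])
    show "integrable lborel (\<lambda>z::R3. F ((norm z)\<^sup>2) / norm z)" by (rule integrable_quot_0)
    show "\<forall>\<^sub>F r in at_top. AE z::R3 in lborel. norm (F ((norm z)\<^sup>2) / max r (norm z)) \<le> F ((norm z)\<^sup>2) / norm z"
    proof (rule always_eventually, rule allI)
      fix r :: real
      show "AE z::R3 in lborel. norm (F ((norm z)\<^sup>2) / max r (norm z)) \<le> F ((norm z)\<^sup>2) / norm z"
        using AE_lborel_singleton[of "0::R3"]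
      proof eventually_elim
        fix z :: R3 assume "z \<noteq> 0"
        from quot_le[OF this, of r] quot_nonneg[of z r]
        show "norm (F ((norm z)\<^sup>2) / max r (norm z)) \<le> F ((norm z)\<^sup>2) / norm z" by simp
      qed
    qed
    show "AE z::R3 in lborel. ((\<lambda>r. F ((norm z)\<^sup>2) / max r (norm z)) \<longlongrightarrow> 0) at_top"
    proof (rule AE_I2)
      fix z :: R3
      have "filterlim (\<lambda>r. max r (norm z)) at_top at_top"
        by (rule filterlim_at_top_mono[OF filterlim_ident]) auto
      then show "((\<lambda>r. F ((norm z)\<^sup>2) / max r (norm z)) \<longlongrightarrow> 0) at_top"
        by (intro tendsto_divide_0[OF tendsto_const] filterlim_at_top_imp_at_infinity)
    qed
  qed measurable
  then show ?thesis by (simp add: g_integral[abs_def])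
qed

lemma continuous_F: "continuous_on UNIV F"
proof -
  have "continuous_on UNIV (\<lambda>q. g \<bar>sqrt q\<bar>)"
    by (rule continuous_on_compose2[OF continuous_g, of UNIV "\<lambda>q. \<bar>sqrt q\<bar>"]) (auto intro!: continuous_intros)
  then have "continuous_on UNIV (\<lambda>q. phi (E0 + g \<bar>sqrt q\<bar>))"
    by (intro continuous_on_compose2[OF continuous_phi, of UNIV "\<lambda>q. E0 + g \<bar>sqrt q\<bar>"] continuous_intros) auto
  then show ?thesis by (simp add: F_g[abs_def])
qed

lemma F_antimono: "0 \<le> p \<Longrightarrow> p \<le> q \<Longrightarrow> F q \<le> F p"
  unfolding F_g by (intro phi_mono add_left_mono g_antimono) auto

text \<open>The integrand of g (sqrt Q) in polar coordinates, with \<open>q\<close> the squared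
  radius of a shell.\<close>

definition h :: "real \<Rightarrow> real \<Rightarrow> real" where
  "h Q q = (if q > 0 then 2 * pi * sqrt q * (F q / max (sqrt Q) (sqrt q)) else 0)"

lemma h_nonneg: "0 \<le> h Q q"
  by (auto simp: h_def le_max_iff_disj)

lemma h_measurable [measurable]: "h Q \<in> borel_measurable borel"
  unfolding h_def[abs_def] by measurable

lemma h_integral:
  assumes "Q \<ge> 0"
  shows "integrable lborel (h Q)" and "(\<integral>q. h Q q \<partial>lborel) = g (sqrt Q)"
proof -
  have "U (sqrt Q) = (\<integral>\<^sup>+z. ennreal (F ((norm (z::R3))\<^sup>2) / max (sqrt Q) (sqrt ((norm z)\<^sup>2))) \<partial>lborel)"
    by (simp add: U_def)
  also have "\<dots> = (\<integral>\<^sup>+q. ennreal (2 * pi * sqrt q) * indicator {0<..} q * ennreal (F q / max (sqrt Q) (sqrt q)) \<partial>lborel)"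
    by (rule nn_integral_radial[of "\<lambda>q. ennreal (F q / max (sqrt Q) (sqrt q))"]) measurable
  also have "\<dots> = (\<integral>\<^sup>+q. ennreal (h Q q) \<partial>lborel)"
  proof (intro nn_integral_cong)
    fix q :: real
    show "ennreal (2 * pi * sqrt q) * indicator {0<..} q * ennreal (F q / max (sqrt Q) (sqrt q)) = ennreal (h Q q)"
    proof (cases "q > 0")
      case True
      then have "0 \<le> F q / max (sqrt Q) (sqrt q)" by (simp add: le_max_iff_disj)
      then have "ennreal (2 * pi * sqrt q) * ennreal (F q / max (sqrt Q) (sqrt q))
          = ennreal (2 * pi * sqrt q * (F q / max (sqrt Q) (sqrt q)))"
        using True by (intro ennreal_mult[symmetric]) auto
      moreover have "indicator {0<..} q = (1::ennreal)" using True by simp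
      ultimately show ?thesis by (simp only: h_def True if_True mult_1_right)
    qed (simp add: h_def)
  qed
  finally have U: "U (sqrt Q) = (\<integral>\<^sup>+q. ennreal (h Q q) \<partial>lborel)" .
  have "U (sqrt Q) < \<infinity>"
    unfolding U_def by (subst nn_integral_eq_integral[OF integrable_quot AE_I2[OF quot_nonneg]]) simp
  then show "integrable lborel (h Q)"
    using h_nonneg by (intro integrableI_nonneg) (auto simp: U)
  show "(\<integral>q. h Q q \<partial>lborel) = g (sqrt Q)"
    unfolding g_def U by (rule integral_eq_nn_integral) (use h_nonneg in auto)
qed

text \<open>\<open>m Q\<close> is the mass in the ball of radius \<open>sqrt Q\<close>, and the gradient of the potential turns out to
  be \<open>A (|x|\<^sup>2) x\<close>, relative to the center.  The value \<open>A 0\<close> is the limit that makes \<open>A\<close> continuous.\<close>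

definition m :: "real \<Rightarrow> real" where "m Q = integral {0..Q} (\<lambda>q. 2 * pi * sqrt q * F q)"

definition A :: "real \<Rightarrow> real" where "A Q = (if Q > 0 then m Q / (Q * sqrt Q) else 4 * pi / 3 * F 0)"

lemma continuous_on_F: "continuous_on S F"
  by (rule continuous_on_subset[OF continuous_F]) simp

text \<open>Subtracting the value at the centre cancels the shells beyond radius sqrt Q, whose
  kernel is the same in both integrands; only integrals over a compact interval remain.\<close>

lemma g_sqrt:
  assumes Q: "Q > 0"
  shows "g (sqrt Q) = g 0 - integral {0..Q} (\<lambda>q. 2 * pi * F q) + m Q / sqrt Q"
proof -
  let ?k = "\<lambda>q. 2 * pi * F q - 2 * pi * sqrt q * F q / sqrt Q"
  have cont: "continuous_on {0..Q} ?k" using Q by (intro continuous_intros continuous_on_F) auto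
  have "g 0 - g (sqrt Q) = (\<integral>q. h 0 q - h Q q \<partial>lborel)"
    using h_integral[of 0] h_integral[of Q] Q by simp
  also have "\<dots> = (\<integral>q. indicator {0..Q} q *\<^sub>R ?k q \<partial>lborel)"
  proof (rule integral_cong_AE)
    have "AE q in lborel. q \<noteq> (0::real)" by (rule AE_lborel_singleton)
    then show "AE q in lborel. h 0 q - h Q q = indicator {0..Q} q *\<^sub>R ?k q"
    proof eventually_elim
      fix q :: real assume "q \<noteq> 0"
      then consider "q < 0" | "0 < q" "q \<le> Q" | "0 < q" "q > Q" by linarith
      then show "h 0 q - h Q q = indicator {0..Q} q *\<^sub>R ?k q"
        by cases (auto simp: h_def max_def)
    qed
  qed measurable
  also have "\<dots> = integral {0..Q} ?k"
  proof -
    have "set_integrable lborel {0..Q} ?k"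
      using cont by (intro borel_integrable_atLeastAtMost') auto
    from set_borel_integral_eq_integral(2)[OF this] show ?thesis by (simp add: set_lebesgue_integral_def)
  qed
  also have "\<dots> = integral {0..Q} (\<lambda>q. 2 * pi * F q) - integral {0..Q} (\<lambda>q. 2 * pi * sqrt q * F q / sqrt Q)"
    using Q by (intro Henstock_Kurzweil_Integration.integral_diff integrable_continuous_real continuous_intros continuous_on_F) auto
  also have "integral {0..Q} (\<lambda>q. 2 * pi * sqrt q * F q / sqrt Q) = m Q / sqrt Q"
    unfolding m_def by simp
  finally show ?thesis by simp
qed

lemma DERIV_m: "Q > 0 \<Longrightarrow> (m has_real_derivative 2 * pi * sqrt Q * F Q) (at Q)"
proof -
  assume Q: "Q > 0"
  have "(m has_real_derivative 2 * pi * sqrt Q * F Q) (at Q within {0..Q + 1})"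
    unfolding m_def using Q
    by (intro integral_has_real_derivative continuous_intros continuous_on_F) auto
  moreover have "at Q within {0..Q + 1} = at Q"
    using Q by (intro at_within_interior) auto
  ultimately show ?thesis by simp
qed

lemma DERIV_g_sqrt_pos:
  assumes Q: "Q > 0" shows "((\<lambda>Q. g (sqrt Q)) has_real_derivative - A Q / 2) (at Q)"
proof -
  have "((\<lambda>Q. integral {0..Q} (\<lambda>q. 2 * pi * F q)) has_real_derivative 2 * pi * F Q) (at Q within {0..Q + 1})"
    using Q by (intro integral_has_real_derivative continuous_intros continuous_on_F) auto
  moreover have "at Q within {0..Q + 1} = at Q"
    using Q by (intro at_within_interior) auto
  ultimately have N: "((\<lambda>Q. integral {0..Q} (\<lambda>q. 2 * pi * F q)) has_real_derivative 2 * pi * F Q) (at Q)" by simp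
  have sq: "sqrt Q * sqrt Q = Q" using Q by simp
  have D: "((\<lambda>Q. g 0 - integral {0..Q} (\<lambda>q. 2 * pi * F q) + m Q / sqrt Q) has_real_derivative
      0 - 2 * pi * F Q + (2 * pi * sqrt Q * F Q * sqrt Q - m Q * (inverse (sqrt Q) / 2)) / (sqrt Q * sqrt Q)) (at Q)"
    using Q by (intro DERIV_add DERIV_diff DERIV_const N DERIV_divide DERIV_m DERIV_real_sqrt) auto
  \<comment> \<open>The terms in \<open>F Q\<close> cancel and leave the enclosed mass: outer shells
    exert no force.\<close>
  have "0 - 2 * pi * F Q + (2 * pi * sqrt Q * F Q * sqrt Q - m Q * (inverse (sqrt Q) / 2)) / (sqrt Q * sqrt Q) = - A Q / 2"
  proof -
    have "2 * pi * sqrt Q * F Q * sqrt Q = 2 * pi * F Q * Q" using sq by (simp add: mult_ac)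
    then show ?thesis using Q by (simp add: A_def sq field_simps)
  qed
  with D have D': "((\<lambda>Q. g 0 - integral {0..Q} (\<lambda>q. 2 * pi * F q) + m Q / sqrt Q) has_real_derivative - A Q / 2) (at Q)" by simp
  have ev: "\<forall>\<^sub>F x in nhds Q. g (sqrt x) = g 0 - integral {0..x} (\<lambda>q. 2 * pi * F q) + m x / sqrt x"
  proof (rule eventually_mono)
    show "\<forall>\<^sub>F x in nhds Q. x \<in> {0<..}" using Q by (intro eventually_nhds_in_open) auto
  qed (rule g_sqrt, simp)
  show ?thesis by (rule DERIV_cong_ev[OF refl ev refl, THEN iffD2, OF D'])
qed

text \<open>Since \<open>F\<close> decreases, the mass in the ball lies between its volume 4 pi / 3
  * Q^(3/2) times \<open>F Q\<close> and times \<open>F 0\<close>. This gives the limit of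
  \<open>A\<close> at the centre.\<close>

lemma A_bounds:
  assumes Q: "Q > 0"
  shows "4 * pi / 3 * F Q \<le> A Q" "A Q \<le> 4 * pi / 3 * F 0"
proof -
  have hi: "((\<lambda>q. 2 * pi * sqrt q * c) has_integral 4 * pi / 3 * c * (Q * sqrt Q)) {0..Q}" for c
  proof -
    have "((\<lambda>q. q powr (1/2)) has_integral (Q powr (1/2 + 1) / (1/2 + 1))) {0..Q}"
      using Q by (intro has_integral_powr_from_0) auto
    moreover have "Q powr (1/2 + 1) = Q * sqrt Q" using Q by (subst powr_add) (simp add: powr_half_sqrt)
    ultimately have "((\<lambda>q. q powr (1/2)) has_integral (2/3 * (Q * sqrt Q))) {0..Q}" by (simp add: mult_ac)
    from has_integral_mult_right[OF this, of "2 * pi * c"]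
    have "((\<lambda>q. 2 * pi * c * q powr (1/2)) has_integral 4 * pi / 3 * c * (Q * sqrt Q)) {0..Q}"
      by (simp add: mult_ac)
    then show ?thesis
      by (rule has_integral_eq[rotated]) (auto simp: powr_half_sqrt mult_ac)
  qed
  have hm: "((\<lambda>q. 2 * pi * sqrt q * F q) has_integral m Q) {0..Q}"
    unfolding m_def by (intro integrable_integral integrable_continuous_real continuous_intros continuous_on_F)
  have "4 * pi / 3 * F Q * (Q * sqrt Q) \<le> m Q"
    by (rule has_integral_le[OF hi hm]) (auto intro!: mult_left_mono F_antimono)
  moreover have "m Q \<le> 4 * pi / 3 * F 0 * (Q * sqrt Q)"
    by (rule has_integral_le[OF hm hi]) (auto intro!: mult_left_mono F_antimono)
  ultimately show "4 * pi / 3 * F Q \<le> A Q" "A Q \<le> 4 * pi / 3 * F 0"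
    using Q by (simp_all add: A_def pos_le_divide_eq pos_divide_le_eq)
qed

lemma DERIV_A: "Q > 0 \<Longrightarrow> (A has_real_derivative (4 * pi * F Q - 3 * A Q) / (2 * Q)) (at Q)"
proof -
  assume Q: "Q > 0"
  have sq: "sqrt Q * sqrt Q = Q" using Q by simp
  have D: "((\<lambda>Q. m Q / (Q * sqrt Q)) has_real_derivative
      (2 * pi * sqrt Q * F Q * (Q * sqrt Q) - m Q * (1 * sqrt Q + inverse (sqrt Q) / 2 * Q)) / ((Q * sqrt Q) * (Q * sqrt Q))) (at Q)"
    using Q by (intro DERIV_divide DERIV_m DERIV_mult DERIV_ident DERIV_real_sqrt) auto
  have eq: "(2 * pi * sqrt Q * F Q * (Q * sqrt Q) - m Q * (1 * sqrt Q + inverse (sqrt Q) / 2 * Q)) / ((Q * sqrt Q) * (Q * sqrt Q))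
    = (4 * pi * F Q - 3 * A Q) / (2 * Q)"
  proof -
    define w where "w = sqrt Q"
    have w: "w > 0" "Q = w * w" using Q sq by (auto simp: w_def)
    have A: "A Q = m Q / (Q * w)" using Q by (simp add: A_def w_def)
    show ?thesis unfolding A w_def[symmetric] using w(1) by (simp add: w(2) field_simps)
  qed
  have ev: "\<forall>\<^sub>F x in nhds Q. A x = m x / (x * sqrt x)"
    using eventually_nhds_in_open[of "{0<..}" Q] Q by (auto elim!: eventually_mono simp: A_def)
  show ?thesis by (rule DERIV_cong_ev[OF refl ev refl, THEN iffD2]) (use D eq in simp)
qed

lemma continuous_A: "continuous_on {0..} A"
proof (rule continuous_on_eq_continuous_within[THEN iffD2], intro ballI)
  fix Q :: real assume "Q \<in> {0..}"
  then consider "Q > 0" | "Q = 0" by force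
  then show "continuous (at Q within {0..}) A"
  proof cases
    case 1
    show ?thesis by (rule continuous_at_imp_continuous_at_within, rule DERIV_isCont, rule DERIV_A, rule 1)
  next
    case 2
    have "(F \<longlongrightarrow> F 0) (at 0 within {0..})"
      using continuous_on_F[of "{0..}"] by (simp add: continuous_on_def)
    then have l: "((\<lambda>Q. 4 * pi / 3 * F Q) \<longlongrightarrow> A 0) (at 0 within {0..})"
      by (auto simp: A_def intro!: tendsto_intros)
    have "(A \<longlongrightarrow> A 0) (at 0 within {0..})"
    proof (rule tendsto_sandwich[OF _ _ l])
      show "\<forall>\<^sub>F q in at 0 within {0..}. 4 * pi / 3 * F q \<le> A q"
        using A_bounds(1) by (auto simp: eventually_at_filter intro!: always_eventually)
      show "\<forall>\<^sub>F q in at 0 within {0..}. A q \<le> A 0"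
        using A_bounds(2) by (auto simp: eventually_at_filter A_def[of 0] intro!: always_eventually)
    qed simp
    then show ?thesis using 2 by (simp add: continuous_within)
  qed
qed

lemma DERIV_g_sqrt:
  assumes Q: "Q \<ge> 0" shows "((\<lambda>Q. g (sqrt Q)) has_real_derivative - A Q / 2) (at Q within {0..})"
proof -
  let ?b = "Q + 1"
  have cA: "continuous_on {0..?b} (\<lambda>q. - A q / 2)"
    by (intro continuous_intros continuous_on_subset[OF continuous_A]) auto
  have eq: "g (sqrt p) = g 0 + integral {0..p} (\<lambda>q. - A q / 2)" if "p \<ge> 0" for p
  proof -
    have "((\<lambda>q. - A q / 2) has_integral g (sqrt p) - g (sqrt 0)) {0..p}"
    proof (rule fundamental_theorem_of_calculus_interior[OF that])
      show "continuous_on {0..p} (\<lambda>q. g (sqrt q))"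
        by (rule continuous_on_compose2[OF continuous_g]) (auto intro!: continuous_intros)
      show "((\<lambda>q. g (sqrt q)) has_vector_derivative - A x / 2) (at x)" if "x \<in> {0<..<p}" for x
        using DERIV_g_sqrt_pos[of x] that by (simp add: has_real_derivative_iff_has_vector_derivative)
    qed
    from integral_unique[OF this] show ?thesis by simp
  qed
  have "((\<lambda>p. integral {0..p} (\<lambda>q. - A q / 2)) has_real_derivative - A Q / 2) (at Q within {0..?b})"
    using Q by (intro integral_has_real_derivative cA) auto
  then have "((\<lambda>p. g 0 + integral {0..p} (\<lambda>q. - A q / 2)) has_real_derivative - A Q / 2) (at Q within {0..?b})"
    using DERIV_add[OF DERIV_const] by fastforce
  then have D: "((\<lambda>p. g (sqrt p)) has_real_derivative - A Q / 2) (at Q within {0..?b})"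
    by (rule has_field_derivative_transform_within[where d = 1]) (use Q eq in auto)
  have "at Q within {0..} = at Q within {0..?b}"
  proof (rule at_within_nhd[of Q "{..<?b}"])
    show "{0..} \<inter> {..<?b} - {Q} = {0..?b} \<inter> {..<?b} - {Q}" by auto
  qed auto
  with D show ?thesis by simp
qed

end

section \<open>The steady state\<close>

lemma frechet_derivative_eq: "(f has_derivative f') (at x) \<Longrightarrow> frechet_derivative f (at x) = f'"
  by (rule frechet_derivative_at[symmetric])

context steady_state
begin

section \<open>Gradient and Hessian of the potential\<close>

abbreviation sqdist :: "R3 \<Rightarrow> real" where "sqdist x \<equiv> (norm (x - center))\<^sup>2"

lemma has_derivative_q: "(sqdist has_derivative (\<lambda>v. 2 * ((x - center) \<bullet> v))) (at x)"
  unfolding power2_norm_eq_inner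
  by (auto intro!: derivative_eq_intros simp: inner_commute)

lemma continuous_q: "continuous_on S sqdist"
  by (intro continuous_intros)

lemma has_derivative_Vpot: "(Vpot \<rho> has_derivative (\<lambda>v. A (sqdist x) * ((x - center) \<bullet> v))) (at x)"
proof -
  have "((\<lambda>Q. g (sqrt Q)) has_derivative (*) (- A (sqdist x) / 2)) (at (sqdist x) within {0..})"
    using DERIV_g_sqrt[of "sqdist x"] by (simp add: has_field_derivative_def)
  \<comment> \<open>Squared distances stay in the half-line, so a one-sided derivative at 0 is
    enough.\<close>
  then have "((\<lambda>Q. g (sqrt Q)) has_derivative (*) (- A (sqdist x) / 2)) (at (sqdist x) within range sqdist)"
    by (rule has_derivative_subset) auto
  from has_derivative_minus[OF has_derivative_in_compose[OF has_derivative_q this]]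
  have "((\<lambda>x. - g (sqrt (sqdist x))) has_derivative (\<lambda>v. - (- A (sqdist x) / 2 * (2 * ((x - center) \<bullet> v))))) (at x)" .
  moreover have "(\<lambda>x. - g (sqrt (sqdist x))) = Vpot \<rho>" by (simp add: fun_eq_iff Vpot_g)
  ultimately show ?thesis by simp
qed

lemma grad_Vpot: "grad (Vpot \<rho>) x = A (sqdist x) *\<^sub>R (x - center)"
  by (simp add: grad_def frechet_derivative_eq[OF has_derivative_Vpot] vec_eq_iff inner_axis)

text \<open>For r > 0 this is 2 * r times the derivative of \<open>A\<close>, by
  \<open>DERIV_A\<close>; it is continuous down to 0 and vanishes there.\<close>

definition B :: "real \<Rightarrow> real" where "B r = 4 * pi * F r - 3 * A r"

lemma continuous_B: "continuous_on {0..} B"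
  unfolding B_def[abs_def] by (intro continuous_intros continuous_on_F continuous_A)

lemma B_0: "B 0 = 0" by (simp add: B_def A_def)

lemma continuous_Aq: "continuous_on UNIV (\<lambda>x. A (sqdist x))"
  by (rule continuous_on_compose2[OF continuous_A continuous_q]) auto

lemma continuous_Bq: "continuous_on UNIV (\<lambda>x. B (sqdist x))"
  by (rule continuous_on_compose2[OF continuous_B continuous_q]) auto

text \<open>At the centre the second summand is read as \<open>0\<close>, thanks to \<open>0 / 0 = 0\<close>.\<close>

lemma has_derivative_grad_Vpot:
  "(grad (Vpot \<rho>) has_derivative
     (\<lambda>v. A (sqdist x) *\<^sub>R v + (B (sqdist x) * ((x - center) \<bullet> v) / sqdist x) *\<^sub>R (x - center))) (at x)"
proof (cases "x = center")
  case False
  then have pos: "sqdist x > 0" by simp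
  have "(A has_derivative (*) (B (sqdist x) / (2 * sqdist x))) (at (sqdist x))"
    using DERIV_A[OF pos] by (simp add: has_field_derivative_def B_def)
  from has_derivative_compose[OF has_derivative_q this]
  have "((\<lambda>x. A (sqdist x)) has_derivative (\<lambda>v. B (sqdist x) / (2 * sqdist x) * (2 * ((x - center) \<bullet> v)))) (at x)" .
  then have "((\<lambda>x. A (sqdist x) *\<^sub>R (x - center)) has_derivative
      (\<lambda>v. A (sqdist x) *\<^sub>R v + (B (sqdist x) / (2 * sqdist x) * (2 * ((x - center) \<bullet> v))) *\<^sub>R (x - center))) (at x)"
    by (rule has_derivative_scaleR) (auto intro!: derivative_eq_intros)
  then show ?thesis by (simp add: grad_Vpot[abs_def])
next
  case True
  \<comment> \<open>At the centre the factor \<open>x - center\<close> vanishes, so continuity of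
    \<open>A\<close> alone yields the derivative, \<open>A 0\<close> times the identity.\<close>
  have "((\<lambda>x. A (sqdist x) *\<^sub>R (x - center)) has_derivative (\<lambda>v. A 0 *\<^sub>R v)) (at center)"
    unfolding has_derivative_at_within
  proof (intro conjI)
    show "bounded_linear (\<lambda>v. A 0 *\<^sub>R v :: R3)" by (rule bounded_linear_scaleR_right)
    have "((\<lambda>y. A (sqdist y) - A 0) \<longlongrightarrow> 0) (at center)"
    proof -
      have "isCont (\<lambda>y. A (sqdist y)) center"
        using continuous_Aq by (simp add: continuous_on_eq_continuous_at)
      from tendsto_diff[OF isContD[OF this] tendsto_const[of "A 0"]] show ?thesis by simp
    qed
    then have "((\<lambda>y. \<bar>A (sqdist y) - A 0\<bar>) \<longlongrightarrow> 0) (at center)" by (rule tendsto_rabs_zero)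
    then show "((\<lambda>y. (A (sqdist y) *\<^sub>R (y - center) - A (sqdist center) *\<^sub>R (center - center) - A 0 *\<^sub>R (y - center)) /\<^sub>R norm (y - center)) \<longlongrightarrow> 0) (at center)"
    proof (rule Lim_null_comparison[rotated], intro always_eventually allI)
      fix y
      have "A (sqdist y) *\<^sub>R (y - center) - A (sqdist center) *\<^sub>R (center - center) - A 0 *\<^sub>R (y - center) = (A (sqdist y) - A 0) *\<^sub>R (y - center)"
        by (simp add: scaleR_left_diff_distrib)
      moreover have cancel: "inverse u * (a * u) = a" if "u \<noteq> 0" for a u :: real using that by simp
      ultimately show "norm ((A (sqdist y) *\<^sub>R (y - center) - A (sqdist center) *\<^sub>R (center - center) - A 0 *\<^sub>R (y - center)) /\<^sub>R norm (y - center)) \<le> \<bar>A (sqdist y) - A 0\<bar>"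
        by (cases "y = center") (simp_all add: abs_mult mult.assoc cancel)
    qed
  qed
  then show ?thesis using True by (simp add: grad_Vpot[abs_def])
qed

lemma frechet_grad_Vpot:
  "frechet_derivative (grad (Vpot \<rho>)) (at x) (axis i 1) $ j
    = A (sqdist x) * (if i = j then 1 else 0) + B (sqdist x) * (x - center) $ i / sqdist x * (x - center) $ j"
proof -
  have "axis i (1::real) $ j = (if i = j then 1 else 0)" by (simp add: axis_def)
  then show ?thesis
    by (simp add: frechet_derivative_eq[OF has_derivative_grad_Vpot] inner_axis)
qed

text \<open>The direction factors are bounded by 1 in absolute value, and \<open>B\<close> tends to
  0 at the centre.\<close>

lemma continuous_hessian_term: "continuous_on UNIV (\<lambda>x. B (sqdist x) * (x - center) $ i / sqdist x * (x - center) $ j)"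
proof (rule continuous_at_imp_continuous_on, intro ballI)
  let ?k = "\<lambda>x. B (sqdist x) * (x - center) $ i / sqdist x * (x - center) $ j"
  fix x
  have Bx: "isCont (\<lambda>x. B (sqdist x)) x" using continuous_Bq by (simp add: continuous_on_eq_continuous_at)
  show "isCont ?k x"
  proof (cases "x = center")
    case False
    then have "sqdist x \<noteq> 0" by simp
    then show ?thesis by (intro continuous_intros Bx) auto
  next
    case True
    have "((\<lambda>y. B (sqdist y)) \<longlongrightarrow> B (sqdist center)) (at center)"
      using Bx True by (simp add: isCont_def)
    then have "((\<lambda>y. \<bar>B (sqdist y)\<bar>) \<longlongrightarrow> 0) (at center)" using tendsto_rabs_zero by (simp add: B_0)
    then have "(?k \<longlongrightarrow> 0) (at center)"
    proof (rule Lim_null_comparison[rotated], intro always_eventually allI)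
      fix y
      let ?y = "y - center"
      have "\<bar>?y $ i\<bar> * \<bar>?y $ j\<bar> \<le> sqdist y"
        unfolding power2_eq_square by (intro mult_mono component_le_norm_cart) auto
      then have "\<bar>?y $ i\<bar> * \<bar>?y $ j\<bar> / sqdist y \<le> 1" by (auto simp: divide_le_eq)
      then have "\<bar>B (sqdist y)\<bar> * (\<bar>?y $ i\<bar> * \<bar>?y $ j\<bar> / sqdist y) \<le> \<bar>B (sqdist y)\<bar> * 1" by (intro mult_left_mono) auto
      then show "norm (?k y) \<le> \<bar>B (sqdist y)\<bar>" by (simp add: abs_mult)
    qed
    then show ?thesis using True by (simp add: isCont_def)
  qed
qed

lemma C2_Vpot: "C2 (Vpot \<rho>)"
  unfolding C2_def
proof (intro conjI allI)
  show "Vpot \<rho> differentiable at x" for x using has_derivative_Vpot by (rule differentiableI)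
  show "grad (Vpot \<rho>) differentiable at x" for x using has_derivative_grad_Vpot by (rule differentiableI)
  show "continuous_on UNIV (\<lambda>x. frechet_derivative (grad (Vpot \<rho>)) (at x) (axis i 1) $ j)" for i j
    unfolding frechet_grad_Vpot by (intro continuous_intros continuous_Aq continuous_hessian_term)
qed

lemma lap_Vpot: "lap (Vpot \<rho>) x = 4 * pi * F (sqdist x)"
proof -
  have "lap (Vpot \<rho>) x = (\<Sum>i\<in>UNIV. A (sqdist x) + B (sqdist x) * (x - center) $ i / sqdist x * (x - center) $ i)"
    by (simp add: lap_def divg_def frechet_grad_Vpot)
  also have "\<dots> = 3 * A (sqdist x) + B (sqdist x) / sqdist x * (\<Sum>i\<in>UNIV. (x - center) $ i * (x - center) $ i)"
    by (simp add: sum.distrib sum_distrib_left sum_divide_distrib mult_ac)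
  also have "(\<Sum>i\<in>UNIV. (x - center) $ i * (x - center) $ i) = sqdist x"
    unfolding power2_norm_eq_inner inner_vec_def by simp
  also have "3 * A (sqdist x) + B (sqdist x) / sqdist x * sqdist x = 4 * pi * F (sqdist x)"
    using B_0 by (cases "sqdist x = 0") (auto simp: B_def A_def)
  finally show ?thesis .
qed

lemma phi_Vpot: "phi (E0 - Vpot \<rho> x) = F (sqdist x)"
  by (simp add: Vpot_g F_g)

section \<open>Decay of the density and the sign of the multiplier\<close>

lemma mass_lower_bound:
  assumes "r > 0" shows "F (r\<^sup>2) * (4 / 3 * pi * r ^ 3) \<le> M"
proof -
  have "ennreal (F (r\<^sup>2) * (4 / 3 * pi * r ^ 3)) = (\<integral>\<^sup>+z. ennreal (F (r\<^sup>2)) * indicator (ball (0::R3) r) z \<partial>lborel)"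
    using assms by (subst nn_integral_cmult_indicator) (auto simp: emeasure_ball unit_ball_vol_3 simp flip: ennreal_mult)
  also have "\<dots> \<le> (\<integral>\<^sup>+z. ennreal (F ((norm (z::R3))\<^sup>2)) \<partial>lborel)"
  proof (rule nn_integral_mono)
    fix z :: R3
    show "ennreal (F (r\<^sup>2)) * indicator (ball 0 r) z \<le> ennreal (F ((norm z)\<^sup>2))"
    proof (cases "norm z < r")
      case True
      then have "(norm z)\<^sup>2 \<le> r\<^sup>2" by (intro power_mono) auto
      then show ?thesis using True by (auto intro!: ennreal_leI F_antimono)
    qed simp
  qed
  also have "\<dots> = ennreal M" by (rule integrable_profile)
  finally show ?thesis using M_pos by (simp add: ennreal_le_iff)
qed

text \<open>By \<open>mass_lower_bound\<close> the profile is at most of order r^(-3).\<close>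

lemma no_slow_decay:
  assumes k: "k > 0" and a: "a < 3" and le: "\<And>r. r \<ge> R \<Longrightarrow> k * r powr (- a) \<le> F (r\<^sup>2)"
  shows False
proof -
  define c where "c = k * (4 / 3 * pi)"
  have c: "c > 0" using k by (simp add: c_def)
  \<comment> \<open>Chosen so that the mass estimate at this radius reads 2 * M \<le> M.\<close>
  define r where "r = max (max R 1) ((2 * M / c) powr (1 / (3 - a)))"
  have r: "r \<ge> R" "r > 0" by (auto simp: r_def)
  have "2 * M / c = ((2 * M / c) powr (1 / (3 - a))) powr (3 - a)"
    using a c M_pos by (simp add: powr_powr)
  also have "\<dots> \<le> r powr (3 - a)" using a by (intro powr_mono2) (auto simp: r_def)
  finally have "2 * M \<le> c * r powr (3 - a)" using c by (simp add: pos_divide_le_eq mult.commute)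
  also have "r powr (3 - a) = r powr (- a) * r ^ 3"
    using r by (simp add: powr_diff powr_minus_divide powr_numeral)
  also have "c * (r powr (- a) * r ^ 3) = (k * r powr (- a)) * (4 / 3 * pi * r ^ 3)" by (simp add: c_def)
  also have "\<dots> \<le> F (r\<^sup>2) * (4 / 3 * pi * r ^ 3)" using le[OF r(1)] r by (intro mult_right_mono) auto
  also have "\<dots> \<le> M" by (rule mass_lower_bound[OF r(2)])
  finally show False using M_pos by simp
qed

text \<open>As \<open>g\<close> is nonnegative, a positive multiplier would keep the density above
  the positive constant \<open>phi E0\<close> everywhere.\<close>

lemma E0_nonpos: "E0 \<le> 0"
proof (rule ccontr)
  assume "\<not> E0 \<le> 0"
  then have pos: "phi E0 > 0" by (intro phi_pos) simp
  show False
  proof (rule no_slow_decay[OF pos, of 0 1])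
    fix r :: real assume "r \<ge> 1"
    then show "phi E0 * r powr (- 0) \<le> F (r\<^sup>2)" by (simp add: F_g phi_mono)
  qed simp
qed

lemma g_1_pos: "g 1 > 0"
proof (rule ccontr)
  assume "\<not> g 1 > 0"
  then have "g 1 = 0" using g_nonneg[of 1] by linarith
  then have "AE z::R3 in lborel. F ((norm z)\<^sup>2) / max 1 (norm z) = 0"
    unfolding g_integral using integral_nonneg_eq_0_iff_AE[OF integrable_quot AE_I2[OF quot_nonneg]] by simp
  then have "AE z::R3 in lborel. ennreal (F ((norm z)\<^sup>2)) = 0"
    by eventually_elim (auto simp: max_def split: if_splits)
  then have "(\<integral>\<^sup>+z. ennreal (F ((norm (z::R3))\<^sup>2)) \<partial>lborel) = 0"
    by (subst nn_integral_0_iff_AE) auto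
  then show False using integrable_profile(1) M_pos by simp
qed

text \<open>For r \<ge> 1 one has max r |z| \<le> r * max 1 |z|, so the value at radius 1 can serve
  as the constant of the Coulomb tail.\<close>

lemma g_lower_bound: "r \<ge> 1 \<Longrightarrow> g 1 / r \<le> g r"
proof -
  assume r: "r \<ge> 1"
  have "g 1 / r = (\<integral>z. F ((norm (z::R3))\<^sup>2) / max 1 (norm z) / r \<partial>lborel)"
    unfolding g_integral[of 1] by (rule integral_divide_zero[symmetric])
  also have "\<dots> \<le> (\<integral>z. F ((norm (z::R3))\<^sup>2) / max r (norm z) \<partial>lborel)"
  proof (rule integral_mono)
    show "integrable lborel (\<lambda>z::R3. F ((norm z)\<^sup>2) / max 1 (norm z) / r)"
      by (intro integrable_divide integrable_quot)
    fix z :: R3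
    have "max r (norm z) \<le> max 1 (norm z) * r"
    proof -
      have "1 * r \<le> max 1 (norm z) * r" "max 1 (norm z) * 1 \<le> max 1 (norm z) * r"
        using r by (intro mult_right_mono mult_left_mono; simp)+
      then show ?thesis by auto
    qed
    then have "F ((norm z)\<^sup>2) / (max 1 (norm z) * r) \<le> F ((norm z)\<^sup>2) / max r (norm z)"
      using r by (intro divide_left_mono mult_pos_pos) auto
    then show "F ((norm z)\<^sup>2) / max 1 (norm z) / r \<le> F ((norm z)\<^sup>2) / max r (norm z)" by simp
  qed (auto intro: integrable_quot)
  also have "\<dots> = g r" by (simp add: g_integral)
  finally show ?thesis .
qed

lemma E0_neg:
  assumes n': "0 < n'" "n' < 3" and C: "C > 0" and \<delta>: "\<delta> > 0"
    and le: "\<And>r. 0 \<le> r \<Longrightarrow> r \<le> \<delta> \<Longrightarrow> dPhi r \<le> C * r powr (1 / n')"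
  shows "E0 < 0"
proof (rule ccontr)
  assume "\<not> E0 < 0"
  then have E0: "E0 = 0" using E0_nonpos by simp
  define k where "k = g 1 / C"
  have k: "k > 0" using g_1_pos C by (simp add: k_def)
  have d: "dPhi \<delta> > 0" using dPhi_strict_mono[of 0 \<delta>] \<delta> by simp
  \<comment> \<open>Beyond this radius phi (g 1 / r) is at most \<delta>, where the assumed bound on
    \<open>dPhi\<close> applies.\<close>
  define R where "R = max 1 (g 1 / dPhi \<delta>)"
  show False
  proof (rule no_slow_decay[of "k powr n'" n' R])
    fix r assume r: "r \<ge> R"
    then have r1: "r \<ge> 1" "g 1 \<le> dPhi \<delta> * r" using d by (auto simp: R_def pos_divide_le_eq mult.commute)
    define s where "s = phi (g 1 / r)"
    have ds: "dPhi s = g 1 / r" using g_1_pos r1 by (simp add: s_def dPhi_phi)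
    have "s \<le> \<delta>" unfolding s_def
      using r1 \<delta> g_1_pos by (subst phi_le_iff) (auto simp: pos_divide_le_eq)
    then have "g 1 / r \<le> C * s powr (1 / n')" using le[of s] ds by (simp add: s_def)
    then have "k / r \<le> s powr (1 / n')" using C r1 by (simp add: k_def field_simps)
    then have "(k / r) powr n' \<le> (s powr (1 / n')) powr n'" using k r1 n' by (intro powr_mono2) auto
    also have "\<dots> = s" using n' by (simp add: powr_powr s_def)
    finally have "k powr n' * r powr (- n') \<le> s"
      using k r1 by (simp add: powr_divide powr_minus_divide)
    also have "s \<le> F (r\<^sup>2)"
      unfolding s_def F_g E0 using g_lower_bound[OF r1(1)] r1 by (intro phi_mono) simp
    finally show "k powr n' * r powr (- n') \<le> F (r\<^sup>2)" .
  qed (use k n' in auto)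
qed

lemma compact_support:
  assumes "E0 < 0" shows "compact (closure {x. F (sqdist x) \<noteq> 0})"
proof -
  have "\<forall>\<^sub>F r in at_top. g r < - E0" using order_tendstoD(2)[OF g_at_top] assms by simp
  then obtain R where R: "\<And>r. r \<ge> R \<Longrightarrow> g r < - E0" by (auto simp: eventually_at_top_linorder)
  have "{x. F (sqdist x) \<noteq> 0} \<subseteq> cball center \<bar>R\<bar>"
  proof
    fix x assume "x \<in> {x. F (sqdist x) \<noteq> 0}"
    then have "\<not> E0 + g (norm (x - center)) \<le> 0" by (auto simp: F_g)
    then have "norm (x - center) < R" using R[of "norm (x - center)"] by linarith
    then show "x \<in> cball center \<bar>R\<bar>" by (simp add: dist_norm norm_minus_commute)
  qed
  then show ?thesis using bounded_subset[OF bounded_cball] by (simp add: compact_closure)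
qed

section \<open>Behaviour at infinity, mass and the Euler-Poisson equations\<close>

lemma Vpot_at_infinity: "(Vpot \<rho> \<longlongrightarrow> 0) at_infinity"
proof -
  have "filterlim (\<lambda>x::R3. norm (x - center)) at_top at_infinity"
  proof (rule filterlim_at_top_mono)
    show "filterlim (\<lambda>x::R3. - norm center + norm x) at_top at_infinity"
      by (intro filterlim_tendsto_add_at_top[OF tendsto_const] filterlim_norm_at_top)
    show "\<forall>\<^sub>F x in at_infinity. - norm center + norm x \<le> norm (x - center)"
    proof (intro always_eventually allI)
      fix x show "- norm center + norm x \<le> norm (x - center)" using norm_triangle_ineq2[of x center] by linarith
    qed
  qed
  from tendsto_minus[OF filterlim_compose[OF g_at_top this]]
  show ?thesis by (simp add: Vpot_g[abs_def])
qed

text \<open>An identity at every point: the formula of the theorem is the continuous radial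
  representative, and only its agreement with \<rho> is almost everywhere.\<close>

lemma density_profile:
  "(\<lambda>x. if Vpot \<rho> x < E0 then inv_into {0..} dPhi (E0 - Vpot \<rho> x) else 0) = (\<lambda>x. F (sqdist x))"
proof
  fix x
  have "F (sqdist x) = phi (E0 - Vpot \<rho> x)" by (simp add: phi_Vpot)
  moreover have "inv_into {0..} dPhi 0 = 0" using phi_nonpos[of 0] by (simp add: phi_def)
  ultimately show "(if Vpot \<rho> x < E0 then inv_into {0..} dPhi (E0 - Vpot \<rho> x) else 0) = F (sqdist x)"
    by (cases "Vpot \<rho> x < E0") (simp_all add: phi_def[of "E0 - Vpot \<rho> x"])
qed

lemma mass_profile: "integrable lborel (\<lambda>x. F (sqdist x))" "(\<integral>x. F (sqdist x) \<partial>lborel) = M"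
proof -
  have m: "(\<lambda>x. F (sqdist x)) \<in> borel_measurable lborel" by measurable
  show "integrable lborel (\<lambda>x. F (sqdist x))"
    using integrable_cong_AE[OF _ m rho_eq_F] rho(1) by simp
  show "(\<integral>x. F (sqdist x) \<partial>lborel) = M"
    using integral_cong_AE[OF _ m rho_eq_F] rho(4) by simp
qed

text \<open>Going through \<open>psi\<close> avoids differentiating the density, which is only known
  to be continuous.\<close>

lemma has_derivative_pressure:
  assumes Phi_C2: "\<And>r. r > 0 \<Longrightarrow> (dPhi has_real_derivative ddPhi r) (at r)"
  shows "((\<lambda>x. integral {0..F (sqdist x)} (\<lambda>\<sigma>. \<sigma> * ddPhi \<sigma>)) has_derivative
    (\<lambda>v. F (sqdist x) * (- (A (sqdist x) * ((x - center) \<bullet> v))))) (at x)"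
proof -
  have "((\<lambda>x. E0 - Vpot \<rho> x) has_derivative (\<lambda>v. - (A (sqdist x) * ((x - center) \<bullet> v)))) (at x)"
    using has_derivative_diff[OF has_derivative_const has_derivative_Vpot] by simp
  moreover have "(psi has_derivative (*) (F (sqdist x))) (at (E0 - Vpot \<rho> x))"
    using DERIV_psi[of "E0 - Vpot \<rho> x"] by (simp add: has_field_derivative_def phi_Vpot)
  ultimately have "((\<lambda>x. psi (E0 - Vpot \<rho> x)) has_derivative (\<lambda>v. F (sqdist x) * (- (A (sqdist x) * ((x - center) \<bullet> v))))) (at x)"
    by (rule has_derivative_compose)
  then show ?thesis by (simp add: pressure_phi[OF Phi_C2] flip: phi_Vpot)
qed

lemma EP_solution_profile:
  assumes Phi_C2: "\<And>r. r > 0 \<Longrightarrow> (dPhi has_real_derivative ddPhi r) (at r)"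
  shows "EP_solution (\<lambda>r. integral {0..r} (\<lambda>\<sigma>. \<sigma> * ddPhi \<sigma>)) (\<lambda>t x. F (sqdist x)) (\<lambda>t x. 0) (\<lambda>t x. Vpot \<rho> x)"
proof -
  note P = has_derivative_pressure[OF Phi_C2]
  \<comment> \<open>Hydrostatic balance, which is all that remains of the momentum equation at zero
    velocity.\<close>
  have "grad (\<lambda>x. integral {0..F (sqdist x)} (\<lambda>\<sigma>. \<sigma> * ddPhi \<sigma>)) x = - F (sqdist x) *\<^sub>R grad (Vpot \<rho>) x" for x
    unfolding grad_Vpot by (simp add: grad_def frechet_derivative_eq[OF P] vec_eq_iff inner_axis)
  moreover have "frechet_derivative (\<lambda>x. 0) (at x) = (\<lambda>v. 0 :: R3)" for x :: R3
    by (rule frechet_derivative_eq) (rule has_derivative_const)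
  moreover have "(\<lambda>x. integral {0..F (sqdist x)} (\<lambda>\<sigma>. \<sigma> * ddPhi \<sigma>)) differentiable at x" for x
    using P by (rule differentiableI)
  moreover have "Vpot \<rho> differentiable at x" "grad (Vpot \<rho>) differentiable at x" for x
    using C2_Vpot by (auto simp: C2_def)
  ultimately show ?thesis
    unfolding EP_solution_def by (simp add: lap_Vpot Vpot_at_infinity divg_def)
qed

end

theorem theorem2:
  fixes \<Phi> dPhi ddPhi :: "real \<Rightarrow> real"
    and M n n' :: real
    and \<rho>0 :: "R3 \<Rightarrow> real"
  assumes M_pos: "M > 0"
    and Phi_C1: "\<And>r. r \<ge> 0 \<Longrightarrow> (\<Phi> has_real_derivative dPhi r) (at r within {0..})"
    and dPhi_cont: "continuous_on {0..} dPhi"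
    and Phi_C2: "\<And>r. r > 0 \<Longrightarrow> (dPhi has_real_derivative ddPhi r) (at r)"
    and ddPhi_cont: "continuous_on {0<..} ddPhi"
    and Phi0: "\<Phi> 0 = 0" and dPhi0: "dPhi 0 = 0"
    and Phi1: "strict_convex_on {0..} \<Phi>"
    and n: "0 < n" "n < 3"
    and Phi2: "\<exists>C>0. \<exists>R. \<forall>r. r \<ge> R \<longrightarrow> \<Phi> r \<ge> C * r powr (1 + 1/n)"
    and n': "0 < n'" "n' < 3"
    and Phi3: "\<exists>C>0. \<exists>\<delta>>0. \<forall>r. 0 \<le> r \<and> r \<le> \<delta> \<longrightarrow> \<Phi> r \<le> C * r powr (1 + 1/n')"
    and min: "is_minimizer \<Phi> M \<rho>0"
  shows "\<exists>E0 \<le> 0.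
     (let V0 = Vpot \<rho>0;
          \<rho>r = (\<lambda>x. if V0 x < E0 then inv_into {0..} dPhi (E0 - V0 x) else 0)
      in (AE x in lborel. \<rho>0 x = \<rho>r x) \<and>
         (\<exists>x0 f g. (\<forall>x. \<rho>r x = f (norm (x - x0)) \<and> V0 x = g (norm (x - x0))) \<and>
                   antimono_on {0..} f \<and> mono_on {0..} g) \<and>
         continuous_on UNIV \<rho>r \<and> integrable lborel \<rho>r \<and> (\<integral>x. \<rho>r x \<partial>lborel) = M \<and>
         C2 V0 \<and> (V0 \<longlongrightarrow> 0) at_infinity \<and>
         EP_solution (\<lambda>r. integral {0..r} (\<lambda>\<sigma>. \<sigma> * ddPhi \<sigma>))
            (\<lambda>t x. \<rho>r x) (\<lambda>t x. 0) (\<lambda>t x. V0 x) \<and>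
         ((\<exists>C>0. \<exists>\<delta>>0. \<forall>r. 0 \<le> r \<and> r \<le> \<delta> \<longrightarrow> dPhi r \<le> C * r powr (1/n'))
            \<longrightarrow> E0 < 0 \<and> compact (closure {x. \<rho>r x \<noteq> 0})))"
proof -
  interpret steady_state \<Phi> dPhi n M \<rho>0
    using assms by unfold_locales auto
  have profile: "(if Vpot \<rho>0 x < E0 then inv_into {0..} dPhi (E0 - Vpot \<rho>0 x) else 0) = F (sqdist x)" for x
    using fun_cong[OF density_profile] .
  have radial: "\<exists>x0 f g. (\<forall>x. F (sqdist x) = f (norm (x - x0)) \<and> Vpot \<rho>0 x = g (norm (x - x0))) \<and>
      antimono_on {0..} f \<and> mono_on {0..} g"
  proof (intro exI conjI allI)
    show "F (sqdist x) = (\<lambda>r. F (r\<^sup>2)) (norm (x - center))" for x by simp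
    show "Vpot \<rho>0 x = (\<lambda>r. - g r) (norm (x - center))" for x by (simp add: Vpot_g)
    show "antimono_on {0..} (\<lambda>r. F (r\<^sup>2))"
      by (intro monotone_onI F_antimono power_mono) auto
    show "mono_on {0..} (\<lambda>r. - g r)"
      by (intro mono_onI) (simp add: g_antimono)
  qed
  have cont: "continuous_on UNIV (\<lambda>x. F (sqdist x))"
    by (rule continuous_on_compose2[OF continuous_F continuous_q]) simp
  have support: "E0 < 0 \<and> compact (closure {x. F (sqdist x) \<noteq> 0})"
    if "\<exists>C>0. \<exists>\<delta>>0. \<forall>r. 0 \<le> r \<and> r \<le> \<delta> \<longrightarrow> dPhi r \<le> C * r powr (1/n')"
    using that E0_neg[OF n'] compact_support by blast
  show ?thesis
    by (intro exI[of _ E0], unfold Let_def profile)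
      (intro conjI impI E0_nonpos rho_eq_F radial cont mass_profile C2_Vpot Vpot_at_infinity
        EP_solution_profile[OF Phi_C2] support)
qed

end
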